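(* If $\mathcal{A}$ is a (complex) $C^*$-algebra with property $(\ddagger)$, then $\mathcal{A}$ satisfies Lim's condition.
   Context: All Banach spaces are complex. For a Banach space $X$, $B(X)$ denotes its closed unit ball and $X^*$ its dual. A functional $\phi\in X^*$ is norm-attaining if there is $x\in B(X)$ with $|\phi(x)|=\|\phi\|$. $X$ has property $(\ddagger)$ if for every $0<\varepsilon<2$ the following holds: whenever $\{\phi_\alpha\}$ is a net of norm-attaining functionals in $B(X^* )$ with $\|\phi_\alpha-\phi_\beta\|\ge\varepsilon$ for all $\alpha\ne\beta$, and $\phi\in B(X^* )$ is norm-attaining with $\phi_\alpha\to\phi$ in the weak* topology, then $\|\phi\|\le 1-\varepsilon/2$. In this definition nets are indexed by directed sets without a greatest element. $X$ satisfies Lim's condition if for every $s\ge 0$, every net $\{\phi_\alpha\}$ in $X^*$ with $\|\phi_\alpha\|=s$ for all $\alpha$ and $\phi_\alpha\to 0$ weak*, and every $\phi\in X^*$, one has $\lim_\alpha\|\phi_\alpha+\phi\|=s+\|\phi\|$. *)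

theory Defs
  imports "HOL-Analysis.Analysis"
begin

section \<open>Complex Banach spaces and C*-algebras\<close>

class complex_banach = banach +
  fixes scaleC :: "complex \<Rightarrow> 'a \<Rightarrow> 'a" (infixr "*\<^sub>C" 75)
  assumes scaleC_add_right: "c *\<^sub>C (x + y) = c *\<^sub>C x + c *\<^sub>C y"
    and scaleC_add_left: "(c + d) *\<^sub>C x = c *\<^sub>C x + d *\<^sub>C x"
    and scaleC_scaleC: "c *\<^sub>C d *\<^sub>C x = (c * d) *\<^sub>C x"
    and scaleC_one: "1 *\<^sub>C x = x"
    and scaleR_scaleC: "r *\<^sub>R x = complex_of_real r *\<^sub>C x"
    and norm_scaleC: "norm (c *\<^sub>C x) = cmod c * norm x"

text \<open>
  No unit is assumed: the class \<open>real_normed_algebra\<close> only asks for an associative bilinear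
  product with submultiplicative norm.
\<close>

class cstar_algebra = complex_banach + real_normed_algebra +
  fixes cstar :: "'a \<Rightarrow> 'a"
  assumes mult_scaleC_left: "(c *\<^sub>C x) * y = c *\<^sub>C (x * y)"
    and mult_scaleC_right: "x * (c *\<^sub>C y) = c *\<^sub>C (x * y)"
    and cstar_cstar: "cstar (cstar x) = x"
    and cstar_add: "cstar (x + y) = cstar x + cstar y"
    and cstar_scaleC: "cstar (c *\<^sub>C x) = cnj c *\<^sub>C cstar x"
    and cstar_mult: "cstar (x * y) = cstar y * cstar x"
    and cstar_norm: "norm (cstar x * x) = (norm x)\<^sup>2"


section \<open>The dual space and its weak* topology\<close>

text \<open>
  The type \<open>'a \<Rightarrow>\<^sub>L complex\<close> consists of the bounded real-linear maps, so the dual is cut out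
  by complex homogeneity; the norm of the type is the operator norm.
\<close>

definition dual_space :: "('a::complex_banach \<Rightarrow>\<^sub>L complex) set" where
  "dual_space = {\<phi>. \<forall>c x. blinfun_apply \<phi> (c *\<^sub>C x) = c * blinfun_apply \<phi> x}"

definition norm_attaining :: "('a::complex_banach \<Rightarrow>\<^sub>L complex) \<Rightarrow> bool" where
  "norm_attaining \<phi> \<longleftrightarrow> (\<exists>x\<in>cball 0 1. cmod (blinfun_apply \<phi> x) = norm \<phi>)"

text \<open>
  The strong operator topology is the topology of pointwise convergence, which on functionals
  is the weak* topology; see \<open>limitin_weak_star_iff\<close>.
\<close>

definition weak_star_topology :: "('a::complex_banach \<Rightarrow>\<^sub>L complex) topology" where
  "weak_star_topology = subtopology strong_operator_topology dual_space"

lemma limitin_weak_star_iff: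
  "limitin weak_star_topology f \<phi> F \<longleftrightarrow>
     \<phi> \<in> dual_space \<and> (\<forall>\<^sub>F i in F. f i \<in> dual_space) \<and>
     (\<forall>x. ((\<lambda>i. blinfun_apply (f i) x) \<longlongrightarrow> blinfun_apply \<phi> x) F)"
proof -
  have "limitin strong_operator_topology f \<phi> F \<longleftrightarrow>
          (\<forall>x. ((\<lambda>i. blinfun_apply (f i) x) \<longlongrightarrow> blinfun_apply \<phi> x) F)" (is "?L \<longleftrightarrow> ?R")
  proof
    assume ?L
    show ?R
    proof
      fix x
      show "((\<lambda>i. blinfun_apply (f i) x) \<longlongrightarrow> blinfun_apply \<phi> x) F"
        using continuous_map_limit[OF strong_operator_topology_continuous_evaluation \<open>?L\<close>, of x]
        by (simp add: o_def)
    qed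
  next
    assume ?R
    then have "limitin (product_topology (\<lambda>_. euclidean) UNIV)
        (\<lambda>i. blinfun_apply (f i)) (blinfun_apply \<phi>) F"
      by (simp add: limitin_componentwise)
    then have lim: "limitin euclidean (\<lambda>i. blinfun_apply (f i)) (blinfun_apply \<phi>) F"
      by (simp add: euclidean_product_topology)
    show ?L
      unfolding limitin_def
    proof (intro conjI allI impI)
      show "\<phi> \<in> topspace strong_operator_topology"
        by (simp add: strong_operator_topology_topspace)
      fix U assume "openin strong_operator_topology U \<and> \<phi> \<in> U"
      then obtain V where V: "open V" "U = blinfun_apply -` V" "\<phi> \<in> U"
        by (auto simp: strong_operator_topology_def openin_pullback_topology)
      with lim have "\<forall>\<^sub>F i in F. blinfun_apply (f i) \<in> V"
        by (auto simp: limitin_def)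
      with V show "\<forall>\<^sub>F i in F. f i \<in> U"
        by simp
    qed
  qed
  then show ?thesis
    by (simp add: weak_star_topology_def limitin_subtopology)
qed


section \<open>Nets\<close>

text \<open>
  A net is a function on the carrier \<open>I\<close> of a directed set; values outside \<open>I\<close> are irrelevant.
\<close>

definition directed_set :: "'i set \<Rightarrow> ('i \<Rightarrow> 'i \<Rightarrow> bool) \<Rightarrow> bool" where
  "directed_set I le \<longleftrightarrow>
     I \<noteq> {} \<and> reflp_on I le \<and> transp_on I le \<and> (\<forall>i\<in>I. \<forall>j\<in>I. \<exists>k\<in>I. le i k \<and> le j k)"

definition has_greatest :: "'i set \<Rightarrow> ('i \<Rightarrow> 'i \<Rightarrow> bool) \<Rightarrow> bool" where
  "has_greatest I le \<longleftrightarrow> (\<exists>m\<in>I. \<forall>i\<in>I. le i m)"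

definition net_filter :: "'i set \<Rightarrow> ('i \<Rightarrow> 'i \<Rightarrow> bool) \<Rightarrow> 'i filter" where
  "net_filter I le = (INF i\<in>I. principal {j\<in>I. le i j})"

lemma eventually_net_filter:
  assumes "directed_set I le"
  shows "eventually P (net_filter I le) \<longleftrightarrow> (\<exists>i\<in>I. \<forall>j\<in>I. le i j \<longrightarrow> P j)"
  unfolding net_filter_def
proof (subst eventually_INF_base)
  show "I \<noteq> {}"
    using assms by (simp add: directed_set_def)
next
  fix i j assume ij: "i \<in> I" "j \<in> I"
  with assms obtain k where k: "k \<in> I" "le i k" "le j k"
    by (auto simp: directed_set_def)
  have "le i l \<and> le j l" if "l \<in> I" "le k l" for l
    using assms ij k that unfolding directed_set_def by (meson transp_onD)
  then show "\<exists>k\<in>I. principal {l \<in> I. le k l} \<le>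
      inf (principal {l \<in> I. le i l}) (principal {l \<in> I. le j l})"
    using k(1) by (intro bexI[of _ k]) auto
qed (auto simp: eventually_principal)


section \<open>The two properties\<close>

text \<open>
  The argument of type \<open>'i itself\<close> fixes the type from which index sets are drawn.
\<close>

definition ddagger_nets :: "'i itself \<Rightarrow> 'a::complex_banach itself \<Rightarrow> bool" where
  "ddagger_nets _ _ \<longleftrightarrow>
     (\<forall>\<epsilon>::real. 0 < \<epsilon> \<and> \<epsilon> < 2 \<longrightarrow>
       (\<forall>(I :: 'i set) le (f :: 'i \<Rightarrow> 'a \<Rightarrow>\<^sub>L complex) \<phi>.
          directed_set I le \<and> \<not> has_greatest I le \<and>
          (\<forall>i\<in>I. f i \<in> dual_space \<and> norm (f i) \<le> 1 \<and> norm_attaining (f i)) \<and>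
          (\<forall>i\<in>I. \<forall>j\<in>I. i \<noteq> j \<longrightarrow> norm (f i - f j) \<ge> \<epsilon>) \<and>
          \<phi> \<in> dual_space \<and> norm \<phi> \<le> 1 \<and> norm_attaining \<phi> \<and>
          limitin weak_star_topology f \<phi> (net_filter I le)
          \<longrightarrow> norm \<phi> \<le> 1 - \<epsilon> / 2))"

text \<open>
  A hypothesis cannot quantify over all index types, but the nets in question are injective, so
  index sets contained in the dual itself suffice; see \<open>property_ddagger_imp_ddagger_nets\<close>.
\<close>

definition property_ddagger :: "'a::complex_banach itself \<Rightarrow> bool" where
  "property_ddagger A \<longleftrightarrow> ddagger_nets TYPE('a \<Rightarrow>\<^sub>L complex) A"

lemma property_ddagger_imp_ddagger_nets:
  assumes "property_ddagger TYPE('a::complex_banach)"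
  shows "ddagger_nets TYPE('i) TYPE('a)"
  unfolding ddagger_nets_def
proof (intro allI impI, elim conjE)
  fix \<epsilon> :: real and I :: "'i set" and le and f :: "'i \<Rightarrow> 'a \<Rightarrow>\<^sub>L complex" and \<phi>
  assume eps: "0 < \<epsilon>" "\<epsilon> < 2"
    and dir: "directed_set I le" and ngr: "\<not> has_greatest I le"
    and f: "\<forall>i\<in>I. f i \<in> dual_space \<and> norm (f i) \<le> 1 \<and> norm_attaining (f i)"
    and sep: "\<forall>i\<in>I. \<forall>j\<in>I. i \<noteq> j \<longrightarrow> norm (f i - f j) \<ge> \<epsilon>"
    and phi: "\<phi> \<in> dual_space" "norm \<phi> \<le> 1" "norm_attaining \<phi>"
    and lim: "limitin weak_star_topology f \<phi> (net_filter I le)"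
  have inj: "inj_on f I"
  proof (rule inj_onI, rule ccontr)
    fix i j assume "i \<in> I" "j \<in> I" "f i = f j" "i \<noteq> j"
    then have "\<epsilon> \<le> norm (f i - f j)"
      using sep by blast
    then show False
      using eps \<open>f i = f j\<close> by simp
  qed
  define g where "g = inv_into I f"
  define le' where "le' = (\<lambda>x y. le (g x) (g y))"
  have g: "g (f i) = i" if "i \<in> I" for i
    using that inj by (simp add: g_def)
  have dir': "directed_set (f ` I) le'"
    unfolding directed_set_def
  proof (intro conjI)
    show "f ` I \<noteq> {}"
      using dir by (simp add: directed_set_def)
    show "reflp_on (f ` I) le'"
      using dir by (auto simp: directed_set_def le'_def g intro!: reflp_onI dest: reflp_onD)
    show "transp_on (f ` I) le'"
    proof (rule transp_onI)
      fix x y z assume "x \<in> f ` I" "y \<in> f ` I" "z \<in> f ` I" "le' x y" "le' y z"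
      moreover from this have "g x \<in> I" "g y \<in> I" "g z \<in> I"
        using g by auto
      ultimately show "le' x z"
        using dir unfolding directed_set_def le'_def by (blast dest: transp_onD)
    qed
    show "\<forall>x\<in>f ` I. \<forall>y\<in>f ` I. \<exists>z\<in>f ` I. le' x z \<and> le' y z"
      using dir by (simp add: directed_set_def le'_def g)
  qed
  have ngr': "\<not> has_greatest (f ` I) le'"
    using ngr by (simp add: has_greatest_def le'_def g)
  have ev: "eventually P (net_filter (f ` I) le') \<longleftrightarrow> eventually (\<lambda>i. P (f i)) (net_filter I le)" for P
    unfolding eventually_net_filter[OF dir] eventually_net_filter[OF dir']
    by (simp add: le'_def g)
  have lim': "limitin weak_star_topology (\<lambda>x. x) \<phi> (net_filter (f ` I) le')"
    using lim by (simp add: limitin_def ev)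
  have *: "ddagger_nets TYPE('a \<Rightarrow>\<^sub>L complex) TYPE('a)"
    using assms by (simp add: property_ddagger_def)
  have fa: "\<forall>x\<in>f ` I. x \<in> dual_space \<and> norm x \<le> 1 \<and> norm_attaining x"
    using f by blast
  have sepa: "\<forall>x\<in>f ` I. \<forall>y\<in>f ` I. x \<noteq> y \<longrightarrow> norm (x - y) \<ge> \<epsilon>"
    using sep by auto
  show "norm \<phi> \<le> 1 - \<epsilon> / 2"
    by (rule *[unfolded ddagger_nets_def, THEN spec[of _ \<epsilon>], THEN mp, THEN spec[of _ "f ` I"],
          THEN spec[of _ le'], THEN spec[of _ "\<lambda>x. x"], THEN spec[of _ \<phi>], THEN mp])
      (intro conjI eps dir' ngr' fa sepa phi lim')+
qed

definition lim_condition :: "'i itself \<Rightarrow> 'a::complex_banach itself \<Rightarrow> bool" where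
  "lim_condition _ _ \<longleftrightarrow>
     (\<forall>(s::real) (I :: 'i set) le (f :: 'i \<Rightarrow> 'a \<Rightarrow>\<^sub>L complex) \<phi>.
        0 \<le> s \<and> directed_set I le \<and>
        (\<forall>i\<in>I. f i \<in> dual_space \<and> norm (f i) = s) \<and>
        limitin weak_star_topology f 0 (net_filter I le) \<and>
        \<phi> \<in> dual_space
        \<longrightarrow> ((\<lambda>i. norm (f i + \<phi>)) \<longlongrightarrow> s + norm \<phi>) (net_filter I le))"

end

theory Submission
  imports Defs
begin

text \<open>
  The idea is that property \<open>(\<ddagger>)\<close> makes the algebra look like a \<open>c\<^sub>0\<close>-sum of matrix algebras, in
  the following sense: for every element \<open>a\<close> the multiplications \<open>y \<mapsto> a y\<close> and \<open>y \<mapsto> y a\<close> are compact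
  operators (\<open>all_elements_compact\<close>). Lim's condition is a direct consequence
  (\<open>lim_if_all_elements_compact\<close>). Given \<open>\<phi>\<close> and a weak* null net \<open>f i\<close>, points of the unit ball where \<open>\<phi>\<close>
  and \<open>f i\<close> nearly attain their norms can be cut down to orthogonal elements, whose sum is again in the
  ball. By compactness of the cutoffs the net, being weak* null, is eventually small on the parts cut away.

  The property is only ever used for sequences and with separation \<open>1\<close> (\<open>ddagger_sequence\<close>): functionals of norm
  one at mutual distance at least \<open>1\<close> have no norm-attaining weak* limit of norm greater than \<open>1/2\<close>. Nets that
  converge weak* are hard to exhibit in a nonseparable dual, so the point is to find
  sequences for which convergence is automatic. There are three of them.

  \<^item> If \<open>p\<close> is a minimal projection, the left ideal generated by \<open>p\<close> is a Hilbert space, and an orthonormal sequence in it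
    gives a convergent sequence of vector functionals. So this space has finite dimension, and \<open>p\<close> is a
    compact element (\<open>minimal_projection_compact\<close>).

  \<^item> A binary tree of orthogonal elements carries a functional resembling a diffuse measure, and the densities
    one plus a Rademacher function converge to it by Bessel's inequality. So splitting an element into
    orthogonal pieces outside a given closed ideal must stop (\<open>ex_not_splits\<close>), and an element that cannot be split behaves like a
    projection of rank one modulo the ideal (\<open>not_splits_character\<close>).

  \<^item> Take the ideal of compact elements. If it is proper, such an element \<open>e\<close> satisfies \<open>e y e = \<lambda>(y) e\<^sup>2\<close> modulo compact
    elements. There are infinitely many orthogonal compact elements below \<open>e\<close>, for otherwise \<open>e\<close> would produce a
    minimal projection that is not compact. Functionals concentrated on them converge weak* to \<open>\<lambda>\<close>, because compact
    elements vanish along an orthogonal sequence.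

  Pieces are cut out by a continuous functional calculus for selfadjoint elements, in an algebra that may
  lack a unit; its heart is the bound \<open>poly_op_norm\<close>. Where one would expect positivity, the arguments combine
  orthogonality with the C*-identity (\<open>norm_sum_orthogonal_le_1\<close>, \<open>functional_kills_right_annihilator\<close>).
\<close>

section \<open>Elementary C*-algebra identities\<close>

lemma cstar_scaleR: "cstar (r *\<^sub>R x) = r *\<^sub>R cstar (x::'a::cstar_algebra)"
  by (simp add: scaleR_scaleC cstar_scaleC)

lemma cstar_zero [simp]: "cstar (0::'a::cstar_algebra) = 0"
  using cstar_scaleR[of 0 "0::'a"] by simp

lemma cstar_minus: "cstar (- x) = - cstar (x::'a::cstar_algebra)"
  using cstar_scaleR[of "-1" x] by simp

lemma cstar_diff: "cstar (x - y) = cstar x - cstar (y::'a::cstar_algebra)"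
  using cstar_add[of x "- y"] by (simp add: cstar_minus)

lemma cstar_sum: "cstar (sum f A) = (\<Sum>i\<in>A. cstar (f i :: 'a::cstar_algebra))"
  by (induction A rule: infinite_finite_induct) (auto simp: cstar_add)

lemma norm_le_norm_cstar: "norm x \<le> norm (cstar (x::'a::cstar_algebra))"
proof (cases "x = 0")
  case False
  have "norm x * norm x \<le> norm (cstar x) * norm x"
    using cstar_norm[of x] norm_mult_ineq[of "cstar x" x] by (simp add: power2_eq_square)
  then show ?thesis using False by simp
qed simp

lemma norm_cstar [simp]: "norm (cstar x) = norm (x::'a::cstar_algebra)"
  using norm_le_norm_cstar[of x] norm_le_norm_cstar[of "cstar x"] by (simp add: cstar_cstar)

lemma cstar_norm': "norm (x * cstar x) = (norm (x::'a::cstar_algebra))\<^sup>2"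
  using cstar_norm[of "cstar x"] by (simp add: cstar_cstar)

lemma scaleC_0_left [simp]: "0 *\<^sub>C (x::'a::complex_banach) = 0"
  using scaleR_scaleC[of 0 x] by simp

lemma scaleC_minus_left: "(- c) *\<^sub>C (x::'a::complex_banach) = - (c *\<^sub>C x)"
  using scaleC_add_left[of "-c" c x] by (simp add: eq_neg_iff_add_eq_0)

lemma scaleC_0_right [simp]: "c *\<^sub>C (0::'a::complex_banach) = 0"
  using scaleC_add_right[of c 0 0] by simp

lemma scaleC_minus_right: "c *\<^sub>C (- x) = - (c *\<^sub>C (x::'a::complex_banach))"
  using scaleC_add_right[of c "-x" x] by (simp add: eq_neg_iff_add_eq_0)

lemma scaleC_diff_right: "c *\<^sub>C (x - y) = c *\<^sub>C x - c *\<^sub>C (y::'a::complex_banach)"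
  using scaleC_add_right[of c x "-y"] by (simp add: scaleC_minus_right)

lemma bounded_linear_cstar: "bounded_linear (cstar :: 'a::cstar_algebra \<Rightarrow> 'a)"
  by (rule bounded_linear_intro[where K = 1]) (auto simp: cstar_add cstar_scaleR)

lemmas tendsto_cstar = bounded_linear.tendsto[OF bounded_linear_cstar]

definition selfadj :: "'a::cstar_algebra \<Rightarrow> bool" where
  "selfadj x \<longleftrightarrow> cstar x = x"

lemma selfadj_norm_square: "selfadj x \<Longrightarrow> norm (x * x) = (norm x)\<^sup>2"
  using cstar_norm[of x] by (simp add: selfadj_def)

text \<open>
  The C*-identity turns the square of a norm into the norm of a square. Iterating it removes any
  factor from a norm estimate that grows only linearly in the exponent.
\<close>

lemma le_one_of_subexponential_powers:
  fixes r C :: real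
  assumes "0 \<le> r" and le: "\<And>m. r ^ (2 ^ m) \<le> C * 2 ^ m"
  shows "r \<le> 1"
proof (rule ccontr)
  assume "\<not> r \<le> 1"
  define s where "s = 1 / r"
  have r: "r > 1" using \<open>\<not> r \<le> 1\<close> by simp
  then have "\<bar>s\<bar> < 1" by (simp add: s_def)
  then have "(\<lambda>n. real n * s ^ n) \<longlonglongrightarrow> 0"
    using powser_times_n_limit_0[of s] by simp
  then have "(\<lambda>m. real (2 ^ m) * s ^ (2 ^ m)) \<longlonglongrightarrow> 0"
    by (rule filterlim_compose) (rule filterlim_subseq, simp add: strict_mono_def)
  then have lim: "(\<lambda>m. C * (real (2 ^ m) * s ^ (2 ^ m))) \<longlonglongrightarrow> C * 0"
    by (intro tendsto_intros)
  have "1 \<le> C * (real (2 ^ m) * s ^ (2 ^ m))" for m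
  proof -
    have "1 = r ^ (2 ^ m) * s ^ (2 ^ m)"
      using r by (simp add: s_def power_mult_distrib[symmetric])
    also have "\<dots> \<le> (C * 2 ^ m) * s ^ (2 ^ m)"
      using le[of m] r by (intro mult_right_mono) (auto simp: s_def)
    finally show ?thesis by (simp add: mult_ac)
  qed
  then have "1 \<le> C * 0"
    by (intro LIMSEQ_le_const[OF lim]) auto
  then show False by simp
qed

text \<open>
  Squaring an orthogonal sum squares its terms, so the \<open>2 ^ m\<close>-th power of its norm stays below the
  number of terms, whatever \<open>m\<close> is.
\<close>

lemma norm_sum_orthogonal_le_1:
  fixes x :: "'i \<Rightarrow> 'a::cstar_algebra"
  assumes fin: "finite I"
    and "\<And>i. i \<in> I \<Longrightarrow> selfadj (x i)" and "\<And>i. i \<in> I \<Longrightarrow> norm (x i) \<le> 1"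
    and "\<And>i j. i \<in> I \<Longrightarrow> j \<in> I \<Longrightarrow> i \<noteq> j \<Longrightarrow> x i * x j = 0"
  shows "norm (\<Sum>i\<in>I. x i) \<le> 1"
proof (rule le_one_of_subexponential_powers)
  fix m :: nat
  have "norm (\<Sum>i\<in>I. x i) ^ (2 ^ m) \<le> real (card I)"
    using assms(2-)
  proof (induction m arbitrary: x)
    case 0
    then show ?case
      using sum_bounded_above[of I "\<lambda>i. norm (x i)" 1] norm_sum[of x I] by force
  next
    case (Suc m)
    let ?y = "\<lambda>i. x i * x i"
    have square: "(\<Sum>i\<in>I. x i) * (\<Sum>i\<in>I. x i) = (\<Sum>i\<in>I. ?y i)"
    proof -
      have "(\<Sum>j\<in>I. x i * x j) = x i * x i" if "i \<in> I" for i
        using that Suc.prems(3) fin by (subst sum.remove[of _ i]) (auto intro!: sum.neutral)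
      then show ?thesis by (simp add: sum_product)
    qed
    have sa: "selfadj (\<Sum>i\<in>I. x i)"
      using Suc.prems(1) by (simp add: selfadj_def cstar_sum)
    have "norm (\<Sum>i\<in>I. ?y i) ^ (2 ^ m) \<le> real (card I)"
    proof (rule Suc.IH)
      fix i assume i: "i \<in> I"
      show "selfadj (?y i)" using Suc.prems(1)[OF i] by (simp add: selfadj_def cstar_mult)
      show "norm (?y i) \<le> 1"
        using Suc.prems(2)[OF i] norm_mult_ineq[of "x i" "x i"]
        by (meson mult_le_one norm_ge_zero order_trans)
      fix j assume "j \<in> I" "i \<noteq> j"
      then have "x i * x j = 0" using Suc.prems(3) i by blast
      then show "?y i * ?y j = 0"
        by (metis mult.assoc mult_zero_left mult_zero_right)
    qed
    then show ?case
      using selfadj_norm_square[OF sa] square by (simp add: power_mult)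
  qed
  also have "\<dots> \<le> real (card I) * 2 ^ m" by (simp add: mult_le_cancel_left1)
  finally show "norm (\<Sum>i\<in>I. x i) ^ (2 ^ m) \<le> real (card I) * 2 ^ m" .
qed simp

section \<open>Polynomials of an operator\<close>

text \<open>
  An element of an algebra without unit cannot be substituted into a polynomial with a constant
  term, but its left multiplication can. Taking for \<open>T\<close> the multiplication by a complex number
  evaluates the polynomial at that number, so one identity serves operators and scalars.
\<close>

definition poly_op :: "('b \<Rightarrow> 'b) \<Rightarrow> real poly \<Rightarrow> 'b \<Rightarrow> 'b::real_vector" where
  "poly_op T p z = (\<Sum>i\<le>degree p. coeff p i *\<^sub>R (T ^^ i) z)"

lemma poly_op_0 [simp]: "poly_op T 0 z = 0"
  by (simp add: poly_op_def)

lemma poly_op_eq_sum: "degree p \<le> n \<Longrightarrow> poly_op T p z = (\<Sum>i\<le>n. coeff p i *\<^sub>R (T ^^ i) z)"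
  unfolding poly_op_def by (intro sum.mono_neutral_left) (auto simp: coeff_eq_0)

lemma linear_funpow: "linear (T :: 'b::real_vector \<Rightarrow> 'b) \<Longrightarrow> linear (T ^^ n)"
  by (induction n) (auto simp: linear_id[unfolded id_def] id_def intro: linear_compose)

lemma poly_op_pCons:
  assumes "linear T"
  shows "poly_op T (pCons c q) z = c *\<^sub>R z + T (poly_op T q z)"
proof -
  have "poly_op T (pCons c q) z = (\<Sum>i\<le>Suc (degree q). coeff (pCons c q) i *\<^sub>R (T ^^ i) z)"
    by (rule poly_op_eq_sum) (simp add: degree_pCons_le)
  also have "\<dots> = c *\<^sub>R z + (\<Sum>i\<le>degree q. coeff q i *\<^sub>R T ((T ^^ i) z))"
    by (subst sum.atMost_Suc_shift) simp
  finally show ?thesis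
    by (simp add: poly_op_def linear_sum[OF assms] linear_cmul[OF assms])
qed

lemma linear_poly_op: assumes "linear T" shows "linear (poly_op T p)"
proof (induction p)
  case 0
  then show ?case by (simp add: linear_iff)
next
  case (pCons c p)
  then show ?case using assms
    by (auto simp: linear_iff poly_op_pCons[OF assms] algebra_simps)
qed

lemma poly_op_add: assumes "linear T"
  shows "poly_op T (p + q) z = poly_op T p z + poly_op T q z"
  by (induction p q rule: poly_induct2)
    (auto simp: poly_op_pCons[OF assms] linear_add[OF assms] algebra_simps)

lemma poly_op_smult: assumes "linear T"
  shows "poly_op T (smult c p) z = c *\<^sub>R poly_op T p z"
  by (induction p)
    (auto simp: poly_op_pCons[OF assms] linear_cmul[OF assms] linear_0[OF assms] algebra_simps)

lemma poly_op_mult: assumes "linear T"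
  shows "poly_op T (p * q) z = poly_op T p (poly_op T q z)"
  by (induction p)
    (auto simp: poly_op_pCons[OF assms] poly_op_add[OF assms] poly_op_smult[OF assms])

lemma poly_op_const: "poly_op T [:c:] z = c *\<^sub>R z"
  by (simp add: poly_op_def)

lemma poly_op_diff: assumes "linear T"
  shows "poly_op T (p - q) z = poly_op T p z - poly_op T q z"
  using poly_op_add[OF assms, of p "smult (-1) q" z] poly_op_smult[OF assms, of "-1" q z] by simp

lemma poly_op_monom: assumes "linear T" shows "poly_op T (monom c n) z = c *\<^sub>R (T ^^ n) z"
  by (induction n) (auto simp: monom_0 poly_op_const monom_Suc poly_op_pCons[OF assms] linear_cmul[OF assms])

lemma poly_op_complex:
  "poly_op ((*) (of_real t)) p w = of_real (poly p t) * (w::complex)"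
proof -
  have lin: "linear ((*) (of_real t :: complex))" by (simp add: linear_iff algebra_simps)
  show ?thesis
    by (induction p) (auto simp: poly_op_pCons[OF lin] scaleR_conv_of_real distrib_right mult.assoc)
qed

text \<open>
  This is the polynomial \<open>w\<^sup>d q((w + 1/w)/2)\<close>. On the unit circle its modulus is that of \<open>q\<close> at the
  real part of \<open>w\<close>.
\<close>

fun circle_poly :: "nat \<Rightarrow> real poly \<Rightarrow> real poly" where
  "circle_poly 0 q = [:coeff q 0:]"
| "circle_poly (Suc d) q =
     monom (coeff q 0) (Suc d) + [:1/2, 0, 1/2:] * circle_poly d (poly_shift 1 q)"

lemma poly_shift_1_pCons: "poly_shift 1 (pCons c q) = q"
  by (rule poly_eqI) (simp add: coeff_poly_shift)

lemma degree_circle_poly: "degree (circle_poly d q) \<le> 2 * d"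
proof (induction d arbitrary: q)
  case (Suc d)
  have "degree ([:1/2, 0, 1/2:] * circle_poly d (poly_shift 1 q))
      \<le> degree ([:1/2, 0, 1/2:] :: real poly) + degree (circle_poly d (poly_shift 1 q))"
    by (rule degree_mult_le)
  also have "\<dots> \<le> 2 + 2 * d" using Suc by simp
  finally have "degree ([:1/2, 0, 1/2:] * circle_poly d (poly_shift 1 q)) \<le> 2 * Suc d" by simp
  moreover have "degree (monom (coeff q 0) (Suc d)) \<le> 2 * Suc d"
    by (rule order_trans[OF degree_monom_le]) simp
  ultimately show ?case unfolding circle_poly.simps by (intro degree_add_le)
qed simp

text \<open>
  The hypothesis on \<open>T\<close> and \<open>R\<close> is the equation \<open>R = (T + T\<inverse>)/2\<close> multiplied by \<open>T\<close>.
\<close>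

lemma poly_op_circle_poly:
  assumes T: "linear T" and R: "linear R"
    and TR: "\<And>z. T (R z) = (1/2) *\<^sub>R (z + T (T z))"
    and "degree q \<le> d"
  shows "poly_op T (circle_poly d q) z = (T ^^ d) (poly_op R q z)"
  using \<open>degree q \<le> d\<close>
proof (induction d arbitrary: q)
  case 0
  then obtain c where "q = [:c:]" by (auto elim: degree_eq_zeroE)
  then show ?case by (simp add: poly_op_const)
next
  case (Suc d)
  obtain c q' where q: "q = pCons c q'" by (cases q)
  have "degree q' \<le> d" using Suc.prems by (auto simp: q split: if_splits)
  then have IH: "poly_op T (circle_poly d q') z = (T ^^ d) (poly_op R q' z)" by (rule Suc.IH)
  have lin: "linear (T ^^ n)" for n by (rule linear_funpow[OF T])
  define y where "y = poly_op R q' z"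
  have "(T ^^ Suc d) (poly_op R q z) = c *\<^sub>R (T ^^ Suc d) z + (T ^^ d) (T (R y))"
    unfolding q poly_op_pCons[OF R] y_def[symmetric]
    by (simp only: linear_add[OF lin] linear_cmul[OF lin] linear_add[OF T] linear_cmul[OF T]
        funpow_Suc_right o_apply)
  also have "(T ^^ d) (T (R y)) = (1/2) *\<^sub>R ((T ^^ d) y + T (T ((T ^^ d) y)))"
    unfolding TR by (simp add: linear_add[OF lin] linear_cmul[OF lin] funpow_swap1)
  finally show ?case
    using IH poly_shift_1_pCons[of c q']
    by (simp add: q poly_op_add[OF T] poly_op_monom[OF T] poly_op_mult[OF T] poly_op_pCons[OF T]
        poly_op_smult[OF T]
        y_def[symmetric] linear_0[OF T] linear_add[OF T] linear_cmul[OF T] algebra_simps)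
qed

text \<open>
  A coefficient is a mean, with unimodular weights, of the values at sufficiently many roots of unity.
\<close>

lemma norm_coeff_le_sup_circle:
  fixes p :: "real poly"
  assumes M: "\<And>w::complex. cmod w = 1 \<Longrightarrow> cmod (poly_op ((*) w) p 1) \<le> M"
  shows "\<bar>coeff p k\<bar> \<le> M"
proof -
  define N where "N = Suc (max (degree p) k)"
  have N: "N > 0" "k < N" "degree p \<le> N - 1" by (auto simp: N_def)
  define w where "w = (\<lambda>j::nat. cis (2 * pi * real j / real N))"
  have geo: "(\<Sum>j<N. w j ^ i * cnj (w j) ^ k) = (if i = k then of_nat N else 0)"
    if "i < N" for i
  proof -
    define r where "r = cis (2 * pi * (real i - real k) / real N)"
    have summand: "w j ^ i * cnj (w j) ^ k = r ^ j" for j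
    proof -
      have "w j ^ i * cnj (w j) ^ k = cis (real i * (2 * pi * real j / real N) + real k * - (2 * pi * real j / real N))"
        by (simp only: w_def cis_cnj Complex.DeMoivre cis_mult)
      also have "\<dots> = cis (real j * (2 * pi * (real i - real k) / real N))"
        by (rule arg_cong[of _ _ cis])
          (simp add: right_diff_distrib left_diff_distrib diff_divide_distrib mult_ac)
      finally show ?thesis by (simp add: r_def Complex.DeMoivre)
    qed
    have rN: "r ^ N = 1"
    proof -
      have "r ^ N = cis (2 * pi * (real_of_int (int i - int k)))"
        using N by (simp add: r_def Complex.DeMoivre)
      then show ?thesis by (metis cis_multiple_2pi Ints_of_int)
    qed
    show ?thesis
    proof (cases "i = k")
      case True
      then have "r = 1" by (simp add: r_def)
      then show ?thesis by (simp add: summand) (simp add: True)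
    next
      case False
      have "r \<noteq> 1"
      proof
        assume "r = 1"
        then have "cos (2 * pi * (real i - real k) / real N) = 1"
          by (simp add: r_def complex_eq_iff)
        then obtain n :: int where "2 * pi * (real i - real k) / real N = real_of_int n * 2 * pi"
          using cos_one_2pi_int by blast
        then have "(2 * pi) * (real i - real k) = (2 * pi) * (real_of_int n * real N)"
          using N by (simp add: field_simps)
        then have "real_of_int (int i - int k) = real_of_int (n * int N)"
          by (simp only: mult_cancel_left) simp
        then have eq: "int i - int k = n * int N" by linarith
        have "\<bar>int i - int k\<bar> < int N" using that N by linarith
        then have "\<bar>n\<bar> * int N < 1 * int N" using eq by (simp add: abs_mult)
        then have "n = 0" using N by (simp only: mult_less_cancel_right) linarith
        then show False using eq False by simp
      qed
      then show ?thesis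
        using geometric_sum[of r N] rN by (simp add: summand False)
    qed
  qed
  have val: "poly_op ((*) (w j)) p 1 = (\<Sum>i<N. of_real (coeff p i) * w j ^ i)" for j
  proof -
    have "((*) (w j) ^^ i) 1 = w j ^ i" for i by (induction i) auto
    moreover have "{..N - 1} = {..<N}" using N by auto
    ultimately show ?thesis
      by (simp add: poly_op_eq_sum[OF N(3)] scaleR_conv_of_real)
  qed
  have "(\<Sum>j<N. poly_op ((*) (w j)) p 1 * cnj (w j) ^ k)
      = (\<Sum>j<N. \<Sum>i<N. of_real (coeff p i) * (w j ^ i * cnj (w j) ^ k))"
    by (simp add: val sum_distrib_right mult.assoc)
  also have "\<dots> = (\<Sum>i<N. of_real (coeff p i) * (\<Sum>j<N. w j ^ i * cnj (w j) ^ k))"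
    by (subst sum.swap) (simp add: sum_distrib_left)
  also have "\<dots> = (\<Sum>i<N. of_real (coeff p i) * (if i = k then of_nat N else 0))"
    by (intro sum.cong) (auto simp: geo)
  also have "\<dots> = of_real (coeff p k) * of_nat N"
    using N by (simp add: sum.delta if_distrib cong: if_cong)
  finally have eq: "(\<Sum>j<N. poly_op ((*) (w j)) p 1 * cnj (w j) ^ k) = of_real (coeff p k) * of_nat N" .
  have "\<bar>coeff p k\<bar> * N = cmod (\<Sum>j<N. poly_op ((*) (w j)) p 1 * cnj (w j) ^ k)"
    by (simp add: eq norm_mult)
  also have "\<dots> \<le> (\<Sum>j<N. M)"
    by (intro sum_norm_le) (simp add: norm_mult norm_power w_def M)
  finally show ?thesis using N by (simp add: mult.commute)
qed

lemma circle_poly_coeff_bound: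
  assumes M: "\<And>t. t \<in> {-1..1} \<Longrightarrow> \<bar>poly q t\<bar> \<le> M" and "degree q \<le> d"
  shows "\<bar>coeff (circle_poly d q) k\<bar> \<le> M"
proof (rule norm_coeff_le_sup_circle)
  fix w :: complex
  assume w: "cmod w = 1"
  have lin: "linear ((*) (c :: complex))" for c by (simp add: linear_iff algebra_simps)
  have "w * cnj w = 1" using w by (simp add: complex_norm_square[symmetric])
  moreover have "complex_of_real (Re w) = (w + cnj w) / 2" by (simp add: complex_add_cnj)
  ultimately have eq: "w * of_real (Re w) = (1 + w * w) / 2"
    by (simp add: field_simps)
  have rel: "w * (of_real (Re w) * z) = (1/2) *\<^sub>R (z + w * (w * z))" for z
  proof -
    have "w * (of_real (Re w) * z) = (1 + w * w) / 2 * z"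
      unfolding eq[symmetric] by (simp only: mult.assoc)
    then show ?thesis by (simp add: scaleR_conv_of_real field_simps)
  qed
  have pow: "((*) w ^^ n) z = w ^ n * z" for n z by (induction n) (auto simp: mult_ac)
  have "poly_op ((*) w) (circle_poly d q) 1 = w ^ d * of_real (poly q (Re w))"
    by (subst poly_op_circle_poly[OF lin lin rel \<open>degree q \<le> d\<close>])
      (simp add: poly_op_complex pow)
  moreover have "Re w \<in> {-1..1}" using abs_Re_le_cmod[of w] w by auto
  ultimately show "cmod (poly_op ((*) w) (circle_poly d q) 1) \<le> M"
    using M w by (simp add: norm_mult norm_power)
qed

section \<open>The norm of a polynomial in a selfadjoint element\<close>

lemma linear_mult_left: "linear ((*) (a::'a::real_normed_algebra))"
  by (simp add: linear_iff algebra_simps)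

lemma poly_op_mult_right:
  "poly_op ((*) a) p (z * w) = poly_op ((*) a) p z * (w::'a::real_normed_algebra)"
  by (induction p) (auto simp: poly_op_pCons[OF linear_mult_left] algebra_simps)

lemma poly_op_mult_self:
  "poly_op ((*) a) p (a * z) = a * poly_op ((*) a) p (z::'a::real_normed_algebra)"
  by (induction p) (auto simp: poly_op_pCons[OF linear_mult_left] algebra_simps)

lemma poly_op_adjoint:
  assumes "selfadj a"
  shows "cstar (poly_op ((*) a) p y) * z = cstar y * poly_op ((*) a) p z"
proof (induction p arbitrary: y z)
  case (pCons c p)
  have "cstar (a * poly_op ((*) a) p y) * z = cstar (poly_op ((*) a) p y) * (a * z)"
    using assms by (simp add: cstar_mult selfadj_def mult.assoc)
  also have "\<dots> = cstar y * (a * poly_op ((*) a) p z)"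
    by (simp add: pCons poly_op_mult_self)
  finally show ?case
    by (simp add: poly_op_pCons[OF linear_mult_left] cstar_add cstar_scaleR distrib_left distrib_right)
qed simp

text \<open>
  The element found is \<open>1 - sqrt (1 - a\<^sup>2)\<close>; unlike the square root itself it exists without a unit.
  It is the fixed point reached from \<open>0\<close> by \<open>y \<mapsto> (a\<^sup>2 + y\<^sup>2)/2\<close>. The scalar iteration with
  \<open>a\<^sup>2 = 1\<close> dominates it step by step and is increasing and bounded by \<open>1\<close>.
\<close>

lemma one_minus_sqrt_exists:
  fixes a :: "'a::cstar_algebra"
  assumes a: "selfadj a" "norm a \<le> 1"
  obtains y where "selfadj y" "a * y = y * a" "a * a + y * y = 2 *\<^sub>R y"
proof -
  define Y where "Y = rec_nat (0::'a) (\<lambda>_ y. (1/2) *\<^sub>R (a * a + y * y))"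
  define R where "R = rec_nat (0::real) (\<lambda>_ r. (1/2) * (1 + r * r))"
  have Y0: "Y 0 = 0" and YS: "Y (Suc n) = (1/2) *\<^sub>R (a * a + Y n * Y n)" for n
    by (simp_all add: Y_def)
  have R0: "R 0 = 0" and RS: "R (Suc n) = (1/2) * (1 + R n * R n)" for n
    by (simp_all add: R_def)
  have saY: "selfadj (Y n)" for n
    using a by (induction n) (auto simp: Y0 YS selfadj_def cstar_scaleR cstar_add cstar_mult)
  have commY: "Y n * c = c * Y n" if "a * c = c * a" for n c
  proof (induction n)
    case (Suc n)
    have "a * a * c = c * (a * a)" using that by (metis mult.assoc)
    moreover have "Y n * Y n * c = c * (Y n * Y n)" using Suc by (metis mult.assoc)
    ultimately show ?case by (simp add: YS distrib_left distrib_right)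
  qed (simp add: Y0)
  have aY: "a * Y n = Y n * a" for n using commY[of a n] by simp
  have YY: "Y n * Y m = Y m * Y n" for n m by (rule commY) (rule aY)
  have Rnn: "0 \<le> R n" for n by (induction n) (auto simp: R0 RS)
  have R1: "R n \<le> 1" for n
  proof (induction n)
    case (Suc n)
    have "R n * R n \<le> 1" using Suc Rnn[of n] by (simp add: mult_le_one)
    then show ?case by (simp add: RS)
  qed (simp add: R0)
  have aa: "norm (a * a) \<le> 1"
    using a norm_mult_ineq[of a a] by (meson mult_le_one norm_ge_zero order_trans)
  have YR: "norm (Y n) \<le> R n" for n
  proof (induction n)
    case (Suc n)
    have "norm (Y n * Y n) \<le> R n * R n"
      using Suc norm_mult_ineq[of "Y n" "Y n"] Rnn[of n] by (meson mult_mono norm_ge_zero order_trans)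
    then have "norm (a * a + Y n * Y n) \<le> 1 + R n * R n"
      using aa by (intro norm_triangle_le) linarith
    then show ?case by (simp add: YS RS)
  qed (simp add: Y0 R0)
  have step: "norm (Y (Suc n) - Y n) \<le> R (Suc n) - R n" for n
  proof (induction n)
    case 0
    then show ?case using aa by (simp add: YS RS Y0 R0)
  next
    case (Suc n)
    have "Y (Suc (Suc n)) - Y (Suc n) = (1/2) *\<^sub>R (Y (Suc n) * Y (Suc n) - Y n * Y n)"
      by (subst (1) YS, subst (3) YS) (simp add: algebra_simps)
    also have "Y (Suc n) * Y (Suc n) - Y n * Y n = (Y (Suc n) - Y n) * (Y (Suc n) + Y n)"
      using YY[of n "Suc n"] by (simp add: algebra_simps)
    finally have "norm (Y (Suc (Suc n)) - Y (Suc n))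
        \<le> (1/2) * (norm (Y (Suc n) - Y n) * norm (Y (Suc n) + Y n))"
      using norm_mult_ineq[of "Y (Suc n) - Y n" "Y (Suc n) + Y n"] by simp
    also have "\<dots> \<le> (1/2) * ((R (Suc n) - R n) * (R (Suc n) + R n))"
    proof -
      have "norm (Y (Suc n) + Y n) \<le> R (Suc n) + R n"
        using YR[of n] YR[of "Suc n"] by (intro norm_triangle_le) linarith
      moreover have "0 \<le> R (Suc n) - R n" using Suc by (rule order_trans[OF norm_ge_zero])
      ultimately show ?thesis using Suc
        by (intro mult_left_mono mult_mono) auto
    qed
    also have "\<dots> = R (Suc (Suc n)) - R (Suc n)"
    proof -
      have "1/2 * ((v - u) * (v + u)) = w - v"
        if "v = 1/2 * (1 + u * u)" "w = 1/2 * (1 + v * v)" for u v w :: real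
        using that by (simp add: algebra_simps)
      then show ?thesis using RS[of n] RS[of "Suc n"] by blast
    qed
    finally show ?case .
  qed
  have inc: "R n \<le> R (Suc n)" for n
    using order_trans[OF norm_ge_zero step[of n]] by simp
  then have "incseq R" by (rule incseq_SucI)
  then obtain L where "R \<longlonglongrightarrow> L" using incseq_convergent[of R 1] R1 by blast
  then have "Cauchy R" by (rule LIMSEQ_imp_Cauchy)
  have diff: "norm (Y (n + k) - Y n) \<le> R (n + k) - R n" for n k
  proof (induction k)
    case (Suc k)
    have "norm (Y (n + Suc k) - Y n) \<le> norm (Y (Suc (n + k)) - Y (n + k)) + norm (Y (n + k) - Y n)"
      using norm_triangle_ineq[of "Y (Suc (n + k)) - Y (n + k)" "Y (n + k) - Y n"] by simp
    then show ?case using Suc step[of "n + k"] by simp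
  qed simp
  have "Cauchy Y"
  proof (rule CauchyI')
    fix e :: real assume "e > 0"
    then obtain M where M: "\<forall>m\<ge>M. \<forall>n\<ge>M. dist (R m) (R n) < e"
      using \<open>Cauchy R\<close> by (auto simp: Cauchy_def)
    have "dist (Y m) (Y n) < e" if "m \<ge> M" "n > m" for m n
    proof -
      have "dist (Y m) (Y n) \<le> R n - R m"
        using diff[of m "n - m"] that by (simp add: dist_norm norm_minus_commute)
      also have "\<dots> < e" using M that by (auto simp: dist_real_def abs_less_iff)
      finally show ?thesis .
    qed
    then show "\<exists>M. \<forall>m\<ge>M. \<forall>n>m. dist (Y m) (Y n) < e" by blast
  qed
  then obtain y where y: "Y \<longlonglongrightarrow> y" using Cauchy_convergent convergentD by blast
  show thesis
  proof
    have "(\<lambda>n. cstar (Y n)) \<longlonglongrightarrow> cstar y"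
      by (intro tendsto_cstar y)
    then show "selfadj y" using saY y LIMSEQ_unique by (auto simp: selfadj_def)
    have "(\<lambda>n. a * Y n) \<longlonglongrightarrow> a * y" "(\<lambda>n. Y n * a) \<longlonglongrightarrow> y * a" by (intro tendsto_intros y)+
    then show "a * y = y * a" using aY LIMSEQ_unique by auto
    have "(\<lambda>n. 2 *\<^sub>R Y (Suc n)) \<longlonglongrightarrow> 2 *\<^sub>R y" by (intro tendsto_intros LIMSEQ_Suc y)
    moreover have "(\<lambda>n. 2 *\<^sub>R Y (Suc n)) \<longlonglongrightarrow> a * a + y * y"
      by (simp add: YS) (intro tendsto_intros y)
    ultimately show "a * a + y * y = 2 *\<^sub>R y" using LIMSEQ_unique by blast
  qed
qed

text \<open>
  In the unitization, \<open>a\<close> is the real part of the unitary \<open>a + \<i> sqrt (1 - a\<^sup>2)\<close>. Left multiplication by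
  this unitary is an isometry \<open>U\<close> of the algebra itself, and \<open>U\<^sup>d q(a)\<close> is a polynomial of degree at
  most \<open>2 d\<close> in \<open>U\<close> whose coefficients are bounded by the supremum of \<open>q\<close> on the interval.
\<close>

lemma poly_op_norm_degree:
  fixes a :: "'a::cstar_algebra"
  assumes a: "selfadj a" "norm a \<le> 1"
    and M: "\<And>t. t \<in> {-1..1} \<Longrightarrow> \<bar>poly q t\<bar> \<le> M" and d: "degree q \<le> d"
  shows "norm (poly_op ((*) a) q z) \<le> (2 * real d + 1) * M * norm z"
proof -
  obtain y where y: "selfadj y" "a * y = y * a" "a * a + y * y = 2 *\<^sub>R y"
    using one_minus_sqrt_exists[OF a] .
  define U where "U = (\<lambda>z. a * z + \<i> *\<^sub>C (z - y * z))"
  define V where "V = (\<lambda>z. a * z - \<i> *\<^sub>C (z - y * z))"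
  have ii: "\<i> *\<^sub>C \<i> *\<^sub>C x = - x" for x :: 'a
    by (simp add: scaleC_scaleC scaleC_minus_left scaleC_one)
  have scaleCR: "c *\<^sub>C r *\<^sub>R x = r *\<^sub>R c *\<^sub>C x" for c r and x :: 'a
    by (simp add: scaleR_scaleC scaleC_scaleC mult.commute)
  have linU: "linear U"
    by (simp add: linear_iff U_def scaleC_add_right scaleC_diff_right scaleCR algebra_simps)
  have alg: "a * (a * z) + y * (y * z) = y * z + y * z" "a * (y * z) = y * (a * z)" for z
  proof -
    have "(a * a + y * y) * z = (2 *\<^sub>R y) * z" using y(3) by simp
    then show "a * (a * z) + y * (y * z) = y * z + y * z"
      by (simp add: distrib_right mult.assoc scaleR_2)
    show "a * (y * z) = y * (a * z)" using y(2) by (metis mult.assoc)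
  qed
  have UV: "U (V z) = z" and VU: "V (U z) = z" for z
    using alg(1)[of z] alg(2)[of z]
    by (simp_all add: U_def V_def scaleC_add_right scaleC_diff_right mult_scaleC_right ii algebra_simps)
  have isoU: "norm (U z) = norm z" for z
  proof -
    have "cstar (U z) * U z = cstar z * V (U z)"
      using a y(1) by (simp add: U_def V_def cstar_add cstar_diff cstar_mult cstar_scaleC selfadj_def
          scaleC_add_right scaleC_diff_right scaleC_minus_left mult_scaleC_right mult_scaleC_left algebra_simps)
    then have "(norm (U z))\<^sup>2 = (norm z)\<^sup>2" by (metis VU cstar_norm)
    then show ?thesis by simp
  qed
  have isoUn: "norm ((U ^^ n) z) = norm z" for n z by (induction n) (auto simp: isoU)
  have rel: "U (a * z) = (1/2) *\<^sub>R (z + U (U z))" for z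
  proof -
    have "a * z = (1/2) *\<^sub>R (V z + U z)" by (simp add: U_def V_def scaleR_2[symmetric])
    then show ?thesis
      by (metis UV linear_add[OF linU] linear_cmul[OF linU])
  qed
  have "norm (poly_op ((*) a) q z) = norm (poly_op U (circle_poly d q) z)"
    by (simp add: poly_op_circle_poly[OF linU linear_mult_left rel d] isoUn)
  also have "\<dots> \<le> (\<Sum>i\<le>2 * d. \<bar>coeff (circle_poly d q) i\<bar> * norm z)"
    unfolding poly_op_eq_sum[OF degree_circle_poly]
    by (rule order_trans[OF norm_sum]) (simp add: isoUn)
  also have "\<dots> \<le> (\<Sum>i\<le>2 * d. M * norm z)"
    by (intro sum_mono mult_right_mono circle_poly_coeff_bound M d) auto
  finally show ?thesis by (simp add: algebra_simps)
qed

text \<open>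
  The bound of the previous lemma, applied to the powers \<open>q ^ (2 ^ m)\<close>, loses a factor that is linear in the
  exponent; the C*-identity makes this loss disappear.
\<close>

lemma poly_op_norm:
  fixes a :: "'a::cstar_algebra"
  assumes a: "selfadj a" "norm a \<le> 1"
    and M: "\<And>t. t \<in> {-1..1} \<Longrightarrow> \<bar>poly q t\<bar> \<le> M"
  shows "norm (poly_op ((*) a) q z) \<le> M * norm z"
proof -
  have square: "(norm (poly_op ((*) a) q z))\<^sup>2 \<le> norm z * norm (poly_op ((*) a) (q * q) z)" for q
  proof -
    have "(norm (poly_op ((*) a) q z))\<^sup>2 = norm (cstar (poly_op ((*) a) q z) * poly_op ((*) a) q z)"
      by (simp add: cstar_norm)
    also have "\<dots> = norm (cstar z * poly_op ((*) a) (q * q) z)"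
      by (simp add: poly_op_adjoint[OF a(1)] poly_op_mult[OF linear_mult_left])
    also have "\<dots> \<le> norm z * norm (poly_op ((*) a) (q * q) z)"
      using norm_mult_ineq[of "cstar z"] by simp
    finally show ?thesis .
  qed
  have iter: "norm (poly_op ((*) a) q z) ^ (2 ^ m) * norm z
      \<le> norm z ^ (2 ^ m) * norm (poly_op ((*) a) (q ^ (2 ^ m)) z)" for m
  proof (induction m arbitrary: q)
    case (Suc m)
    have "norm (poly_op ((*) a) q z) ^ (2 ^ Suc m) = ((norm (poly_op ((*) a) q z))\<^sup>2) ^ (2 ^ m)"
      by (simp add: power_mult)
    also have "\<dots> \<le> (norm z * norm (poly_op ((*) a) (q * q) z)) ^ (2 ^ m)"
      by (intro power_mono square) simp
    finally have "norm (poly_op ((*) a) q z) ^ (2 ^ Suc m) * norm z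
        \<le> norm z ^ (2 ^ m) * (norm (poly_op ((*) a) (q * q) z) ^ (2 ^ m) * norm z)"
      by (simp add: power_mult_distrib mult_right_mono mult.assoc[symmetric])
    also have "\<dots> \<le> norm z ^ (2 ^ m) * (norm z ^ (2 ^ m) * norm (poly_op ((*) a) ((q * q) ^ (2 ^ m)) z))"
      by (intro mult_left_mono Suc) simp
    finally show ?case
      by (simp add: power_mult power_mult_distrib power2_eq_square mult.assoc)
  qed simp
  have main: "norm (poly_op ((*) a) q z) \<le> K * norm z" if "K > M" for K
  proof (cases "z = 0")
    case True
    then show ?thesis by (simp add: linear_0[OF linear_poly_op[OF linear_mult_left]])
  next
    case False
    have M0: "0 \<le> M" using M[of 0] by auto
    define r where "r = norm (poly_op ((*) a) q z) / (K * norm z)"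
    have Kz: "K * norm z > 0" using False that M0 by simp
    have "r \<le> 1"
    proof (rule le_one_of_subexponential_powers)
      show "0 \<le> r" using Kz by (simp add: r_def)
      fix m :: nat
      have deg: "degree (q ^ (2 ^ m)) \<le> degree q * 2 ^ m"
        by (rule degree_power_le)
      have "norm (poly_op ((*) a) (q ^ (2 ^ m)) z) \<le> (2 * real (degree q * 2 ^ m) + 1) * M ^ (2 ^ m) * norm z"
        using M by (intro poly_op_norm_degree a deg) (auto simp: poly_power power_abs intro!: power_mono)
      then have "norm (poly_op ((*) a) q z) ^ (2 ^ m) * norm z
          \<le> norm z ^ (2 ^ m) * ((2 * real (degree q * 2 ^ m) + 1) * M ^ (2 ^ m) * norm z)"
        using iter[of m] by (meson mult_left_mono order_trans zero_le_power norm_ge_zero)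
      then have "norm (poly_op ((*) a) q z) ^ (2 ^ m)
          \<le> norm z ^ (2 ^ m) * ((2 * real (degree q * 2 ^ m) + 1) * M ^ (2 ^ m))"
        using False by (simp add: mult.assoc[symmetric])
      also have "\<dots> \<le> norm z ^ (2 ^ m) * ((2 * real (degree q) + 1) * 2 ^ m * K ^ (2 ^ m))"
        using M0 that by (intro mult_left_mono mult_mono power_mono) (auto simp: algebra_simps)
      finally have "norm (poly_op ((*) a) q z) ^ (2 ^ m)
          \<le> ((2 * real (degree q) + 1) * 2 ^ m) * (K * norm z) ^ (2 ^ m)"
        by (simp add: power_mult_distrib mult_ac)
      then show "r ^ (2 ^ m) \<le> (2 * real (degree q) + 1) * 2 ^ m"
        using Kz by (simp add: r_def power_divide pos_divide_le_eq)
    qed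
    then show ?thesis using Kz by (simp add: r_def pos_divide_le_eq)
  qed
  show ?thesis
  proof (rule field_le_epsilon)
    fix e :: real assume e: "0 < e"
    have "norm (poly_op ((*) a) q z) \<le> (M + e / (norm z + 1)) * norm z"
      using e by (intro main) (simp add: add_nonneg_pos)
    also have "\<dots> = M * norm z + e * (norm z / (norm z + 1))" by (simp add: algebra_simps)
    also have "\<dots> \<le> M * norm z + e * 1"
      using e by (intro add_left_mono mult_left_mono) (auto simp: divide_le_eq_1 add_nonneg_pos)
    finally show "norm (poly_op ((*) a) q z) \<le> M * norm z + e" by simp
  qed
qed

section \<open>Continuous functions of a selfadjoint element\<close>

text \<open>
  Without a unit only functions that vanish at \<open>0\<close> give elements of the algebra.
\<close>

abbreviation null_cont :: "(real \<Rightarrow> real) \<Rightarrow> bool" where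
  "null_cont f \<equiv> continuous_on {-1..1} f \<and> f 0 = 0"

lemma poly_op_self_mult:
  "poly_op ((*) a) q a * z = a * poly_op ((*) a) q (z::'a::real_normed_algebra)"
  by (simp add: poly_op_mult_right[symmetric] poly_op_mult_self)

lemma mult_left_zero_imp_zero:
  assumes "\<And>z. b * z = 0" shows "b = (0::'a::cstar_algebra)"
  using cstar_norm'[of b] assms[of "cstar b"] by simp

lemma norm_le_left_mult:
  assumes "\<And>z. norm (b * z) \<le> M * norm z" "0 \<le> M"
  shows "norm (b::'a::cstar_algebra) \<le> M"
proof (cases "b = 0")
  case False
  have "norm b * norm b \<le> M * norm b"
    using assms(1)[of "cstar b"] by (simp add: cstar_norm' power2_eq_square)
  then show ?thesis using False by simp
qed (simp add: assms)

lemma selfadj_poly_op: assumes "selfadj a" shows "selfadj (poly_op ((*) a) q a)"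
proof -
  have "cstar (poly_op ((*) a) q a) * z = poly_op ((*) a) q a * z" for z
    using poly_op_adjoint[OF assms, of q a z] assms by (simp add: selfadj_def poly_op_self_mult)
  then have "(cstar (poly_op ((*) a) q a) - poly_op ((*) a) q a) * z = 0" for z
    by (simp add: left_diff_distrib)
  from mult_left_zero_imp_zero[OF this] show ?thesis by (simp add: selfadj_def)
qed

lemma weierstrass_vanishing_at_0:
  assumes "null_cont f" and e: "0 < e"
  obtains q where "\<And>t. t \<in> {-1..1} \<Longrightarrow> \<bar>f t - t * poly q t\<bar> \<le> e"
proof -
  obtain g where g: "real_polynomial_function g" "\<And>t. t \<in> {-1..1} \<Longrightarrow> \<bar>f t - g t\<bar> < e / 2"
    using Stone_Weierstrass_real_polynomial_function[of "{-1..1}" f "e / 2"] assms by auto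
  obtain c n where "g = (\<lambda>x. \<Sum>i\<le>n. c i * x ^ i)"
    using g(1) real_polynomial_function_iff_sum by blast
  then have gp: "g x = poly (\<Sum>i\<le>n. monom (c i) i) x" for x
    by (simp add: poly_sum poly_monom)
  obtain d q where q: "(\<Sum>i\<le>n. monom (c i) i) = pCons d q" by (meson pCons_cases)
  have g': "g t = d + t * poly q t" for t using gp q by simp
  have "\<bar>d\<bar> < e / 2" using g(2)[of 0] g'[of 0] assms(1) by simp
  show thesis
  proof
    fix t :: real assume "t \<in> {-1..1}"
    then show "\<bar>f t - t * poly q t\<bar> \<le> e"
      using g(2)[of t] \<open>\<bar>d\<bar> < e / 2\<close> unfolding g' by linarith
  qed
qed

context
  fixes a :: "'a::cstar_algebra"
  assumes a: "selfadj a" "norm a \<le> 1"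
begin

lemma poly_op_self_diff_norm:
  assumes "\<And>t. t \<in> {-1..1} \<Longrightarrow> \<bar>t * poly p t - t * poly q t\<bar> \<le> M"
  shows "norm (poly_op ((*) a) p a - poly_op ((*) a) q a) \<le> M"
proof (rule norm_le_left_mult)
  show "0 \<le> M" using assms[of 0] by simp
  fix z
  have "(poly_op ((*) a) p a - poly_op ((*) a) q a) * z = poly_op ((*) a) (pCons 0 (p - q)) z"
    by (simp add: left_diff_distrib poly_op_self_mult poly_op_pCons[OF linear_mult_left]
        poly_op_diff[OF linear_mult_left] right_diff_distrib)
  also have "norm \<dots> \<le> M * norm z"
    using assms by (intro poly_op_norm a) (auto simp: algebra_simps)
  finally show "norm ((poly_op ((*) a) p a - poly_op ((*) a) q a) * z) \<le> M * norm z" .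
qed

lemma cfc_exists:
  assumes f: "null_cont f"
  obtains b where "\<And>q M. (\<And>t. t \<in> {-1..1} \<Longrightarrow> \<bar>f t - t * poly q t\<bar> \<le> M) \<Longrightarrow>
    norm (b - poly_op ((*) a) q a) \<le> M"
proof -
  have "\<exists>q. \<forall>t\<in>{-1..1}. \<bar>f t - t * poly q t\<bar> \<le> 1 / real (Suc n)" for n
    by (rule weierstrass_vanishing_at_0[OF f, of "1 / real (Suc n)"]) (simp, blast)
  then obtain q where q: "\<And>n t. t \<in> {-1..1} \<Longrightarrow> \<bar>f t - t * poly (q n) t\<bar> \<le> 1 / real (Suc n)"
    by metis
  define x where "x = (\<lambda>n. poly_op ((*) a) (q n) a)"
  have bound: "norm (x n - poly_op ((*) a) p a) \<le> 1 / real (Suc n) + M"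
    if p: "\<And>t. t \<in> {-1..1} \<Longrightarrow> \<bar>f t - t * poly p t\<bar> \<le> M" for n p M
    unfolding x_def
  proof (rule poly_op_self_diff_norm)
    fix t :: real assume "t \<in> {-1..1}"
    then show "\<bar>t * poly (q n) t - t * poly p t\<bar> \<le> 1 / real (Suc n) + M"
      using q[of t n] p[of t] by linarith
  qed
  have "Cauchy x"
  proof (rule CauchyI')
    fix e :: real assume "e > 0"
    then obtain N where N: "1 / real (Suc N) < e / 2" using nat_approx_posE[of "e/2"] by auto
    have "dist (x m) (x n) < e" if "m \<ge> N" "n > m" for m n
    proof -
      have "dist (x m) (x n) \<le> 1 / real (Suc m) + 1 / real (Suc n)"
        using bound[OF q] by (simp add: dist_norm x_def)
      also have "\<dots> \<le> 1 / real (Suc N) + 1 / real (Suc N)"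
        using that by (intro add_mono divide_left_mono) auto
      finally show ?thesis using N by simp
    qed
    then show "\<exists>M. \<forall>m\<ge>M. \<forall>n>m. dist (x m) (x n) < e" by blast
  qed
  then obtain b where b: "x \<longlonglongrightarrow> b" using Cauchy_convergent convergentD by blast
  show thesis
  proof
    fix p M assume p: "\<And>t. t \<in> {-1..1} \<Longrightarrow> \<bar>f t - t * poly p t\<bar> \<le> M"
    have "(\<lambda>n. 1 / real (Suc n) + M) \<longlonglongrightarrow> 0 + M"
      by (intro tendsto_intros LIMSEQ_Suc[OF lim_1_over_n])
    moreover have "(\<lambda>n. norm (x n - poly_op ((*) a) p a)) \<longlonglongrightarrow> norm (b - poly_op ((*) a) p a)"
      by (intro tendsto_intros b)
    ultimately show "norm (b - poly_op ((*) a) p a) \<le> M"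
      using LIMSEQ_le[of _ "norm (b - poly_op ((*) a) p a)" _ "0 + M"] bound[OF p] by auto
  qed
qed

end

text \<open>
  The element is described by its distance to every polynomial in \<open>a\<close>, rather than as the limit of one
  chosen sequence, so that each later estimate may use whichever approximation suits it.
\<close>

definition cfc :: "'a::cstar_algebra \<Rightarrow> (real \<Rightarrow> real) \<Rightarrow> 'a" where
  "cfc a f = (SOME b. \<forall>q M. (\<forall>t\<in>{-1..1}. \<bar>f t - t * poly q t\<bar> \<le> M) \<longrightarrow>
    norm (b - poly_op ((*) a) q a) \<le> M)"

context
  fixes a :: "'a::cstar_algebra"
  assumes a: "selfadj a" "norm a \<le> 1"
begin

lemma cfc_approx:
  assumes f: "null_cont f" and q: "\<And>t. t \<in> {-1..1} \<Longrightarrow> \<bar>f t - t * poly q t\<bar> \<le> M"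
  shows "norm (cfc a f - poly_op ((*) a) q a) \<le> M"
proof -
  obtain b where "\<forall>q M. (\<forall>t\<in>{-1..1}. \<bar>f t - t * poly q t\<bar> \<le> M) \<longrightarrow>
    norm (b - poly_op ((*) a) q a) \<le> M"
    using cfc_exists[OF a f] by metis
  then have "\<forall>q M. (\<forall>t\<in>{-1..1}. \<bar>f t - t * poly q t\<bar> \<le> M) \<longrightarrow>
    norm (cfc a f - poly_op ((*) a) q a) \<le> M"
    unfolding cfc_def by (rule someI)
  then show ?thesis using q by blast
qed

lemma cfc_LIMSEQ:
  assumes f: "null_cont f" and lim: "uniform_limit {-1..1} (\<lambda>n t. t * poly (q n) t) f sequentially"
  shows "(\<lambda>n. poly_op ((*) a) (q n) a) \<longlonglongrightarrow> cfc a f"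
proof (rule LIMSEQ_I)
  fix e :: real assume e: "0 < e"
  obtain N where N: "\<forall>n\<ge>N. \<forall>t\<in>{-1..1}. dist (t * poly (q n) t) (f t) < e / 2"
    using lim e half_gt_zero unfolding uniform_limit_sequentially_iff by blast
  have "norm (poly_op ((*) a) (q n) a - cfc a f) < e" if "n \<ge> N" for n
  proof -
    have "norm (cfc a f - poly_op ((*) a) (q n) a) \<le> e / 2"
      using N that by (intro cfc_approx f) (auto simp: dist_real_def abs_minus_commute less_imp_le)
    then show ?thesis using e by (simp add: norm_minus_commute)
  qed
  then show "\<exists>N. \<forall>n\<ge>N. norm (poly_op ((*) a) (q n) a - cfc a f) < e" by blast
qed

lemma cfc_sequence:
  assumes f: "null_cont f"
  obtains q where "uniform_limit {-1..1} (\<lambda>n t. t * poly (q n) t) f sequentially"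
    "(\<lambda>n. poly_op ((*) a) (q n) a) \<longlonglongrightarrow> cfc a f"
proof -
  have "\<exists>q. \<forall>t\<in>{-1..1}. \<bar>f t - t * poly q t\<bar> \<le> 1 / real (Suc n)" for n
    by (rule weierstrass_vanishing_at_0[OF f, of "1 / real (Suc n)"]) (simp, blast)
  then obtain q where q: "\<And>n t. t \<in> {-1..1} \<Longrightarrow> \<bar>f t - t * poly (q n) t\<bar> \<le> 1 / real (Suc n)"
    by metis
  have "uniform_limit {-1..1} (\<lambda>n t. t * poly (q n) t) f sequentially"
    unfolding uniform_limit_sequentially_iff
  proof (intro allI impI)
    fix e :: real assume "e > 0"
    then obtain N where N: "1 / real (Suc N) < e" using nat_approx_posE[of e] by auto
    have "dist (t * poly (q n) t) (f t) < e" if "n \<ge> N" "t \<in> {-1..1}" for n t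
    proof -
      have "1 / real (Suc n) \<le> 1 / real (Suc N)" using that by (intro divide_left_mono) auto
      then show ?thesis using q[OF that(2), of n] N
        by (simp add: dist_real_def abs_minus_commute)
    qed
    then show "\<exists>N. \<forall>n\<ge>N. \<forall>t\<in>{-1..1}. dist (t * poly (q n) t) (f t) < e" by blast
  qed
  then show thesis using that cfc_LIMSEQ[OF f] by blast
qed

text \<open>
  The function \<open>c + f\<close> need not vanish at \<open>0\<close>, but it still acts on the algebra by left
  multiplication, and that action is bounded by its supremum.
\<close>

lemma cfc_norm:
  assumes f: "null_cont f" and M: "\<And>t. t \<in> {-1..1} \<Longrightarrow> \<bar>c + f t\<bar> \<le> M"
  shows "norm (c *\<^sub>R z + cfc a f * z) \<le> M * norm z"
proof (rule field_le_epsilon)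
  fix e' :: real assume e': "0 < e'"
  define e where "e = e' / (2 * (norm z + 1))"
  have nz: "norm z + 1 > 0" by (simp add: add_nonneg_pos)
  have e: "e > 0" using e' nz by (simp add: e_def)
  obtain q where q: "\<And>t. t \<in> {-1..1} \<Longrightarrow> \<bar>f t - t * poly q t\<bar> \<le> e"
    using weierstrass_vanishing_at_0[OF f e] by blast
  have "norm ((cfc a f - poly_op ((*) a) q a) * z) \<le> e * norm z"
    using norm_mult_ineq[of "cfc a f - poly_op ((*) a) q a" z] cfc_approx[OF f q]
    by (meson mult_right_mono norm_ge_zero order_trans)
  moreover have "norm (poly_op ((*) a) (pCons c q) z) \<le> (M + e) * norm z"
  proof (intro poly_op_norm a)
    fix t :: real assume "t \<in> {-1..1}"
    then show "\<bar>poly (pCons c q) t\<bar> \<le> M + e" using M[of t] q[of t] by simp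
  qed
  moreover have eq: "c *\<^sub>R z + cfc a f * z =
      poly_op ((*) a) (pCons c q) z + (cfc a f - poly_op ((*) a) q a) * z"
    by (simp add: poly_op_pCons[OF linear_mult_left] left_diff_distrib poly_op_self_mult)
  ultimately have "norm (c *\<^sub>R z + cfc a f * z) \<le> (M + e) * norm z + e * norm z"
    unfolding eq
    using norm_triangle_ineq[of "poly_op ((*) a) (pCons c q) z" "(cfc a f - poly_op ((*) a) q a) * z"]
    by linarith
  also have "\<dots> = M * norm z + 2 * e * norm z" by (simp add: algebra_simps)
  also have "2 * e * norm z \<le> e'"
    using e' nz by (simp add: e_def field_simps)
  finally show "norm (c *\<^sub>R z + cfc a f * z) \<le> M * norm z + e'" by simp
qed

lemma cfc_norm_le:
  assumes "null_cont f" "\<And>t. t \<in> {-1..1} \<Longrightarrow> \<bar>f t\<bar> \<le> M"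
  shows "norm (cfc a f) \<le> M"
proof (rule norm_le_left_mult)
  show "0 \<le> M" using assms(2)[of 0] by simp
  show "norm (cfc a f * z) \<le> M * norm z" for z
    using cfc_norm[OF assms(1), of 0 M z] assms(2) by simp
qed

lemma cfc_selfadj:
  assumes "null_cont f" shows "selfadj (cfc a f)"
proof -
  obtain q where q: "(\<lambda>n. poly_op ((*) a) (q n) a) \<longlonglongrightarrow> cfc a f"
    using cfc_sequence[OF assms] by blast
  from tendsto_cstar[OF q] have "(\<lambda>n. poly_op ((*) a) (q n) a) \<longlonglongrightarrow> cstar (cfc a f)"
    using selfadj_poly_op[OF a(1)] by (simp add: selfadj_def)
  then show ?thesis using q LIMSEQ_unique by (auto simp: selfadj_def)
qed

lemma bounded_null_cont: "null_cont f \<Longrightarrow> bounded (f ` {-1..1})"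
  by (auto intro!: compact_imp_bounded compact_continuous_image)

lemma cfc_mult:
  assumes f: "null_cont f" and g: "null_cont g"
  shows "cfc a (\<lambda>t. f t * g t) = cfc a f * cfc a g"
proof -
  obtain p where p: "uniform_limit {-1..1} (\<lambda>n t. t * poly (p n) t) f sequentially"
    "(\<lambda>n. poly_op ((*) a) (p n) a) \<longlonglongrightarrow> cfc a f" using cfc_sequence[OF f] by blast
  obtain q where q: "uniform_limit {-1..1} (\<lambda>n t. t * poly (q n) t) g sequentially"
    "(\<lambda>n. poly_op ((*) a) (q n) a) \<longlonglongrightarrow> cfc a g" using cfc_sequence[OF g] by blast
  have "uniform_limit {-1..1} (\<lambda>n t. (t * poly (p n) t) * (t * poly (q n) t)) (\<lambda>t. f t * g t) sequentially"
    by (intro uniform_lim_mult p q bounded_null_cont f g)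
  then have u: "uniform_limit {-1..1} (\<lambda>n t. t * poly (pCons 0 (p n * q n)) t) (\<lambda>t. f t * g t) sequentially"
    by (simp add: mult_ac)
  have "null_cont (\<lambda>t. f t * g t)" using f g by (auto intro: continuous_on_mult)
  from cfc_LIMSEQ[OF this u]
  have "(\<lambda>n. poly_op ((*) a) (pCons 0 (p n * q n)) a) \<longlonglongrightarrow> cfc a (\<lambda>t. f t * g t)" .
  moreover have "poly_op ((*) a) (pCons 0 (r * s)) a = poly_op ((*) a) r a * poly_op ((*) a) s a" for r s
    by (simp add: poly_op_pCons[OF linear_mult_left] poly_op_mult[OF linear_mult_left] poly_op_self_mult)
  ultimately show ?thesis
    using tendsto_mult[OF p(2) q(2)] LIMSEQ_unique by auto
qed

lemma cfc_add:
  assumes f: "null_cont f" and g: "null_cont g"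
  shows "cfc a (\<lambda>t. f t + g t) = cfc a f + cfc a g"
proof -
  obtain p where p: "uniform_limit {-1..1} (\<lambda>n t. t * poly (p n) t) f sequentially"
    "(\<lambda>n. poly_op ((*) a) (p n) a) \<longlonglongrightarrow> cfc a f" using cfc_sequence[OF f] by blast
  obtain q where q: "uniform_limit {-1..1} (\<lambda>n t. t * poly (q n) t) g sequentially"
    "(\<lambda>n. poly_op ((*) a) (q n) a) \<longlonglongrightarrow> cfc a g" using cfc_sequence[OF g] by blast
  have "uniform_limit {-1..1} (\<lambda>n t. (t * poly (p n) t) + (t * poly (q n) t)) (\<lambda>t. f t + g t) sequentially"
    by (intro uniform_limit_add p q)
  then have u: "uniform_limit {-1..1} (\<lambda>n t. t * poly (p n + q n) t) (\<lambda>t. f t + g t) sequentially"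
    by (simp add: algebra_simps)
  have "null_cont (\<lambda>t. f t + g t)" using f g by (auto intro: continuous_on_add)
  from cfc_LIMSEQ[OF this u]
  have "(\<lambda>n. poly_op ((*) a) (p n + q n) a) \<longlonglongrightarrow> cfc a (\<lambda>t. f t + g t)" .
  then show ?thesis
    using tendsto_add[OF p(2) q(2)] LIMSEQ_unique by (auto simp: poly_op_add[OF linear_mult_left])
qed

lemma cfc_scale:
  assumes f: "null_cont f"
  shows "cfc a (\<lambda>t. c * f t) = c *\<^sub>R cfc a f"
proof -
  obtain p where p: "uniform_limit {-1..1} (\<lambda>n t. t * poly (p n) t) f sequentially"
    "(\<lambda>n. poly_op ((*) a) (p n) a) \<longlonglongrightarrow> cfc a f" using cfc_sequence[OF f] by blast
  have "uniform_limit {-1..1} (\<lambda>n t. c * (t * poly (p n) t)) (\<lambda>t. c * f t) sequentially"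
    by (intro bounded_linear_uniform_limit_intros p)
  then have u: "uniform_limit {-1..1} (\<lambda>n t. t * poly (smult c (p n)) t) (\<lambda>t. c * f t) sequentially"
    by (simp add: mult_ac)
  have "null_cont (\<lambda>t. c * f t)" using f by (auto intro: continuous_intros)
  from cfc_LIMSEQ[OF this u]
  have "(\<lambda>n. poly_op ((*) a) (smult c (p n)) a) \<longlonglongrightarrow> cfc a (\<lambda>t. c * f t)" .
  then show ?thesis
    using tendsto_scaleR[OF tendsto_const p(2), of c] LIMSEQ_unique
    by (auto simp: poly_op_smult[OF linear_mult_left])
qed

lemma cfc_ident: "cfc a (\<lambda>t. t) = a"
  using cfc_approx[of "\<lambda>t. t" "[:1:]" 0] by (simp add: poly_op_const)

lemma cfc_in_closed:
  assumes "null_cont f" "closed S" "\<And>q. poly_op ((*) a) q a \<in> S"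
  shows "cfc a f \<in> S"
proof -
  obtain q where q: "(\<lambda>n. poly_op ((*) a) (q n) a) \<longlonglongrightarrow> cfc a f"
    using cfc_sequence[OF assms(1)] by blast
  show ?thesis by (rule closed_sequentially[OF assms(2) _ q]) (rule assms(3))
qed

lemma cfc_mult_unit:
  assumes f: "null_cont f" and e: "e * a = a"
  shows "e * cfc a f = cfc a f"
proof -
  have "closed {w. e * w = w}" by (intro closed_Collect_eq continuous_intros)
  moreover have "poly_op ((*) a) q a \<in> {w. e * w = w}" for q
    by (induction q) (auto simp: poly_op_pCons[OF linear_mult_left] distrib_left e mult.assoc[symmetric])
  ultimately show ?thesis using cfc_in_closed[OF f] by blast
qed

lemma cfc_annihilates:
  assumes f: "null_cont f" and v: "a * v = 0"
  shows "cfc a f * v = 0"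
proof -
  have "closed {w. w * v = 0}" by (intro closed_Collect_eq continuous_intros)
  moreover have "poly_op ((*) a) q a \<in> {w. w * v = 0}" for q
    using v by (simp add: poly_op_mult_right[symmetric] linear_0[OF linear_poly_op[OF linear_mult_left]])
  ultimately show ?thesis using cfc_in_closed[OF f] by blast
qed

end

section \<open>Ideals, and the spectrum modulo an ideal\<close>

definition closed_star_ideal :: "'a::cstar_algebra set \<Rightarrow> bool" where
  "closed_star_ideal J \<longleftrightarrow> 0 \<in> J \<and> (\<forall>x\<in>J. \<forall>y\<in>J. x + y \<in> J) \<and> (\<forall>c. \<forall>x\<in>J. c *\<^sub>C x \<in> J) \<and>
     (\<forall>x\<in>J. \<forall>y. x * y \<in> J \<and> y * x \<in> J) \<and> (\<forall>x\<in>J. cstar x \<in> J) \<and> closed J"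

context
  fixes J :: "'a::cstar_algebra set"
  assumes J: "closed_star_ideal J"
begin

lemma ideal_zero: "0 \<in> J" and ideal_add: "x \<in> J \<Longrightarrow> y \<in> J \<Longrightarrow> x + y \<in> J"
  and ideal_scaleC: "x \<in> J \<Longrightarrow> c *\<^sub>C x \<in> J"
  and ideal_mult_right: "x \<in> J \<Longrightarrow> x * y \<in> J" and ideal_mult_left: "x \<in> J \<Longrightarrow> y * x \<in> J"
  and ideal_cstar: "x \<in> J \<Longrightarrow> cstar x \<in> J" and ideal_closed: "closed J"
  using J by (auto simp: closed_star_ideal_def)

lemma ideal_scaleR: "x \<in> J \<Longrightarrow> r *\<^sub>R x \<in> J"
  by (simp add: scaleR_scaleC ideal_scaleC)

lemma ideal_diff: "x \<in> J \<Longrightarrow> y \<in> J \<Longrightarrow> x - y \<in> J"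
  using ideal_add[of x "- y"] ideal_scaleR[of y "-1"] by simp

lemma ideal_cfc:
  assumes a: "selfadj a" "norm a \<le> 1" and "a \<in> J" "null_cont f"
  shows "cfc a f \<in> J"
proof (rule cfc_in_closed[OF a \<open>null_cont f\<close> ideal_closed])
  show "poly_op ((*) a) q a \<in> J" for q
    using \<open>a \<in> J\<close> by (induction q)
      (auto simp: poly_op_pCons[OF linear_mult_left] ideal_zero ideal_add ideal_scaleR ideal_mult_left)
qed

end

text \<open>
  Up to the point \<open>0\<close>, which it always contains, this is the spectrum of the image of \<open>a\<close> in the
  quotient by \<open>J\<close>, expressed without forming the quotient.
\<close>

definition ess_spectrum :: "'a::cstar_algebra set \<Rightarrow> 'a \<Rightarrow> real set" where
  "ess_spectrum J a = {t\<in>{-1..1}. \<forall>h. null_cont h \<and> cfc a h \<in> J \<longrightarrow> h t = 0}"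

text \<open>
  The functions that \<open>a\<close> carries into \<open>J\<close> form a closed ideal of functions. By compactness it has
  a nonnegative member that is bounded below where \<open>\<bar>k\<bar>\<close> is not small, and multiplying that member by a
  suitable continuous function approximates \<open>k\<close>.
\<close>

lemma cfc_in_ideal:
  assumes J: "closed_star_ideal J" and a: "selfadj a" "norm a \<le> 1"
    and k: "null_cont k" "\<And>t. t \<in> ess_spectrum J a \<Longrightarrow> k t = 0"
  shows "cfc a k \<in> J"
proof -
  have "\<exists>b\<in>J. norm (b - cfc a k) \<le> e" if e: "0 < e" for e
  proof -
    define K where "K = {t\<in>{-1..1}. e \<le> \<bar>k t\<bar>}"
    have "continuous_on {-1..1} (\<lambda>t. \<bar>k t\<bar>)" using k(1) by (auto intro: continuous_intros)
    then have "closed ({-1..1} \<inter> (\<lambda>t. \<bar>k t\<bar>) -` {e..})"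
      by (rule continuous_closed_preimage) auto
    moreover have "K = {-1..1} \<inter> (\<lambda>t. \<bar>k t\<bar>) -` {e..}" by (auto simp: K_def)
    ultimately have "closed K" by simp
    then have "compact K"
      by (rule compact_Int_closed[of "{-1..1}" K, OF compact_Icc, THEN back_subst[of compact]]) (auto simp: K_def)
    have "\<exists>h. null_cont h \<and> cfc a h \<in> J \<and> h t \<noteq> 0" if "t \<in> K" for t
    proof -
      have "t \<notin> ess_spectrum J a" using k(2)[of t] that e by (auto simp: K_def)
      then show ?thesis using that by (auto simp: K_def ess_spectrum_def)
    qed
    then obtain h where h: "\<And>t. t \<in> K \<Longrightarrow> null_cont (h t) \<and> cfc a (h t) \<in> J \<and> h t t \<noteq> 0"
      by metis
    have "\<exists>d>0. \<forall>s\<in>{-1..1}. dist s t < d \<longrightarrow> h t s \<noteq> 0" if "t \<in> K" for t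
    proof -
      have "continuous_on {-1..1} (h t)" "t \<in> {-1..1}" "\<bar>h t t\<bar> > 0"
        using h[OF that] that by (auto simp: K_def)
      then obtain d where "d > 0" "\<And>s. s \<in> {-1..1} \<Longrightarrow> dist s t < d \<Longrightarrow> dist (h t s) (h t t) < \<bar>h t t\<bar>"
        unfolding continuous_on_iff by meson
      then show ?thesis by (intro exI[of _ d]) (force simp: dist_real_def)
    qed
    then obtain d where d: "\<And>t. t \<in> K \<Longrightarrow> d t > 0"
      "\<And>s t. t \<in> K \<Longrightarrow> s \<in> {-1..1} \<Longrightarrow> dist s t < d t \<Longrightarrow> h t s \<noteq> 0"
      by metis
    obtain T where T: "T \<subseteq> K" "finite T" "K \<subseteq> (\<Union>t\<in>T. ball t (d t))"
      by (rule compactE_image[OF \<open>compact K\<close>, of K "\<lambda>t. ball t (d t)"]) (use d(1) in auto)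
    define H where "H = (\<lambda>s. \<Sum>t\<in>T. h t s * h t s)"
    have H_ideal: "null_cont H \<and> cfc a H \<in> J"
      using T(2,1) unfolding H_def
    proof (induction T rule: finite_induct)
      case empty
      have "norm (cfc a (\<lambda>_. 0)) \<le> 0" by (rule cfc_norm_le[OF a]) auto
      then show ?case by (simp add: ideal_zero[OF J])
    next
      case (insert t T)
      have t: "null_cont (h t)" "cfc a (h t) \<in> J" using h insert.prems by auto
      have t2: "null_cont (\<lambda>s. h t s * h t s)" using t by (auto intro: continuous_intros)
      moreover have "cfc a (\<lambda>s. h t s * h t s) \<in> J"
        using cfc_mult[OF a t(1) t(1)] t(2) by (simp add: ideal_mult_left[OF J])
      moreover have IH: "null_cont (\<lambda>s. \<Sum>t\<in>T. h t s * h t s)" "cfc a (\<lambda>s. \<Sum>t\<in>T. h t s * h t s) \<in> J"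
        using insert by auto
      ultimately have "cfc a (\<lambda>s. h t s * h t s + (\<Sum>t\<in>T. h t s * h t s)) \<in> J"
        by (simp add: cfc_add[OF a t2 IH(1)] ideal_add[OF J])
      moreover have "null_cont (\<lambda>s. h t s * h t s + (\<Sum>t\<in>T. h t s * h t s))"
        using t2 IH(1) by (auto intro: continuous_intros)
      ultimately show ?case using insert by simp
    qed
    have H_nonneg: "0 \<le> H s" for s by (simp add: H_def sum_nonneg)
    have H_pos: "0 < H s" if "s \<in> K" for s
    proof -
      obtain t where t: "t \<in> T" "dist s t < d t" using T(3) \<open>s \<in> K\<close> by (auto simp: dist_commute)
      then have "h t s \<noteq> 0" using d(2)[of t s] that T(1) by (auto simp: K_def)
      then show ?thesis unfolding H_def using t(1)
        by (intro sum_pos2[OF T(2)]) (auto simp: zero_less_mult_iff)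
    qed
    obtain m where m: "m > 0" "\<And>s. s \<in> K \<Longrightarrow> m \<le> H s"
    proof (cases "K = {}")
      case True
      then show thesis using that[of 1] by auto
    next
      case False
      have "continuous_on K H" using H_ideal by (auto intro: continuous_on_subset simp: K_def)
      from continuous_attains_inf[OF \<open>compact K\<close> False this] obtain s0 where
        "s0 \<in> K" "\<forall>s\<in>K. H s0 \<le> H s" by blast
      then show thesis using that[of "H s0"] H_pos by auto
    qed
    \<comment> \<open>With this cofactor \<open>H w\<close> equals \<open>k\<close> where \<open>H \<ge> m\<close> and is nowhere larger than \<open>k\<close> in modulus.\<close>
    define w where "w = (\<lambda>s. k s / max m (H s))"
    have w: "null_cont w"
      using k(1) H_ideal m(1) unfolding w_def by (auto intro!: continuous_intros)
    have Hw: "null_cont (\<lambda>s. H s * w s)" using w H_ideal by (auto intro: continuous_intros)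
    have "cfc a (\<lambda>s. H s * w s) \<in> J"
      using H_ideal by (simp add: cfc_mult[OF a _ w] ideal_mult_right[OF J])
    moreover have "norm (cfc a (\<lambda>s. H s * w s) - cfc a k) \<le> e"
    proof -
      have u: "null_cont (\<lambda>s. (-1) * k s)" using k(1) by (auto intro: continuous_intros)
      have "cfc a (\<lambda>s. H s * w s) - cfc a k = cfc a (\<lambda>s. H s * w s + (-1) * k s)"
        unfolding cfc_add[OF a Hw u] cfc_scale[OF a k(1)] by simp
      also have "norm \<dots> \<le> e"
      proof (rule cfc_norm_le[OF a])
        show "null_cont (\<lambda>s. H s * w s + (-1) * k s)"
          using H_ideal w k(1) by (auto intro!: continuous_intros)
        fix s :: real assume s: "s \<in> {-1..1}"
        show "\<bar>H s * w s + (-1) * k s\<bar> \<le> e"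
        proof (cases "s \<in> K")
          case True
          then have "max m (H s) = H s" "H s \<noteq> 0" using m(2) H_pos[OF True] by (auto simp: max_absorb2)
          then show ?thesis using e by (simp add: w_def)
        next
          case False
          have pos: "max m (H s) > 0" using m(1) by simp
          have "H s * w s + (-1) * k s = - (k s * (1 - H s / max m (H s)))"
            by (simp add: w_def algebra_simps)
          also have "\<bar>\<dots>\<bar> \<le> \<bar>k s\<bar> * 1"
            unfolding abs_minus_cancel abs_mult
          proof (intro mult_left_mono)
            have "0 \<le> H s / max m (H s)" "H s / max m (H s) \<le> 1"
              using pos H_nonneg[of s] by (auto simp: divide_le_eq_1)
            then show "\<bar>1 - H s / max m (H s)\<bar> \<le> 1" by linarith
          qed simp
          finally show ?thesis using False s by (auto simp: K_def)
        qed
      qed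
      finally show ?thesis .
    qed
    ultimately show ?thesis by blast
  qed
  then have "cfc a k \<in> closure J"
    unfolding closure_approachable dist_norm
    by (meson dense le_less_trans)
  then show ?thesis using ideal_closed[OF J] by simp
qed

section \<open>Chains of bumps\<close>

definition bump :: "real \<Rightarrow> real \<Rightarrow> real \<Rightarrow> real" where
  "bump t d s = max 0 (min 1 (2 - \<bar>s - t\<bar> / d))"

lemma bump_continuous: "d > 0 \<Longrightarrow> continuous_on A (bump t d)"
  unfolding bump_def by (intro continuous_intros) auto

lemma bump_range: "0 \<le> bump t d s" "bump t d s \<le> 1"
  by (auto simp: bump_def)

lemma bump_center [simp]: "bump t d t = 1"
  by (simp add: bump_def)

lemma bump_eq_1: "d > 0 \<Longrightarrow> \<bar>s - t\<bar> \<le> d \<Longrightarrow> bump t d s = 1"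
  by (auto simp: bump_def field_simps)

lemma bump_eq_0: "d > 0 \<Longrightarrow> 2 * d \<le> \<bar>s - t\<bar> \<Longrightarrow> bump t d s = 0"
  by (auto simp: bump_def field_simps)

lemma bump_null_cont: "d > 0 \<Longrightarrow> 2 * d \<le> \<bar>t\<bar> \<Longrightarrow> null_cont (bump t d)"
  using bump_eq_0[of d 0 t] by (simp add: bump_continuous)

lemma bump_mult: "d > 0 \<Longrightarrow> 2 * d' \<le> d \<Longrightarrow> d' > 0 \<Longrightarrow> bump t d s * bump t d' s = bump t d' s"
  using bump_eq_1[of d s t] bump_eq_0[of d' s t] by (cases "\<bar>s - t\<bar> \<le> d") auto

text \<open>
  The model is a sequence of bump functions of one selfadjoint element, all equal to \<open>1\<close> near a point of
  its spectrum modulo \<open>J\<close>, each equal to \<open>1\<close> on the support of the next. The norm condition holds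
  because \<open>e k + r (e j - e k)\<close> is a function of modulus at most \<open>1\<close>. It is what forces a
  contractive functional with value \<open>1\<close> at \<open>e k\<close> to have value \<open>1\<close> at every earlier bump.
\<close>

definition bump_chain :: "'a::cstar_algebra set \<Rightarrow> (nat \<Rightarrow> 'a) \<Rightarrow> bool" where
  "bump_chain J e \<longleftrightarrow> (\<forall>k. selfadj (e k)) \<and> (\<forall>k. e k \<notin> J) \<and> (\<forall>j k. j < k \<longrightarrow> e j * e k = e k) \<and>
     (\<forall>j k r. j < k \<longrightarrow> \<bar>r\<bar> \<le> 1 \<longrightarrow> norm (e k + r *\<^sub>R (e j - e k)) \<le> 1)"

context
  fixes J :: "'a::cstar_algebra set" and e
  assumes e: "bump_chain J e"
begin

lemma chain_selfadj: "selfadj (e k)" and chain_notin: "e k \<notin> J"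
  and chain_mult: "j < k \<Longrightarrow> e j * e k = e k"
  and chain_norm_comb: "j < k \<Longrightarrow> \<bar>r\<bar> \<le> 1 \<Longrightarrow> norm (e k + r *\<^sub>R (e j - e k)) \<le> 1"
  using e by (auto simp: bump_chain_def)

lemma chain_mult_right: "j < k \<Longrightarrow> e k * e j = e k"
  using chain_mult[of j k] chain_selfadj unfolding selfadj_def by (metis cstar_mult)

lemma chain_norm_le: "norm (e k) \<le> 1"
  using chain_norm_comb[of k "Suc k" 1] by simp

lemma chain_norm: assumes "closed_star_ideal J" shows "norm (e k) = 1"
proof -
  have "norm (e (Suc k)) \<le> norm (e k) * norm (e (Suc k))"
    using norm_mult_ineq[of "e k" "e (Suc k)"] by (simp add: chain_mult)
  moreover have "e (Suc k) \<noteq> 0" using chain_notin[of "Suc k"] ideal_zero[OF assms] by metis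
  ultimately show ?thesis using chain_norm_le[of k] by simp
qed

end

text \<open>
  A bump centred at a point of the spectrum modulo \<open>J\<close> is \<open>1\<close> there, so it cannot be carried into \<open>J\<close>.
\<close>

lemma bump_chain_at:
  assumes a: "selfadj a" "norm a \<le> 1" and t: "t \<in> ess_spectrum J a" and d: "d > 0" "2 * d \<le> \<bar>t\<bar>"
  shows "bump_chain J (\<lambda>k. cfc a (bump t (d / 2 ^ k)))"
proof -
  have dk: "d / 2 ^ k > 0" "2 * (d / 2 ^ k) \<le> \<bar>t\<bar>" for k
  proof -
    show "d / 2 ^ k > 0" using d by simp
    have "d / 2 ^ k \<le> d / 1" using d by (intro divide_left_mono) auto
    then show "2 * (d / 2 ^ k) \<le> \<bar>t\<bar>" using d by linarith
  qed
  have u: "null_cont (bump t (d / 2 ^ k))" for k by (rule bump_null_cont[OF dk])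
  have mult: "bump t (d / 2 ^ j) s * bump t (d / 2 ^ k) s = bump t (d / 2 ^ k) s" if "j < k" for j k s
  proof (rule bump_mult[OF dk(1) _ dk(1)])
    have "(2::real) ^ Suc j \<le> 2 ^ k" using that by (intro power_increasing) auto
    then have "d / 2 ^ k \<le> d / 2 ^ Suc j" using d by (intro divide_left_mono) auto
    then show "2 * (d / 2 ^ k) \<le> d / 2 ^ j" by simp
  qed
  show ?thesis
    unfolding bump_chain_def
  proof (intro conjI allI impI)
    fix k show "selfadj (cfc a (bump t (d / 2 ^ k)))" by (rule cfc_selfadj[OF a u])
    show "cfc a (bump t (d / 2 ^ k)) \<notin> J" using t u by (force simp: ess_spectrum_def)
    fix j :: nat assume jk: "j < k"
    show "cfc a (bump t (d / 2 ^ j)) * cfc a (bump t (d / 2 ^ k)) = cfc a (bump t (d / 2 ^ k))"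
      unfolding cfc_mult[OF a u u, symmetric] mult[OF jk] ..
    fix r :: real assume r: "\<bar>r\<bar> \<le> 1"
    have u1: "null_cont (\<lambda>s. (1 - r) * bump t (d / 2 ^ k) s)" "null_cont (\<lambda>s. r * bump t (d / 2 ^ j) s)"
      using u[of k] u[of j] by (auto intro: continuous_intros)
    have "cfc a (bump t (d / 2 ^ k)) + r *\<^sub>R (cfc a (bump t (d / 2 ^ j)) - cfc a (bump t (d / 2 ^ k)))
       = cfc a (\<lambda>s. (1 - r) * bump t (d / 2 ^ k) s + r * bump t (d / 2 ^ j) s)"
      unfolding cfc_add[OF a u1] cfc_scale[OF a u] by (simp add: algebra_simps)
    also have "norm \<dots> \<le> 1"
    proof (rule cfc_norm_le[OF a])
      show "null_cont (\<lambda>s. (1 - r) * bump t (d / 2 ^ k) s + r * bump t (d / 2 ^ j) s)"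
        using u1 by (auto intro: continuous_intros)
      fix s
      define x y where "x = bump t (d / 2 ^ k) s" and "y = bump t (d / 2 ^ j) s"
      have xy: "y * x = x" "0 \<le> x" "x \<le> 1" "0 \<le> y" "y \<le> 1"
        using mult[OF jk, of s] bump_range by (auto simp: x_def y_def)
      have "\<bar>(1 - r) * x + r * y\<bar> \<le> 1"
      proof (cases "x = 0")
        case True
        then show ?thesis using r xy by (simp add: abs_mult mult_le_one)
      next
        case False
        then have "y = 1" using xy by simp
        have "(1 - r) * x + r = x * 1 + r * (1 - x)" by (simp add: algebra_simps)
        moreover have "\<bar>r * (1 - x)\<bar> \<le> 1 * (1 - x)"
          using r xy unfolding abs_mult by (intro mult_mono) auto
        ultimately show ?thesis using xy \<open>y = 1\<close> by (auto simp: abs_le_iff)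
      qed
      then show "\<bar>(1 - r) * bump t (d / 2 ^ k) s + r * bump t (d / 2 ^ j) s\<bar> \<le> 1"
        by (simp add: x_def y_def)
    qed
    finally show "norm (cfc a (bump t (d / 2 ^ k)) + r *\<^sub>R (cfc a (bump t (d / 2 ^ j)) - cfc a (bump t (d / 2 ^ k)))) \<le> 1" .
  qed
qed

section \<open>The Hahn-Banach theorem\<close>

definition sublinear :: "('b::real_vector \<Rightarrow> real) \<Rightarrow> bool" where
  "sublinear p \<longleftrightarrow> (\<forall>x y. p (x + y) \<le> p x + p y) \<and> (\<forall>r x. 0 < r \<longrightarrow> p (r *\<^sub>R x) \<le> r * p x)"

lemma sublinear_scale:
  assumes "sublinear p" "0 < r" shows "p (r *\<^sub>R x) = r * p x"
proof -
  have "p ((1/r) *\<^sub>R (r *\<^sub>R x)) \<le> (1/r) * p (r *\<^sub>R x)"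
    using assms unfolding sublinear_def by (meson zero_less_divide_1_iff)
  then have "r * p x \<le> p (r *\<^sub>R x)" using assms(2) by (simp add: field_simps)
  then show ?thesis using assms by (auto simp: sublinear_def intro: antisym)
qed

lemma sublinear_0: "sublinear p \<Longrightarrow> p 0 = 0"
  using sublinear_scale[of p 2 0] by simp

lemma sublinear_add: "sublinear p \<Longrightarrow> p (x + y) \<le> p x + p y"
  by (simp add: sublinear_def)

lemma sublinear_lower: "sublinear p \<Longrightarrow> - p (- x) \<le> p x"
  using sublinear_0[of p] sublinear_add[of p x "- x"] by simp

text \<open>
  This construction lowers \<open>p\<close> as far as its value at \<open>y\<close> permits. It is used twice: it cannot lower
  a minimal sublinear functional, which makes the latter additive, and applied before minimizing it
  keeps the value at \<open>y\<close> from dropping.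
\<close>

lemma sublinear_shift:
  fixes p :: "'b::real_vector \<Rightarrow> real" and x y :: 'b
  assumes p: "sublinear p"
  defines "p' \<equiv> \<lambda>x. INF t\<in>{0::real..}. p (x + t *\<^sub>R y) - t * p y"
  shows "sublinear p'" "p' x \<le> p x" "p' x \<le> p (x + y) - p y"
proof -
  have lower: "- p (- x) \<le> p (x + t *\<^sub>R y) - t * p y" if "0 \<le> t" for t x
  proof -
    have "t * p y = p (t *\<^sub>R y)"
      using that sublinear_scale[OF p, of t y] sublinear_0[OF p] by (cases "t = 0") auto
    also have "\<dots> \<le> p (x + t *\<^sub>R y) + p (- x)"
      using sublinear_add[OF p, of "x + t *\<^sub>R y" "- x"] by simp
    finally show ?thesis by simp
  qed
  then have bdd: "bdd_below ((\<lambda>t. p (x + t *\<^sub>R y) - t * p y) ` {0..})" for x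
    by (intro bdd_belowI2[of _ "- p (- x)"]) auto
  have upper: "p' x \<le> p (x + t *\<^sub>R y) - t * p y" if "0 \<le> t" for t x
    unfolding p'_def using that by (intro cINF_lower bdd) auto
  have great: "c \<le> p' x" if "\<And>t. 0 \<le> t \<Longrightarrow> c \<le> p (x + t *\<^sub>R y) - t * p y" for c x
    unfolding p'_def using that by (intro cINF_greatest) auto
  show "p' x \<le> p x" using upper[of 0 x] by simp
  show "p' x \<le> p (x + y) - p y" using upper[of 1 x] by simp
  show "sublinear p'"
    unfolding sublinear_def
  proof (intro conjI allI impI)
    fix x z
    have "p' (x + z) - p' z \<le> p' x"
    proof (rule great)
      fix t :: real assume t: "0 \<le> t"
      have "p' (x + z) - (p (x + t *\<^sub>R y) - t * p y) \<le> p' z"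
      proof (rule great)
        fix s :: real assume s: "0 \<le> s"
        have "p' (x + z) \<le> p ((x + t *\<^sub>R y) + (z + s *\<^sub>R y)) - (t + s) * p y"
          using upper[of "t + s" "x + z"] t s by (simp add: algebra_simps)
        also have "\<dots> \<le> p (x + t *\<^sub>R y) + p (z + s *\<^sub>R y) - (t + s) * p y"
          by (intro diff_right_mono sublinear_add p)
        finally show "p' (x + z) - (p (x + t *\<^sub>R y) - t * p y) \<le> p (z + s *\<^sub>R y) - s * p y"
          by (simp add: algebra_simps)
      qed
      then show "p' (x + z) - p' z \<le> p (x + t *\<^sub>R y) - t * p y" by simp
    qed
    then show "p' (x + z) \<le> p' x + p' z" by simp
  next
    fix r :: real and x assume r: "0 < r"
    have "p' (r *\<^sub>R x) / r \<le> p' x"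
    proof (rule great)
      fix t :: real assume t: "0 \<le> t"
      have "p' (r *\<^sub>R x) \<le> p (r *\<^sub>R (x + t *\<^sub>R y)) - (r * t) * p y"
        using upper[of "r * t" "r *\<^sub>R x"] t r by (simp add: scaleR_add_right)
      also have "\<dots> = r * (p (x + t *\<^sub>R y) - t * p y)"
        by (simp only: sublinear_scale[OF p r]) (simp add: algebra_simps)
      finally show "p' (r *\<^sub>R x) / r \<le> p (x + t *\<^sub>R y) - t * p y"
        using r by (simp add: divide_le_eq mult.commute)
    qed
    then show "p' (r *\<^sub>R x) \<le> r * p' x" using r by (simp add: divide_le_eq mult.commute)
  qed
qed

lemma minimal_sublinear:
  fixes p :: "'b::real_vector \<Rightarrow> real"
  assumes p: "sublinear p"
  obtains m where "sublinear m" "\<And>x. m x \<le> p x"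
    "\<And>q. sublinear q \<Longrightarrow> (\<And>x. q x \<le> m x) \<Longrightarrow> q = m"
proof -
  define A where "A = {q. sublinear q \<and> (\<forall>x. q x \<le> p x)}"
  define P where "P = (\<lambda>(q::'b \<Rightarrow> real) r. \<forall>x. r x \<le> q x)"
  have "\<exists>m\<in>A. \<forall>q\<in>A. P m q \<longrightarrow> q = m"
  proof (rule predicate_Zorn)
    show "partial_order_on A (relation_of P A)"
      by (rule partial_order_on_relation_ofI) (auto simp: P_def intro: order_trans intro!: ext antisym)
    fix C assume C: "C \<in> Chains (relation_of P A)"
    then have CA: "C \<subseteq> A" and comp: "\<And>q r. q \<in> C \<Longrightarrow> r \<in> C \<Longrightarrow> P q r \<or> P r q"
      by (auto simp: Chains_def relation_of_def)
    show "\<exists>u\<in>A. \<forall>q\<in>C. P q u"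
    proof (cases "C = {}")
      case True
      then show ?thesis using p by (auto simp: A_def intro!: bexI[of _ p])
    next
      case False
      define u where "u = (\<lambda>x. INF q\<in>C. q x)"
      have sub: "sublinear q" "q x \<le> p x" if "q \<in> C" for q x using CA that by (auto simp: A_def)
      have bdd: "bdd_below ((\<lambda>q. q x) ` C)" for x
      proof (rule bdd_belowI2)
        fix q assume "q \<in> C"
        then show "- p (- x) \<le> q x" using sublinear_lower[of q x] sub(1)[of q] sub(2)[of q "- x"] by linarith
      qed
      have upper: "u x \<le> q x" if "q \<in> C" for q x
        unfolding u_def using that by (intro cINF_lower bdd)
      have great: "c \<le> u x" if "\<And>q. q \<in> C \<Longrightarrow> c \<le> q x" for c x
        unfolding u_def using that False by (intro cINF_greatest) auto
      have "sublinear u"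
        unfolding sublinear_def
      proof (intro conjI allI impI)
        fix x y
        have split: "u (x + y) \<le> q x + r y" if qr: "q \<in> C" "r \<in> C" for q r
        proof -
          obtain w where w: "w \<in> C" "w x \<le> q x" "w y \<le> r y"
            using comp[OF qr] qr unfolding P_def by blast
          have "u (x + y) \<le> w x + w y"
            using upper[OF w(1), of "x + y"] sublinear_add[OF sub(1)[OF w(1)], of x y] by linarith
          then show ?thesis using w by linarith
        qed
        have "u (x + y) - q x \<le> u y" if "q \<in> C" for q
        proof (rule great)
          show "u (x + y) - q x \<le> r y" if "r \<in> C" for r
            using split[OF \<open>q \<in> C\<close> that] by simp
        qed
        then have "u (x + y) - u y \<le> q x" if "q \<in> C" for q
          using that by (simp add: diff_le_eq add.commute)
        then have "u (x + y) - u y \<le> u x" by (rule great)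
        then show "u (x + y) \<le> u x + u y" by simp
      next
        fix r :: real and x assume r: "0 < r"
        have "u (r *\<^sub>R x) / r \<le> u x"
        proof (rule great)
          fix q assume q: "q \<in> C"
          then show "u (r *\<^sub>R x) / r \<le> q x"
            using upper[OF q, of "r *\<^sub>R x"] sublinear_scale[OF sub(1)[OF q] r] r
            by (simp add: divide_le_eq mult.commute)
        qed
        then show "u (r *\<^sub>R x) \<le> r * u x" using r by (simp add: divide_le_eq mult.commute)
      qed
      moreover have "u x \<le> p x" for x
        using False upper sub(2) by (meson ex_in_conv order_trans)
      ultimately have "u \<in> A" by (simp add: A_def)
      then show ?thesis using upper by (auto simp: P_def)
    qed
  qed
  then obtain m where m: "m \<in> A" "\<And>q. q \<in> A \<Longrightarrow> P m q \<Longrightarrow> q = m" by blast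
  show thesis
  proof
    show "sublinear m" "m x \<le> p x" for x using m(1) by (auto simp: A_def)
    fix q assume "sublinear q" "\<And>x. q x \<le> m x"
    then show "q = m" using m(1) by (intro m(2)) (auto simp: A_def P_def intro: order_trans)
  qed
qed

lemma hahn_banach_sublinear:
  fixes p :: "'b::real_vector \<Rightarrow> real"
  assumes p: "sublinear p"
  obtains f where "linear f" "\<And>x. f x \<le> p x" "f y = p y"
proof -
  define p' where "p' = (\<lambda>x. INF t\<in>{0::real..}. p (x + t *\<^sub>R y) - t * p y)"
  have p': "sublinear p'" "p' x \<le> p x" "p' x \<le> p (x + y) - p y" for x
    unfolding p'_def by (rule sublinear_shift[OF p])+
  obtain m where m: "sublinear m" "\<And>x. m x \<le> p' x"
    "\<And>q. sublinear q \<Longrightarrow> (\<And>x. q x \<le> m x) \<Longrightarrow> q = m"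
    by (rule minimal_sublinear[OF p'(1)]) blast
  have "m x + m z \<le> m (x + z)" for x z
  proof -
    define q where "q = (\<lambda>x. INF t\<in>{0::real..}. m (x + t *\<^sub>R z) - t * m z)"
    have q: "sublinear q" "q x \<le> m x" "q x \<le> m (x + z) - m z" for x
      unfolding q_def by (rule sublinear_shift[OF m(1)])+
    have "q = m" using q by (intro m(3)) auto
    then show ?thesis using q(3)[of x] by simp
  qed
  then have add: "m (x + z) = m x + m z" for x z
    using m(1) by (auto simp: sublinear_def intro: antisym)
  have neg: "m (- x) = - m x" for x
    using add[of x "- x"] sublinear_0[OF m(1)] by simp
  have "m (r *\<^sub>R x) = r * m x" for r x
    using sublinear_scale[OF m(1), of r x] sublinear_scale[OF m(1), of "- r" x]
      sublinear_0[OF m(1)] neg[of "r *\<^sub>R x"]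
    by (cases "r > 0"; cases "r = 0") auto
  then have lin: "linear m" using add by (simp add: linear_iff)
  have le: "m x \<le> p x" for x using m(2) p'(2) order_trans by blast
  have "m (- y) \<le> - p y"
    using m(2)[of "- y"] p'(3)[of "- y"] sublinear_0[OF p] by simp
  then have "m y = p y" using neg[of y] le[of y] by simp
  then show thesis using that lin le by blast
qed

section \<open>Functionals of norm at most one\<close>

text \<open>
  Functionals arise below as pointwise limits, averages and coefficients, so plain functions are
  more convenient than the type of bounded operators.
\<close>

definition contractive_functional :: "('a::complex_banach \<Rightarrow> complex) \<Rightarrow> bool" where
  "contractive_functional F \<longleftrightarrow> (\<forall>x y. F (x + y) = F x + F y) \<and> (\<forall>c x. F (c *\<^sub>C x) = c * F x) \<and>
     (\<forall>x. cmod (F x) \<le> norm x)"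

context
  fixes F :: "'a::complex_banach \<Rightarrow> complex"
  assumes F: "contractive_functional F"
begin

lemma cf_add: "F (x + y) = F x + F y" and cf_scaleC: "F (c *\<^sub>C x) = c * F x"
  and cf_norm: "cmod (F x) \<le> norm x"
  using F by (auto simp: contractive_functional_def)

lemma cf_scaleR: "F (r *\<^sub>R x) = of_real r * F x"
  by (simp add: scaleR_scaleC cf_scaleC)

lemma cf_zero: "F 0 = 0"
  using cf_norm[of 0] by simp

lemma cf_diff: "F (x - y) = F x - F y"
  using cf_add[of x "- y"] cf_scaleR[of "-1" y] by simp

lemma cf_sum: "F (sum f A) = (\<Sum>i\<in>A. F (f i))"
  by (induction A rule: infinite_finite_induct) (auto simp: cf_add cf_zero)

lemma cf_blinfun:
  obtains \<phi> where "\<phi> \<in> dual_space" "norm \<phi> \<le> 1" "\<And>x. blinfun_apply \<phi> x = F x"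
proof -
  have bl: "bounded_linear F"
    by (rule bounded_linear_intro[where K = 1])
      (auto simp: cf_add cf_scaleR cf_norm scaleR_conv_of_real)
  have app: "blinfun_apply (Blinfun F) x = F x" for x
    by (simp add: bounded_linear_Blinfun_apply[OF bl])
  show thesis
  proof
    show "Blinfun F \<in> dual_space" by (simp add: dual_space_def app cf_scaleC)
    show "norm (Blinfun F) \<le> 1" by (rule norm_blinfun_bound) (auto simp: app cf_norm)
  qed (rule app)
qed

end

lemma norm_functional_exists:
  fixes q :: "'a::complex_banach"
  obtains F where "contractive_functional F" "F q = of_real (norm q)"
proof -
  have "sublinear (norm :: 'a \<Rightarrow> real)" by (auto simp: sublinear_def norm_triangle_ineq)
  then obtain f where f: "linear f" "\<And>x::'a. f x \<le> norm x" "f q = norm q"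
    using hahn_banach_sublinear[of norm q] by blast
  define F where "F = (\<lambda>x. Complex (f x) (- f (\<i> *\<^sub>C x)))"
  have add: "F (x + y) = F x + F y" for x y
    by (simp add: F_def linear_add[OF f(1)] scaleC_add_right complex_eq_iff)
  have scale: "F (c *\<^sub>C x) = c * F x" for c x
  proof -
    have c: "c *\<^sub>C x = Re c *\<^sub>R x + Im c *\<^sub>R (\<i> *\<^sub>C x)"
    proof -
      have "c = of_real (Re c) + of_real (Im c) * \<i>" by (simp add: complex_eq_iff)
      then have "c *\<^sub>C x = (of_real (Re c) + of_real (Im c) * \<i>) *\<^sub>C x" by simp
      then show ?thesis by (simp add: scaleC_add_left scaleC_scaleC[symmetric] scaleR_scaleC[symmetric])
    qed
    have ii: "\<i> *\<^sub>C \<i> *\<^sub>C x = - x" by (simp add: scaleC_scaleC scaleC_minus_left scaleC_one)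
    have ic: "\<i> *\<^sub>C c *\<^sub>C x = Re c *\<^sub>R (\<i> *\<^sub>C x) - Im c *\<^sub>R x"
    proof -
      have "\<i> *\<^sub>C c *\<^sub>C x = c *\<^sub>C \<i> *\<^sub>C x" by (simp add: scaleC_scaleC mult.commute)
      also have "\<dots> = Re c *\<^sub>R \<i> *\<^sub>C x + Im c *\<^sub>R (\<i> *\<^sub>C \<i> *\<^sub>C x)"
      proof -
        have "c = of_real (Re c) + of_real (Im c) * \<i>" by (simp add: complex_eq_iff)
        then have "c *\<^sub>C \<i> *\<^sub>C x = (of_real (Re c) + of_real (Im c) * \<i>) *\<^sub>C \<i> *\<^sub>C x" by simp
        then show ?thesis by (simp only: scaleC_add_left scaleC_scaleC[symmetric] scaleR_scaleC[symmetric])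
      qed
      finally show ?thesis by (simp add: ii)
    qed
    show ?thesis
      unfolding F_def ic unfolding c
      by (simp add: complex_eq_iff linear_add[OF f(1)] linear_diff[OF f(1)] linear_cmul[OF f(1)])
  qed
  have norm: "cmod (F x) \<le> norm x" for x
  proof (cases "F x = 0")
    case False
    define c where "c = cnj (F x) / of_real (cmod (F x))"
    have c: "cmod c = 1" using False by (simp add: c_def norm_divide)
    have "F (c *\<^sub>C x) = of_real (cmod (F x))"
      using False by (simp add: scale c_def complex_norm_square[symmetric] power2_eq_square mult.commute)
    then have "cmod (F x) = f (c *\<^sub>C x)" by (simp add: F_def complex_eq_iff)
    also have "\<dots> \<le> norm x" using f(2)[of "c *\<^sub>C x"] c by (simp add: norm_scaleC)
    finally show ?thesis .
  qed simp
  have cf: "contractive_functional F" using add scale norm by (simp add: contractive_functional_def)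
  moreover have "F q = of_real (norm q)"
  proof -
    have "Re (F q) = norm q" by (simp add: F_def f(3))
    moreover have "cmod (F q) \<le> norm q" by (rule norm)
    ultimately have "Im (F q) = 0"
      using cmod_power2[of "F q"] power_mono[of "cmod (F q)" "norm q" 2] by simp
    then show ?thesis using \<open>Re (F q) = norm q\<close> by (simp add: complex_eq_iff)
  qed
  ultimately show thesis using that by blast
qed

text \<open>
  A first-order gain \<open>F (q + t y) = 1 + t F y\<close> is impossible when the norm grows only to second order
  in \<open>t\<close>.
\<close>

lemma quadratic_perturbation_zero:
  fixes F :: "'a::complex_banach \<Rightarrow> complex"
  assumes F: "contractive_functional F" and q: "F q = 1"
    and perturb: "\<And>t. (norm (q + t *\<^sub>C y))\<^sup>2 \<le> 1 + (cmod t)\<^sup>2 * K"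
  shows "F y = 0"
proof (rule ccontr)
  assume nz: "F y \<noteq> 0"
  define b where "b = (cmod (F y))\<^sup>2"
  have b: "b > 0" using nz by (simp add: b_def)
  have K: "0 \<le> \<bar>K\<bar>" by simp
  define s where "s = 1 / (\<bar>K\<bar> + 1)"
  have s: "s > 0" "s * \<bar>K\<bar> \<le> 1" by (auto simp: s_def divide_le_eq_1 add_nonneg_pos)
  \<comment> \<open>This phase makes \<open>t F y\<close> positive, and \<open>s\<close> is small enough for the linear term to win.\<close>
  define t where "t = of_real s * cnj (F y)"
  have ty: "t * F y = of_real (s * b)"
    using complex_norm_square[of "F y"] by (simp add: t_def b_def mult_ac)
  have tn: "(cmod t)\<^sup>2 = s\<^sup>2 * b" by (simp add: t_def b_def norm_mult power_mult_distrib)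
  have Fq: "F (q + t *\<^sub>C y) = of_real (1 + s * b)"
    using ty by (simp add: cf_add[OF F] cf_scaleC[OF F] q)
  have "1 + s * b = cmod (F (q + t *\<^sub>C y))" unfolding Fq norm_of_real using s b by simp
  also have "\<dots> \<le> norm (q + t *\<^sub>C y)" by (rule cf_norm[OF F])
  finally have "(1 + s * b)\<^sup>2 \<le> (norm (q + t *\<^sub>C y))\<^sup>2"
    using s b by (intro power_mono) auto
  also have "\<dots> \<le> 1 + s\<^sup>2 * b * K" using perturb[of t] by (simp add: tn)
  also have "\<dots> \<le> 1 + s\<^sup>2 * b * \<bar>K\<bar>" using s b by (intro add_left_mono mult_left_mono) auto
  also have "\<dots> = 1 + s * b * (s * \<bar>K\<bar>)" by (simp add: power2_eq_square mult_ac)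
  also have "\<dots> \<le> 1 + s * b * 1" using s b by (intro add_left_mono mult_left_mono) auto
  finally have "s * b + (s * b)\<^sup>2 \<le> 0" by (simp add: power2_eq_square algebra_simps)
  moreover have "s * b > 0" using s b by simp
  ultimately show False by (smt (verit) zero_le_power2)
qed

text \<open>
  If \<open>q y = 0\<close>, the cross terms in \<open>(q + t y)\<^sup>* (q + t y)\<close> vanish, and the C*-identity gives the
  second-order bound. For states this would be the Cauchy-Schwarz inequality.
\<close>

lemma functional_kills_right_annihilator:
  fixes F :: "'a::cstar_algebra \<Rightarrow> complex"
  assumes F: "contractive_functional F" and q: "F q = 1" "selfadj q" "norm q \<le> 1" and y: "q * y = 0"
  shows "F y = 0"
proof (rule quadratic_perturbation_zero[OF F q(1)])
  fix t
  have yq: "cstar y * q = 0" using y q(2) unfolding selfadj_def by (metis cstar_mult cstar_zero)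
  have "cstar (q + t *\<^sub>C y) * (q + t *\<^sub>C y) = q * q + (cnj t * t) *\<^sub>C (cstar y * y)"
    using y yq q(2) by (simp add: cstar_add cstar_scaleC selfadj_def distrib_left distrib_right
        mult_scaleC_left mult_scaleC_right scaleC_scaleC mult.commute)
  then have "(norm (q + t *\<^sub>C y))\<^sup>2 = norm (q * q + (cnj t * t) *\<^sub>C (cstar y * y))"
    by (simp add: cstar_norm[symmetric])
  also have "\<dots> \<le> norm (q * q) + norm ((cnj t * t) *\<^sub>C (cstar y * y))" by (rule norm_triangle_ineq)
  also have "\<dots> \<le> 1 + (cmod t)\<^sup>2 * (norm y)\<^sup>2"
    using selfadj_norm_square[OF q(2)] q(3)
    by (simp add: norm_scaleC cstar_norm norm_mult power2_eq_square mult_le_one)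
  finally show "(norm (q + t *\<^sub>C y))\<^sup>2 \<le> 1 + (cmod t)\<^sup>2 * (norm y)\<^sup>2" .
qed

lemma functional_kills_left_annihilator:
  fixes F :: "'a::cstar_algebra \<Rightarrow> complex"
  assumes F: "contractive_functional F" and q: "F q = 1" "selfadj q" "norm q \<le> 1" and y: "y * q = 0"
  shows "F y = 0"
proof (rule quadratic_perturbation_zero[OF F q(1)])
  fix t
  have yq: "q * cstar y = 0" using y q(2) unfolding selfadj_def by (metis cstar_mult cstar_zero)
  have "(q + t *\<^sub>C y) * cstar (q + t *\<^sub>C y) = q * q + (t * cnj t) *\<^sub>C (y * cstar y)"
    using y yq q(2) by (simp add: cstar_add cstar_scaleC selfadj_def distrib_left distrib_right
        mult_scaleC_left mult_scaleC_right scaleC_scaleC mult.commute)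
  then have "(norm (q + t *\<^sub>C y))\<^sup>2 = norm (q * q + (t * cnj t) *\<^sub>C (y * cstar y))"
    by (simp add: cstar_norm'[symmetric])
  also have "\<dots> \<le> norm (q * q) + norm ((t * cnj t) *\<^sub>C (y * cstar y))" by (rule norm_triangle_ineq)
  also have "\<dots> \<le> 1 + (cmod t)\<^sup>2 * (norm y)\<^sup>2"
    using selfadj_norm_square[OF q(2)] q(3)
    by (simp add: norm_scaleC cstar_norm' norm_mult power2_eq_square mult_le_one)
  finally show "(norm (q + t *\<^sub>C y))\<^sup>2 \<le> 1 + (cmod t)\<^sup>2 * (norm y)\<^sup>2" .
qed

text \<open>
  A functional of norm one that attains its norm at \<open>e k\<close> is concentrated where \<open>e k\<close> is \<open>1\<close>:
  it does not see the difference between \<open>x\<close> and \<open>e j x\<close>, because \<open>e k\<close> annihilates \<open>x - e j x\<close>.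
\<close>

lemma chain_functional_exists:
  fixes e :: "nat \<Rightarrow> 'a::cstar_algebra"
  assumes J: "closed_star_ideal J" and e: "bump_chain J e"
  obtains F where "contractive_functional F" "\<And>j. j \<le> k \<Longrightarrow> F (e j) = 1"
    "\<And>j x. j < k \<Longrightarrow> F (e j * x) = F x" "\<And>j x. j < k \<Longrightarrow> F (x * e j) = F x"
proof -
  obtain F where F: "contractive_functional F" "F (e k) = of_real (norm (e k))"
    by (rule norm_functional_exists)
  then have Fk: "F (e k) = 1" using chain_norm[OF e J] by simp
  note q = Fk chain_selfadj[OF e] chain_norm_le[OF e]
  show thesis
  proof
    show "contractive_functional F" by (rule F)
    fix j assume "j \<le> k"
    show "F (e j) = 1"
    proof (cases "j = k")
      case False
      then have jk: "j < k" using \<open>j \<le> k\<close> by simp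
      define z where "z = F (e j - e k)"
      have bound: "cmod (1 + of_real r * z) \<le> 1" if "\<bar>r\<bar> \<le> 1" for r
        using cf_norm[OF F(1), of "e k + r *\<^sub>R (e j - e k)"] chain_norm_comb[OF e jk that]
        by (simp add: cf_add[OF F(1)] cf_scaleR[OF F(1)] Fk z_def)
      have "(1 + Re z)\<^sup>2 + (Im z)\<^sup>2 \<le> 1" "(1 - Re z)\<^sup>2 + (Im z)\<^sup>2 \<le> 1"
        using power_mono[OF bound[of 1] norm_ge_zero, of 2] power_mono[OF bound[of "-1"] norm_ge_zero, of 2]
        by (simp_all add: cmod_power2)
      then have "(Re z)\<^sup>2 + (Im z)\<^sup>2 \<le> 0" by (simp add: power2_eq_square algebra_simps)
      then have "z = 0" by (simp add: complex_eq_iff sum_power2_le_zero_iff)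
      then show ?thesis by (simp add: z_def cf_diff[OF F(1)] Fk)
    qed (simp add: Fk)
  next
    fix j x assume jk: "j < k"
    have "e k * (x - e j * x) = 0"
      using chain_mult_right[OF e jk] by (simp add: right_diff_distrib mult.assoc[symmetric])
    from functional_kills_right_annihilator[OF F(1) q this]
    show "F (e j * x) = F x" by (simp add: cf_diff[OF F(1)])
    have "(x - x * e j) * e k = 0"
      using chain_mult[OF e jk] by (simp add: left_diff_distrib mult.assoc)
    from functional_kills_left_annihilator[OF F(1) q this]
    show "F (x * e j) = F x" by (simp add: cf_diff[OF F(1)])
  qed
qed

text \<open>
  The property for sequences and separation \<open>1\<close>. Every contradiction below comes from here: a sequence of
  functionals of norm one, pairwise at distance at least \<open>1\<close>, cannot converge weak* to a norm-attaining
  functional of norm greater than \<open>1/2\<close>.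
\<close>

lemma ddagger_sequence:
  fixes G :: "nat \<Rightarrow> 'a::complex_banach \<Rightarrow> complex"
  assumes ddagger: "property_ddagger TYPE('a)"
    and G: "\<And>n. contractive_functional (G n)"
    and attain: "\<And>n. \<exists>u. norm u \<le> 1 \<and> cmod (G n u) = 1"
    and separated: "\<And>n m. n < m \<Longrightarrow> \<exists>v. norm v \<le> 1 \<and> 1 \<le> cmod (G n v - G m v)"
    and lim: "\<And>x. (\<lambda>n. G n x) \<longlonglongrightarrow> H x"
    and H: "\<And>x. cmod (H x) \<le> c * norm x" "norm w \<le> 1" "cmod (H w) = c"
  shows "c \<le> 1/2"
proof -
  have "\<exists>\<phi>. \<phi> \<in> dual_space \<and> norm \<phi> \<le> 1 \<and> (\<forall>x. blinfun_apply \<phi> x = G n x)" for n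
    using cf_blinfun[OF G[of n]] by metis
  then obtain g where g: "\<And>n. g n \<in> dual_space" "\<And>n. norm (g n) \<le> 1"
    "\<And>n x. blinfun_apply (g n) x = G n x" by metis
  have cfH: "contractive_functional H"
    unfolding contractive_functional_def
  proof (intro conjI allI)
    fix x y
    have "(\<lambda>n. G n (x + y)) \<longlonglongrightarrow> H x + H y"
      by (simp add: cf_add[OF G]) (intro tendsto_add lim)
    then show "H (x + y) = H x + H y" using lim LIMSEQ_unique by blast
    fix z
    have "(\<lambda>n. G n (z *\<^sub>C x)) \<longlonglongrightarrow> z * H x"
      by (simp add: cf_scaleC[OF G]) (intro tendsto_intros lim)
    then show "H (z *\<^sub>C x) = z * H x" using lim LIMSEQ_unique by blast
    show "cmod (H x) \<le> norm x"
      by (rule LIMSEQ_le_const2[OF tendsto_norm[OF lim]]) (auto simp: cf_norm[OF G])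
  qed
  obtain h where h: "h \<in> dual_space" "norm h \<le> 1" "\<And>x. blinfun_apply h x = H x"
    using cf_blinfun[OF cfH] by metis
  have c0: "0 \<le> c" using H(3) norm_ge_zero by metis
  have "norm h \<le> c" by (rule norm_blinfun_bound) (auto simp: h H c0)
  moreover have "c \<le> norm h * norm w" using norm_blinfun[of h w] by (simp add: h H)
  moreover have "norm h * norm w \<le> norm h" using H(2) by (simp add: mult_left_le)
  ultimately have hc: "norm h = c" by simp
  have dir: "directed_set (UNIV :: nat set) (\<le>)"
    unfolding directed_set_def by (auto intro!: reflp_onI transp_onI intro: max.cobounded1 max.cobounded2)
  have nf: "net_filter (UNIV :: nat set) (\<le>) = sequentially"
    by (rule filter_eqI) (simp add: eventually_net_filter[OF dir] eventually_sequentially)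
  have sep: "norm (g n - g m) \<ge> 1" if "n \<noteq> m" for n m
  proof -
    have *: "norm (g n - g m) \<ge> 1" if "n < m" for n m
    proof -
      obtain v where v: "norm v \<le> 1" "1 \<le> cmod (G n v - G m v)" using separated[OF \<open>n < m\<close>] by blast
      have "cmod (G n v - G m v) \<le> norm (g n - g m) * norm v"
        using norm_blinfun[of "g n - g m" v] by (simp add: g blinfun.diff_left)
      also have "\<dots> \<le> norm (g n - g m)" using v(1) by (simp add: mult_left_le)
      finally show ?thesis using v by simp
    qed
    show ?thesis using that *[of n m] *[of m n] by (cases "n < m") (auto simp: norm_minus_commute)
  qed
  have att: "norm_attaining (g n)" for n
  proof -
    obtain u where u: "norm u \<le> 1" "cmod (G n u) = 1" using attain by blast
    have "1 \<le> norm (g n) * norm u" using norm_blinfun[of "g n" u] u by (simp add: g)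
    also have "\<dots> \<le> norm (g n)" using u by (simp add: mult_left_le)
    finally have "norm (g n) = 1" using g(2)[of n] by simp
    then show ?thesis using u unfolding norm_attaining_def by (intro bexI[of _ u]) (auto simp: g)
  qed
  have "norm_attaining h"
    unfolding norm_attaining_def by (rule bexI[of _ w]) (auto simp: h H hc)
  moreover have "limitin weak_star_topology g h (net_filter UNIV (\<le>))"
    unfolding limitin_weak_star_iff nf using h g lim by simp
  moreover have "\<not> has_greatest (UNIV :: nat set) (\<le>)"
    unfolding has_greatest_def by (auto simp: not_le)
  moreover have "ddagger_nets TYPE(nat) TYPE('a)"
    by (rule property_ddagger_imp_ddagger_nets[OF ddagger])
  ultimately have "norm h \<le> 1 - 1 / 2"
    using h(1,2) g(1,2) sep att dir
    unfolding ddagger_nets_def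
    by (elim allE[of _ "1::real"] impE allE[of _ "UNIV :: nat set"] allE[of _ "(\<le>) :: nat \<Rightarrow> nat \<Rightarrow> bool"] allE[of _ g] allE[of _ h]) auto
  then show ?thesis by (simp add: hc)
qed

section \<open>Chains that do not split\<close>

definition splits :: "'a::cstar_algebra set \<Rightarrow> (nat \<Rightarrow> 'a) \<Rightarrow> bool" where
  "splits J e \<longleftrightarrow> (\<exists>c d. bump_chain J c \<and> bump_chain J d \<and> e 1 * c 0 = c 0 \<and> e 1 * d 0 = d 0 \<and> c 0 * d 0 = 0)"

text \<open>
  Two distinct nonzero points in the spectrum of \<open>x\<close> modulo \<open>J\<close> would have disjoint bumps, and these would
  split the chain. So there is at most one such point \<open>r\<close>, and \<open>t\<^sup>2 - r t\<close> vanishes on the spectrum.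
\<close>

lemma not_splits_quadratic:
  assumes J: "closed_star_ideal J" and ns: "\<not> splits J e"
    and x: "selfadj x" "e 1 * x = x"
  obtains r :: real where "x * x - r *\<^sub>R x \<in> J"
proof (cases "x = 0")
  case True
  then show ?thesis using that[of 0] ideal_zero[OF J] by simp
next
  case False
  define a where "a = (1 / norm x) *\<^sub>R x"
  have a: "selfadj a" "norm a \<le> 1" "e 1 * a = a"
    using x False by (auto simp: a_def selfadj_def cstar_scaleR)
  have xa: "x = norm x *\<^sub>R a" using False by (simp add: a_def)
  have single: "t0 = t1" if t: "t0 \<in> ess_spectrum J a" "t1 \<in> ess_spectrum J a" "t0 \<noteq> 0" "t1 \<noteq> 0" for t0 t1
  proof (rule ccontr)
    assume ne: "t0 \<noteq> t1"
    define d where "d = min (min \<bar>t0\<bar> \<bar>t1\<bar> / 2) (\<bar>t0 - t1\<bar> / 4)"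
    have d: "d > 0" "2 * d \<le> \<bar>t0\<bar>" "2 * d \<le> \<bar>t1\<bar>" "4 * d \<le> \<bar>t0 - t1\<bar>"
      using t ne by (auto simp: d_def min_def)
    define c0 c1 where "c0 = (\<lambda>k. cfc a (bump t0 (d / 2 ^ k)))" and "c1 = (\<lambda>k::nat. cfc a (bump t1 (d / 2 ^ k)))"
    have chains: "bump_chain J c0" "bump_chain J c1"
      unfolding c0_def c1_def by (intro bump_chain_at a t d)+
    have u: "null_cont (bump t0 d)" "null_cont (bump t1 d)" using d by (intro bump_null_cont; simp)+
    have disj: "bump t0 d s * bump t1 d s = 0" for s
    proof (cases "2 * d \<le> \<bar>s - t0\<bar>")
      case False
      then have "2 * d \<le> \<bar>s - t1\<bar>" using d(4) by linarith
      then show ?thesis using bump_eq_0[OF d(1)] by simp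
    qed (simp add: bump_eq_0[OF d(1)])
    have "c0 0 * c1 0 = cfc a (\<lambda>s. bump t0 d s * bump t1 d s)"
      by (simp add: c0_def c1_def cfc_mult[OF a(1,2) u])
    then have "c0 0 * c1 0 = cfc a (\<lambda>_. 0)" by (simp only: disj)
    moreover have "norm (cfc a (\<lambda>_. 0)) \<le> 0" by (rule cfc_norm_le[OF a(1,2)]) auto
    ultimately have "c0 0 * c1 0 = 0" by simp
    moreover have "e 1 * c0 0 = c0 0" "e 1 * c1 0 = c1 0"
      using cfc_mult_unit[OF a(1,2) u(1) a(3)] cfc_mult_unit[OF a(1,2) u(2) a(3)]
      by (simp_all add: c0_def c1_def)
    ultimately show False using ns chains unfolding splits_def by blast
  qed
  then obtain r where r: "\<And>t. t \<in> ess_spectrum J a \<Longrightarrow> t = 0 \<or> t = r" by metis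
  have id: "null_cont (\<lambda>t. t)" by (simp add: continuous_on_id)
  have u: "null_cont (\<lambda>t. t * t)" "null_cont (\<lambda>t. (- r) * t)"
    by (auto intro: continuous_intros)
  have "cfc a (\<lambda>t. t * t + (- r) * t) \<in> J"
  proof (rule cfc_in_ideal[OF J a(1,2)])
    show "null_cont (\<lambda>t. t * t + (- r) * t)" by (auto intro!: continuous_intros)
    show "t * t + (- r) * t = 0" if "t \<in> ess_spectrum J a" for t
      using r[OF that] by auto
  qed
  then have "a * a - r *\<^sub>R a \<in> J"
    unfolding cfc_add[OF a(1,2) u] cfc_mult[OF a(1,2) id id] cfc_scale[OF a(1,2) id] cfc_ident[OF a(1,2)]
    by simp
  then have "(norm x * norm x) *\<^sub>R (a * a - r *\<^sub>R a) \<in> J" by (rule ideal_scaleR[OF J])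
  also have "(norm x * norm x) *\<^sub>R (a * a - r *\<^sub>R a) = x * x - (norm x * r) *\<^sub>R x"
    by (subst (3 4 6) xa) (simp add: scaleR_diff_right mult_ac)
  finally show ?thesis using that by blast
qed

text \<open>
  Modulo \<open>J\<close>, the operator \<open>1 + z\<close> is invertible by the Neumann series.
\<close>

lemma ideal_absorb:
  assumes J: "closed_star_ideal J" and z: "norm z \<le> 1/2" and v: "v + z * v \<in> J"
  shows "v \<in> J"
proof -
  define b where "b = (\<lambda>n. ((\<lambda>w. - (z * w)) ^^ n) v)"
  have bS: "b (Suc n) = - (z * b n)" and b0: "b 0 = v" for n by (simp_all add: b_def)
  have mem: "v - b n \<in> J" for n
  proof (induction n)
    case (Suc n)
    have "v - b (Suc n) = (v + z * v) - z * (v - b n)" by (simp add: bS algebra_simps)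
    then show ?case using ideal_diff[OF J v ideal_mult_left[OF J Suc]] by metis
  qed (simp add: b0 ideal_zero[OF J])
  have "norm (b n) \<le> (1/2) ^ n * norm v" for n
  proof (induction n)
    case (Suc n)
    have "norm (b (Suc n)) \<le> norm z * norm (b n)" by (simp add: bS norm_mult_ineq)
    also have "\<dots> \<le> (1/2) * ((1/2) ^ n * norm v)" using z Suc by (intro mult_mono) auto
    finally show ?case by simp
  qed (simp add: b0)
  moreover have "(\<lambda>n. (1/2) ^ n * norm v) \<longlonglongrightarrow> 0 * norm v"
    by (intro tendsto_intros LIMSEQ_realpow_zero) auto
  ultimately have "b \<longlonglongrightarrow> 0"
    by (intro Lim_null_comparison[of b "\<lambda>n. (1/2) ^ n * norm v"]) auto
  then have "(\<lambda>n. v - b n) \<longlonglongrightarrow> v - 0" by (intro tendsto_intros)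
  then show ?thesis using closed_sequentially[OF ideal_closed[OF J] mem] by simp
qed

text \<open>
  Modulo \<open>J\<close> a chain that does not split lives in a one-dimensional corner, so compressing \<open>y\<close> by it
  leaves a scalar. To see this for small selfadjoint \<open>y\<close>, put \<open>z = e 3 * y * e 3\<close> and apply the
  quadratic relation to \<open>e 2\<close>, which must be idempotent modulo \<open>J\<close>, and to \<open>e 2 + z\<close>. The relation factors as
  \<open>(1 + z) (z + 1 - r)\<close> on the range of \<open>e 3\<close>, and the first factor is invertible.
\<close>

lemma not_splits_character:
  fixes e :: "nat \<Rightarrow> 'a::cstar_algebra"
  assumes J: "closed_star_ideal J" and e: "bump_chain J e" and ns: "\<not> splits J e"
  obtains c where "e 4 * y * e 4 - c *\<^sub>C (e 4 * e 4) \<in> J"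
proof -
  note mult = chain_mult[OF e] and multr = chain_mult_right[OF e] and sa = chain_selfadj[OF e]
  obtain r0 where r0: "e 2 * e 2 - r0 *\<^sub>R e 2 \<in> J"
    using not_splits_quadratic[OF J ns, of "e 2"] sa mult[of 1 2] by auto
  have "(e 2 * e 2 - r0 *\<^sub>R e 2) * e 3 \<in> J" by (rule ideal_mult_right[OF J r0])
  then have "(1 - r0) *\<^sub>R e 3 \<in> J" by (simp add: left_diff_distrib mult.assoc mult scaleR_diff_left)
  then have "(1 / (1 - r0)) *\<^sub>R ((1 - r0) *\<^sub>R e 3) \<in> J" by (rule ideal_scaleR[OF J])
  then have "r0 = 1" using chain_notin[OF e, of 3] by (cases "r0 = 1") auto
  then have e2: "e 2 * e 2 - e 2 \<in> J" using r0 by simp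
  have small: "\<exists>r::real. e 4 * y * e 4 - r *\<^sub>R (e 4 * e 4) \<in> J" if y: "selfadj y" "norm y \<le> 1/2" for y
  proof -
    define z where "z = e 3 * y * e 3"
    have e3: "norm (e 3) \<le> 1" by (rule chain_norm_le[OF e])
    have "norm z \<le> norm (e 3) * norm y * norm (e 3)"
      unfolding z_def by (meson mult_right_mono norm_ge_zero norm_mult_ineq order_trans)
    also have "\<dots> \<le> 1 * (1/2) * 1" using e3 y by (intro mult_mono) auto
    finally have nz: "norm z \<le> 1/2" by simp
    have saz: "selfadj z" using sa[of 3] y by (simp add: z_def selfadj_def cstar_mult mult.assoc)
    have ez: "e 2 * z = z" "z * e 2 = z" "e 1 * z = z"
      using mult[of 2 3] mult[of 1 3] multr[of 2 3] unfolding z_def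
      by (simp add: mult.assoc[symmetric], simp add: mult.assoc, simp add: mult.assoc[symmetric])
    obtain r where r: "(e 2 + z) * (e 2 + z) - r *\<^sub>R (e 2 + z) \<in> J"
      using not_splits_quadratic[OF J ns, of "e 2 + z"] sa[of 2] saz ez(3) mult[of 1 2]
      by (auto simp: selfadj_def cstar_add distrib_left)
    define v where "v = z * e 3 + (1 - r) *\<^sub>R e 3"
    have "((e 2 + z) * (e 2 + z) - r *\<^sub>R (e 2 + z) - (e 2 * e 2 - e 2)) * e 3 \<in> J"
      by (intro ideal_mult_right[OF J] ideal_diff[OF J] r e2)
    also have "((e 2 + z) * (e 2 + z) - r *\<^sub>R (e 2 + z) - (e 2 * e 2 - e 2)) * e 3 = v + z * v"
      using mult[of 2 3] ez
      by (simp add: v_def algebra_simps)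
    finally have "v \<in> J" by (rule ideal_absorb[OF J nz])
    then have "e 4 * v * e 4 \<in> J" by (intro ideal_mult_left[OF J] ideal_mult_right[OF J])
    also have "e 4 * v * e 4 = e 4 * y * e 4 - (r - 1) *\<^sub>R (e 4 * e 4)"
    proof -
      have "e 4 * (e 3 * w) = e 4 * w" for w using multr[of 3 4] by (simp add: mult.assoc[symmetric])
      then show ?thesis using mult[of 3 4]
        by (simp add: v_def z_def distrib_left distrib_right mult.assoc scaleR_diff_left algebra_simps)
    qed
    finally show ?thesis by blast
  qed
  have real: "\<exists>r::real. e 4 * y * e 4 - r *\<^sub>R (e 4 * e 4) \<in> J" if y: "selfadj y" for y
  proof -
    define k where "k = 2 * norm y + 1"
    have k: "k > 0" by (simp add: k_def add_nonneg_pos)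
    have "selfadj ((1/k) *\<^sub>R y)" using y by (simp add: selfadj_def cstar_scaleR)
    moreover have "norm ((1/k) *\<^sub>R y) \<le> 1/2" using k by (simp add: k_def divide_le_eq)
    ultimately obtain r where "e 4 * ((1/k) *\<^sub>R y) * e 4 - r *\<^sub>R (e 4 * e 4) \<in> J" using small by blast
    then have "k *\<^sub>R (e 4 * ((1/k) *\<^sub>R y) * e 4 - r *\<^sub>R (e 4 * e 4)) \<in> J" by (rule ideal_scaleR[OF J])
    then show ?thesis using k by (intro exI[of _ "k * r"]) (simp add: scaleR_diff_right)
  qed
  define y1 where "y1 = (1/2) *\<^sub>R (y + cstar y)"
  define y2 where "y2 = (- \<i> / 2) *\<^sub>C (y - cstar y)"
  have y12: "selfadj y1" "selfadj y2"
    by (auto simp: y1_def y2_def selfadj_def cstar_scaleR cstar_add cstar_diff cstar_cstar cstar_scaleC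
        scaleC_diff_right scaleC_minus_left add.commute)
  have yy: "y = y1 + \<i> *\<^sub>C y2"
  proof -
    have "\<i> *\<^sub>C y2 = (1/2) *\<^sub>R (y - cstar y)" by (simp add: y2_def scaleC_scaleC scaleR_scaleC)
    then show ?thesis by (simp add: y1_def scaleR_add_right[symmetric] scaleR_2[symmetric])
  qed
  obtain r1 r2 :: real where r1: "e 4 * y1 * e 4 - r1 *\<^sub>R (e 4 * e 4) \<in> J" and r2: "e 4 * y2 * e 4 - r2 *\<^sub>R (e 4 * e 4) \<in> J"
    using real y12 by meson
  have "(e 4 * y1 * e 4 - r1 *\<^sub>R (e 4 * e 4)) + \<i> *\<^sub>C (e 4 * y2 * e 4 - r2 *\<^sub>R (e 4 * e 4)) \<in> J"
    by (intro ideal_add[OF J] ideal_scaleC[OF J] r1 r2)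
  also have "(e 4 * y1 * e 4 - r1 *\<^sub>R (e 4 * e 4)) + \<i> *\<^sub>C (e 4 * y2 * e 4 - r2 *\<^sub>R (e 4 * e 4))
      = e 4 * y * e 4 - (of_real r1 + \<i> * of_real r2) *\<^sub>C (e 4 * e 4)"
    by (simp add: yy distrib_left distrib_right mult_scaleC_left mult_scaleC_right scaleC_diff_right
        scaleC_add_left scaleC_scaleC scaleR_scaleC)
  finally show thesis using that by blast
qed

section \<open>Averages over the binary tree\<close>

text \<open>
  The mean of \<open>f\<close> over all lists of length \<open>n\<close>. Nodes of the tree are lists whose head is the most recent
  branching, so descending one level is \<open>Cons\<close>.
\<close>

primrec avg :: "nat \<Rightarrow> (bool list \<Rightarrow> 'b::real_vector) \<Rightarrow> 'b" where
  "avg 0 f = f []"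
| "avg (Suc n) f = avg n (\<lambda>s. (1/2) *\<^sub>R (f (True # s) + f (False # s)))"

lemma avg_cong: "(\<And>s. length s = n \<Longrightarrow> f s = g s) \<Longrightarrow> avg n f = avg n g"
proof (induction n arbitrary: f g)
  case (Suc n)
  show ?case unfolding avg.simps by (rule Suc.IH) (simp add: Suc.prems)
qed simp

lemma avg_add: "avg n (\<lambda>s. f s + g s) = avg n f + avg n g"
  by (induction n arbitrary: f g) (auto simp: algebra_simps)

lemma avg_linear:
  assumes "linear L" shows "avg n (\<lambda>s. L (f s)) = L (avg n f)"
proof (induction n arbitrary: f)
  case (Suc n)
  have "avg (Suc n) (\<lambda>s. L (f s)) = avg n (\<lambda>s. L ((1/2) *\<^sub>R (f (True # s) + f (False # s))))"
    by (simp add: linear_add[OF assms] linear_cmul[OF assms])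
  then show ?case by (simp add: Suc)
qed simp

lemma avg_scaleR: "avg n (\<lambda>s. r *\<^sub>R f s) = r *\<^sub>R avg n f"
  by (rule avg_linear) (rule linear_scaleR)

lemma avg_const [simp]: "avg n (\<lambda>s. c) = c"
  by (induction n) (auto simp: scaleR_2[symmetric])

lemma avg_mult: "avg n (\<lambda>s. c * f s) = c * avg n (f :: _ \<Rightarrow> complex)"
  by (rule avg_linear) (simp add: linear_iff algebra_simps)

lemma avg_of_real: "avg n (\<lambda>s. complex_of_real (f s)) = of_real (avg n f)"
  by (rule avg_linear) (simp add: linear_iff scaleR_conv_of_real)

lemma avg_mono: "(\<And>s. length s = n \<Longrightarrow> f s \<le> g s) \<Longrightarrow> avg n f \<le> avg n (g :: _ \<Rightarrow> real)"
proof (induction n arbitrary: f g)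
  case (Suc n)
  show ?case unfolding avg.simps by (rule Suc.IH) (simp add: Suc.prems add_mono)
qed simp

lemma norm_avg_le: "norm (avg n f) \<le> avg n (\<lambda>s. norm (f s))" for f :: "bool list \<Rightarrow> 'b::real_normed_vector"
proof (induction n arbitrary: f)
  case (Suc n)
  have "norm (avg (Suc n) f) \<le> avg n (\<lambda>s. norm ((1/2) *\<^sub>R (f (True # s) + f (False # s))))"
    unfolding avg.simps by (rule Suc)
  also have "\<dots> \<le> avg n (\<lambda>s. (1/2) *\<^sub>R (norm (f (True # s)) + norm (f (False # s))))"
    by (intro avg_mono) (simp add: norm_triangle_ineq)
  finally show ?case by simp
qed simp

text \<open>
  The Rademacher functions; reversing the list makes \<open>rad n\<close> the sign of the branching at depth \<open>n\<close>.
\<close>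

definition rad :: "nat \<Rightarrow> bool list \<Rightarrow> real" where
  "rad n s = (if rev s ! n then 1 else -1)"

lemma rad_append: "n < length s \<Longrightarrow> rad n (u @ s) = rad n s"
  by (simp add: rad_def nth_append)

lemma rad_Cons: "n < length s \<Longrightarrow> rad n (b # s) = rad n s"
  using rad_append[of n s "[b]"] by simp

lemma rad_Cons_last: "rad (length s) (b # s) = (if b then 1 else -1)"
  by (simp add: rad_def nth_append)

lemma rad_square: "rad n s * rad n s = 1"
  by (simp add: rad_def)

lemma avg_rad_Suc:
  "n < N \<Longrightarrow> avg (Suc N) (\<lambda>s. rad n s *\<^sub>R f s) = avg N (\<lambda>s. rad n s *\<^sub>R ((1/2) *\<^sub>R (f (True # s) + f (False # s))))"
  unfolding avg.simps by (rule avg_cong) (simp add: rad_Cons algebra_simps)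

lemma avg_rad_last:
  "avg (Suc N) (\<lambda>s. rad N s *\<^sub>R f s) = avg N (\<lambda>s. (1/2) *\<^sub>R (f (True # s) - f (False # s)))"
  unfolding avg.simps by (rule avg_cong) (auto simp: rad_Cons_last algebra_simps)

lemma avg_rad_eq_0: "n < N \<Longrightarrow> avg N (rad n) = 0"
proof (induction N)
  case (Suc N)
  show ?case
  proof (cases "n = N")
    case True
    then show ?thesis using avg_rad_last[of N "\<lambda>_. 1::real"] by simp
  next
    case False
    then have "n < N" using Suc.prems by simp
    then show ?thesis using avg_rad_Suc[of n N "\<lambda>_. 1::real"] Suc.IH by simp
  qed
qed simp

lemma avg_rad_rad_eq_0: "n < m \<Longrightarrow> m < N \<Longrightarrow> avg N (\<lambda>s. rad n s * rad m s) = 0"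
proof (induction N)
  case (Suc N)
  show ?case
  proof (cases "m = N")
    case True
    have "avg (Suc N) (\<lambda>s. rad N s *\<^sub>R rad n s) = avg N (\<lambda>s. (1/2) *\<^sub>R (rad n (True # s) - rad n (False # s)))"
      by (rule avg_rad_last)
    also have "\<dots> = avg N (\<lambda>_. 0)"
      using Suc.prems True by (intro avg_cong) (simp add: rad_Cons)
    finally show ?thesis using True by (simp add: mult.commute)
  next
    case False
    then have m: "m < N" "n < N" using Suc.prems by auto
    have "avg (Suc N) (\<lambda>s. rad n s *\<^sub>R rad m s)
        = avg N (\<lambda>s. rad n s *\<^sub>R ((1/2) *\<^sub>R (rad m (True # s) + rad m (False # s))))"
      by (rule avg_rad_Suc[OF m(2)])
    also have "\<dots> = avg N (\<lambda>s. rad n s * rad m s)"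
      using m by (intro avg_cong) (simp add: rad_Cons)
    finally show ?thesis using Suc.IH m Suc.prems by simp
  qed
qed simp

lemma square_summable_tendsto_0:
  fixes a :: "nat \<Rightarrow> complex"
  assumes "\<And>N. (\<Sum>n<N. (cmod (a n))\<^sup>2) \<le> C"
  shows "a \<longlonglongrightarrow> 0"
proof -
  have "summable (\<lambda>n. (cmod (a n))\<^sup>2)"
    by (rule summableI_nonneg_bounded[where x = C]) (use assms in auto)
  then have "(\<lambda>n. (cmod (a n))\<^sup>2) \<longlonglongrightarrow> 0" by (rule summable_LIMSEQ_zero)
  then have "(\<lambda>n. sqrt ((cmod (a n))\<^sup>2)) \<longlonglongrightarrow> sqrt 0" by (rule tendsto_real_sqrt)
  then show ?thesis by (simp add: tendsto_norm_zero_iff)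
qed

text \<open>
  Splitting off the last branching decomposes \<open>f\<close> into its conditional mean \<open>g\<close> and its fluctuation \<open>h\<close>, and
  the parallelogram law is the induction step.
\<close>

lemma rademacher_bessel:
  fixes f :: "bool list \<Rightarrow> complex"
  shows "(\<Sum>n<N. (cmod (avg N (\<lambda>s. rad n s *\<^sub>R f s)))\<^sup>2) + (cmod (avg N f))\<^sup>2 \<le> avg N (\<lambda>s. (cmod (f s))\<^sup>2)"
proof (induction N arbitrary: f)
  case (Suc N)
  define g where "g = (\<lambda>s. (1/2) *\<^sub>R (f (True # s) + f (False # s)))"
  define h where "h = (\<lambda>s. (1/2) *\<^sub>R (f (True # s) - f (False # s)))"
  have "(\<Sum>n<Suc N. (cmod (avg (Suc N) (\<lambda>s. rad n s *\<^sub>R f s)))\<^sup>2) + (cmod (avg (Suc N) f))\<^sup>2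
      = (\<Sum>n<N. (cmod (avg N (\<lambda>s. rad n s *\<^sub>R g s)))\<^sup>2) + (cmod (avg N h))\<^sup>2 + (cmod (avg N g))\<^sup>2"
    unfolding sum.lessThan_Suc avg_rad_last h_def[symmetric]
  proof -
    have "avg (Suc N) (\<lambda>s. rad n s *\<^sub>R f s) = avg N (\<lambda>s. rad n s *\<^sub>R g s)" if "n < N" for n
      using avg_rad_Suc[OF that, of f] by (simp only: g_def)
    moreover have "avg (Suc N) f = avg N g" by (simp add: g_def)
    ultimately show "(\<Sum>n<N. (cmod (avg (Suc N) (\<lambda>s. rad n s *\<^sub>R f s)))\<^sup>2) + (cmod (avg N h))\<^sup>2
        + (cmod (avg (Suc N) f))\<^sup>2 = (\<Sum>n<N. (cmod (avg N (\<lambda>s. rad n s *\<^sub>R g s)))\<^sup>2) + (cmod (avg N h))\<^sup>2 + (cmod (avg N g))\<^sup>2"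
      by (simp del: avg.simps)
  qed
  also have "\<dots> \<le> avg N (\<lambda>s. (cmod (g s))\<^sup>2) + avg N (\<lambda>s. (cmod (h s))\<^sup>2)"
  proof -
    have "0 \<le> (\<Sum>n<N. (cmod (avg N (\<lambda>s. rad n s *\<^sub>R h s)))\<^sup>2)" by (intro sum_nonneg) simp
    then show ?thesis using Suc.IH[of g] Suc.IH[of h] by linarith
  qed
  also have "\<dots> = avg N (\<lambda>s. (1/2) *\<^sub>R ((cmod (f (True # s)))\<^sup>2 + (cmod (f (False # s)))\<^sup>2))"
    unfolding avg_add[symmetric]
  proof (rule avg_cong)
    fix s
    show "(cmod (g s))\<^sup>2 + (cmod (h s))\<^sup>2 = (1/2) *\<^sub>R ((cmod (f (True # s)))\<^sup>2 + (cmod (f (False # s)))\<^sup>2)"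
      by (simp only: g_def h_def cmod_power2 scaleR_complex.sel plus_complex.sel minus_complex.sel)
        (simp add: power2_eq_square field_simps)
  qed
  finally show ?case by simp
qed simp

text \<open>
  Weak* compactness of the dual ball, by Tychonoff. The result is phrased with a filter below the sequential one,
  so that limits of the sequence pass to the cluster point \<open>h\<close> by the usual rules.
\<close>

lemma pointwise_cluster:
  fixes f :: "nat \<Rightarrow> 'a::real_normed_vector \<Rightarrow> complex"
  assumes bound: "\<And>n x. cmod (f n x) \<le> norm x"
  obtains G h where "G \<noteq> bot" "G \<le> sequentially" "\<And>x. ((\<lambda>n. f n x) \<longlongrightarrow> h x) G"
proof -
  define K where "K = (\<Pi>\<^sub>E x\<in>(UNIV::'a set). cball (0::complex) (norm x))"
  have "compactin (product_topology (\<lambda>_::'a. euclidean :: complex topology) UNIV) K"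
    unfolding K_def compactin_PiE by (simp add: compact_cball)
  then have "compact K" by (simp add: euclidean_product_topology)
  moreover have "eventually (\<lambda>g. g \<in> K) (filtermap f sequentially)"
    by (simp add: eventually_filtermap K_def PiE_def bound)
  ultimately obtain h where h: "inf (nhds h) (filtermap f sequentially) \<noteq> bot"
    unfolding compact_filter by (metis filtermap_bot_iff trivial_limit_sequentially)
  define G where "G = inf sequentially (filtercomap f (nhds h))"
  have nontrivial: "G \<noteq> bot"
  proof
    assume "G = bot"
    then have "eventually (\<lambda>_. False) G" by simp
    then obtain P Q where PQ: "eventually P sequentially" "eventually Q (filtercomap f (nhds h))"
      "\<And>n. P n \<Longrightarrow> Q n \<Longrightarrow> False"
      unfolding G_def eventually_inf by blast
    from PQ(2) obtain R where R: "eventually R (nhds h)" "\<And>n. R (f n) \<Longrightarrow> Q n"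
      unfolding eventually_filtercomap by blast
    have "eventually (\<lambda>g. \<not> R g) (filtermap f sequentially)"
      unfolding eventually_filtermap using PQ(1) by eventually_elim (use PQ(3) R(2) in blast)
    then have "eventually (\<lambda>_. False) (inf (nhds h) (filtermap f sequentially))"
      unfolding eventually_inf using R(1) by blast
    then show False using h by (simp add: trivial_limit_def)
  qed
  have "(f \<longlongrightarrow> h) G"
    unfolding G_def filterlim_def filtermap_le_iff_le_filtercomap by simp
  then have "((\<lambda>n. f n x) \<longlongrightarrow> h x) G" for x
    using continuous_on_tendsto_compose[OF continuous_on_product_coordinates[where i = x], of f h G]
    by simp
  then show thesis using that[of G h] nontrivial by (simp add: G_def)
qed

text \<open>
  If every chain split, iterating would give a binary tree of bumps \<open>p s\<close>, orthogonal on each level and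
  each dominated by its parent. Let \<open>g s\<close> be a functional concentrated at the node \<open>s\<close>. A cluster
  point \<open>h\<close> of the level averages of the \<open>g s\<close> is like a diffuse measure on the branches, and
  \<open>y n\<close>, the signed sum of the bumps on level \<open>n + 1\<close>, is like the \<open>n\<close>-th Rademacher function
  on it. The densities \<open>1 + y n\<close> then give functionals of norm one that are pairwise at distance at least
  \<open>1\<close>, yet converge weak* to \<open>h\<close> by Bessel's inequality, and \<open>h\<close> attains its norm one at the root.
\<close>

lemma ex_not_splits:
  fixes e0 :: "nat \<Rightarrow> 'a::cstar_algebra"
  assumes ddagger: "property_ddagger TYPE('a)"
    and J: "closed_star_ideal J" and e0: "bump_chain J e0"
  obtains e where "bump_chain J e" "\<not> splits J e"
proof (rule ccontr)
  assume "\<not> thesis"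
  then have "\<forall>e. bump_chain J e \<longrightarrow> splits J e" using that by blast
  then obtain L R where LR: "\<And>e. bump_chain J e \<Longrightarrow> bump_chain J (L e) \<and> bump_chain J (R e) \<and>
      e 1 * L e 0 = L e 0 \<and> e 1 * R e 0 = R e 0 \<and> L e 0 * R e 0 = 0"
    unfolding splits_def by metis
  define T where "T = rec_list e0 (\<lambda>b _ e. if b then L e else R e)"
  have T_Nil: "T [] = e0" and T_Cons: "T (b # s) = (if b then L (T s) else R (T s))" for b s
    by (simp_all add: T_def)
  have chain: "bump_chain J (T s)" for s
    by (induction s) (auto simp: T_Nil T_Cons e0 LR)
  define p where "p = (\<lambda>s. T s 0)"
  have sa: "selfadj (p s)" for s using chain_selfadj[OF chain] by (simp add: p_def)
  have p_norm: "norm (p s) \<le> 1" for s using chain_norm_le[OF chain] by (simp add: p_def)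
  have swap: "p s * p t = r \<Longrightarrow> selfadj r \<Longrightarrow> p t * p s = r" for s t r
    using sa unfolding selfadj_def by (metis cstar_mult)
  have child: "p s * p (b # s) = p (b # s)" for s b
  proof -
    have "T s 1 * p (b # s) = p (b # s)" using LR[OF chain, of s] by (simp add: p_def T_Cons)
    then show ?thesis using chain_mult[OF chain, of 0 1 s] unfolding p_def by (metis mult.assoc zero_less_one)
  qed
  have below: "p s * p (u @ s) = p (u @ s)" if "u \<noteq> []" for u s
    using that
  proof (induction u)
    case (Cons b u)
    show ?case
    proof (cases "u = []")
      case False
      then have "p s * p (u @ s) = p (u @ s)" using Cons by simp
      then show ?thesis using child[of "u @ s" b] by (metis append_Cons mult.assoc)
    qed (simp add: child)
  qed simp
  have below': "p (u @ s) * p s = p (u @ s)" if "u \<noteq> []" for u s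
    using swap[OF below[OF that] sa] .
  have disjoint: "p s * p t = 0" if "length s = length t" "s \<noteq> t" for s t
    using that
  proof (induction s t rule: list_induct2)
    case (Cons b s c t)
    show ?case
    proof (cases "s = t")
      case True
      have "p (True # t) * p (False # t) = 0" using LR[OF chain, of t] by (simp add: p_def T_Cons)
      moreover from this have "p (False # t) * p (True # t) = 0" by (rule swap) (simp add: selfadj_def)
      ultimately show ?thesis using True Cons.prems by (cases b; cases c) auto
    next
      case False
      then have "p s * p t = 0" using Cons by simp
      then show ?thesis using child[of t c] below'[of "[b]" s]
        by (metis append_Cons append_Nil list.distinct(1) mult.assoc mult_zero_left mult_zero_right)
    qed
  qed simp
  have "\<exists>F. contractive_functional F \<and> F (p t) = 1 \<and> (\<forall>x. F (p t * x) = F x)" for t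
    using chain_functional_exists[OF J chain, of 1 t] unfolding p_def by (metis zero_le zero_less_one)
  then obtain g where g: "\<And>t. contractive_functional (g t)" "\<And>t. g t (p t) = 1" "\<And>t x. g t (p t * x) = g t x"
    by metis
  have g_root: "g t (p []) = 1" for t
  proof (cases "t = []")
    case False
    then show ?thesis using g(3)[of t "p []"] below'[of t "[]"] g(2)[of t] by simp
  qed (simp add: g(2))
  \<comment> \<open>A functional at a node below level \<open>length s\<close> sees exactly one bump of that level.\<close>
  have g_p: "g (u @ t) (p s * x) = (if s = t then g (u @ t) x else 0)" if "length s = length t" for u s t x
  proof (cases "u = []")
    case True
    then show ?thesis
      using g(3)[of t x] g(3)[of t "p s * x"] disjoint[of t s] that cf_zero[OF g(1)]
      by (auto simp: mult.assoc[symmetric])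
  next
    case False
    have eq: "g (u @ t) (p s * x) = g (u @ t) (p (u @ t) * p s * x)"
      using g(3)[of "u @ t" "p s * x"] by (simp add: mult.assoc)
    show ?thesis
    proof (cases "s = t")
      case True
      then show ?thesis using eq below'[OF False, of t] g(3)[of "u @ t" x] by simp
    next
      case sneq: False
      have "p (u @ t) * p s = p (u @ t) * (p t * p s)"
        using below'[OF False, of t] by (metis mult.assoc)
      also have "\<dots> = 0" using disjoint[of t s] that sneq by simp
      finally show ?thesis using eq sneq cf_zero[OF g(1)] by simp
    qed
  qed
  define y where "y = (\<lambda>n. \<Sum>s\<in>{s. length s = Suc n}. rad n s *\<^sub>R p s)"
  have fin: "finite {s::bool list. length s = k}" for k
    using finite_lists_length_eq[of "UNIV :: bool set" k] by simp
  have y_norm: "norm (y n) \<le> 1" for n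
    unfolding y_def
  proof (rule norm_sum_orthogonal_le_1[OF fin])
    fix s
    show "selfadj (rad n s *\<^sub>R p s)" using sa[of s] by (simp add: selfadj_def cstar_scaleR)
    show "norm (rad n s *\<^sub>R p s) \<le> 1" using p_norm[of s] by (simp add: rad_def)
    fix t assume "s \<in> {s. length s = Suc n}" "t \<in> {s. length s = Suc n}" "s \<noteq> t"
    then show "(rad n s *\<^sub>R p s) * (rad n t *\<^sub>R p t) = 0" using disjoint[of s t] by simp
  qed
  have g_y: "g t (y n * x) = rad n t *\<^sub>R g t x" if "n < length t" for n t x
  proof -
    define u v where "u = take (length t - Suc n) t" and "v = drop (length t - Suc n) t"
    have t: "t = u @ v" "length v = Suc n" using that by (auto simp: u_def v_def)
    have "g t (y n * x) = (\<Sum>s\<in>{s. length s = Suc n}. rad n s *\<^sub>R g t (p s * x))"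
      by (simp add: y_def sum_distrib_right cf_sum[OF g(1)] cf_scaleR[OF g(1)] scaleR_conv_of_real)
    also have "\<dots> = (\<Sum>s\<in>{s. length s = Suc n}. if s = v then rad n v *\<^sub>R g t x else 0)"
      using t(2) unfolding t(1) by (intro sum.cong) (auto simp: g_p)
    also have "\<dots> = rad n v *\<^sub>R g t x" using t(2) by (simp add: sum.delta fin)
    finally show ?thesis using t rad_append[of n v u] by simp
  qed
  have y_root: "y n * p [] = y n" for n
    unfolding y_def sum_distrib_right
  proof (rule sum.cong)
    fix s :: "bool list" assume "s \<in> {s. length s = Suc n}"
    then have "s \<noteq> []" by auto
    then show "rad n s *\<^sub>R p s * p [] = rad n s *\<^sub>R p s" using below'[of s "[]"] by simp
  qed simp
  define f where "f = (\<lambda>N x. avg N (\<lambda>t. g t x))"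
  have f_norm: "cmod (f N x) \<le> norm x" for N x
  proof -
    have "cmod (f N x) \<le> avg N (\<lambda>t. cmod (g t x))" unfolding f_def by (rule norm_avg_le)
    also have "\<dots> \<le> avg N (\<lambda>_. norm x)" by (intro avg_mono cf_norm g(1))
    finally show ?thesis by simp
  qed
  have f_y: "f N (y n * x) = avg N (\<lambda>t. rad n t *\<^sub>R g t x)" if "n < N" for n N x
    unfolding f_def using that by (intro avg_cong) (simp add: g_y)
  obtain G h where G: "G \<noteq> bot" "G \<le> sequentially" and lim: "\<And>x. ((\<lambda>n. f n x) \<longlongrightarrow> h x) G"
    using pointwise_cluster[of f] f_norm by blast
  have ev: "eventually (\<lambda>N. P N) G" if "\<And>N. n < N \<Longrightarrow> P N" for n P
    using G(2) eventually_gt_at_top[of n] that by (meson eventually_mono filter_leD)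
  have eqI: "h x = c" if "\<And>N. n < N \<Longrightarrow> f N x = c" for n x c
  proof -
    have "((\<lambda>N. f N x) \<longlongrightarrow> c) G"
      by (rule tendsto_eventually) (rule ev[of n], rule that)
    then show ?thesis using lim[of x] tendsto_unique[OF G(1)] by blast
  qed
  have cfh: "contractive_functional h"
    unfolding contractive_functional_def
  proof (intro conjI allI)
    fix x z :: 'a and c :: complex
    have "((\<lambda>n. f n (x + z)) \<longlongrightarrow> h x + h z) G"
      unfolding f_def cf_add[OF g(1)] avg_add using lim unfolding f_def by (intro tendsto_add)
    then show "h (x + z) = h x + h z" using lim tendsto_unique[OF G(1)] by blast
    have "((\<lambda>n. f n (c *\<^sub>C x)) \<longlongrightarrow> c * h x) G"
      unfolding f_def cf_scaleC[OF g(1)] avg_mult using lim unfolding f_def by (intro tendsto_mult tendsto_const)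
    then show "h (c *\<^sub>C x) = c * h x" using lim tendsto_unique[OF G(1)] by blast
    show "cmod (h x) \<le> norm x"
      by (rule tendsto_upperbound[OF tendsto_norm[OF lim] _ G(1)]) (simp add: f_norm)
  qed
  have h_root: "h (p []) = 1" by (rule eqI[of 0]) (simp add: f_def g_root)
  have h_y: "h (y n) = 0" for n
  proof (rule eqI[of n])
    fix N assume N: "n < N"
    have "f N (y n) = avg N (\<lambda>t. rad n t *\<^sub>R g t (p []))" using f_y[OF N, of "p []"] by (simp add: y_root)
    also have "\<dots> = avg N (\<lambda>t. (of_real (rad n t) :: complex))" by (simp add: g_root scaleR_conv_of_real)
    also have "\<dots> = of_real (avg N (rad n))"
      by (rule avg_of_real)
    finally show "f N (y n) = 0" by (simp add: avg_rad_eq_0[OF N])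
  qed
  have h_yy: "h (y n * y m) = (if n = m then 1 else 0)" for n m
  proof (rule eqI[of "max n m"])
    fix N assume N: "max n m < N"
    have "f N (y n * y m) = avg N (\<lambda>t. rad n t *\<^sub>R g t (y m))" using N by (simp add: f_y)
    also have "\<dots> = avg N (\<lambda>t. of_real (rad n t * rad m t))"
    proof (rule avg_cong)
      fix t :: "bool list" assume "length t = N"
      then have "g t (y m) = of_real (rad m t)"
        using g_y[of m t "p []"] N by (simp add: y_root g_root scaleR_conv_of_real)
      then show "rad n t *\<^sub>R g t (y m) = of_real (rad n t * rad m t)" by (simp add: scaleR_conv_of_real)
    qed
    also have "\<dots> = of_real (avg N (\<lambda>t. rad n t * rad m t))" by (rule avg_of_real)
    also have "avg N (\<lambda>t. rad n t * rad m t) = (if n = m then 1 else 0)"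
      using N avg_rad_rad_eq_0[of n m N] avg_rad_rad_eq_0[of m n N]
      by (cases n m rule: linorder_cases) (auto simp: rad_square mult.commute)
    finally show "f N (y n * y m) = (if n = m then 1 else 0)" by simp
  qed
  have bessel: "(\<Sum>n<K. (cmod (h (y n * x)))\<^sup>2) \<le> (norm x)\<^sup>2" for K x
  proof (rule tendsto_upperbound[OF _ _ G(1)])
    show "((\<lambda>N. \<Sum>n<K. (cmod (f N (y n * x)))\<^sup>2) \<longlongrightarrow> (\<Sum>n<K. (cmod (h (y n * x)))\<^sup>2)) G"
      by (intro tendsto_intros lim)
    show "\<forall>\<^sub>F N in G. (\<Sum>n<K. (cmod (f N (y n * x)))\<^sup>2) \<le> (norm x)\<^sup>2"
    proof (rule ev[of K])
      fix N assume N: "K < N"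
      have "(\<Sum>n<K. (cmod (f N (y n * x)))\<^sup>2) = (\<Sum>n<K. (cmod (avg N (\<lambda>t. rad n t *\<^sub>R g t x)))\<^sup>2)"
        using N by (intro sum.cong) (simp_all add: f_y)
      also have "\<dots> \<le> (\<Sum>n<N. (cmod (avg N (\<lambda>t. rad n t *\<^sub>R g t x)))\<^sup>2)"
        using N by (intro sum_mono2) auto
      also have "\<dots> \<le> avg N (\<lambda>t. (cmod (g t x))\<^sup>2)"
        using rademacher_bessel[of N "\<lambda>t. g t x"] by (smt (verit) zero_le_power2)
      also have "\<dots> \<le> avg N (\<lambda>_. (norm x)\<^sup>2)"
        by (intro avg_mono power_mono cf_norm g(1)) simp
      finally show "(\<Sum>n<K. (cmod (f N (y n * x)))\<^sup>2) \<le> (norm x)\<^sup>2" by simp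
    qed
  qed
  have h_y_lim: "(\<lambda>n. h (y n * x)) \<longlonglongrightarrow> 0" for x by (rule square_summable_tendsto_0[OF bessel])
  have "(1::real) \<le> 1/2"
  proof (rule ddagger_sequence[OF ddagger, where G = "\<lambda>n x. h (x + y n * x)" and H = h and w = "p []"])
    fix n
    show "contractive_functional (\<lambda>x. h (x + y n * x))"
      unfolding contractive_functional_def
    proof (intro conjI allI)
      fix x z :: 'a and c :: complex
      show "h (x + z + y n * (x + z)) = h (x + y n * x) + h (z + y n * z)"
        by (simp add: cf_add[OF cfh] distrib_left)
      show "h (c *\<^sub>C x + y n * (c *\<^sub>C x)) = c * h (x + y n * x)"
        by (simp add: cf_add[OF cfh] cf_scaleC[OF cfh] mult_scaleC_right distrib_left)
      show "cmod (h (x + y n * x)) \<le> norm x"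
      proof (rule tendsto_upperbound[OF tendsto_norm[OF lim] _ G(1)], rule ev[of n])
        fix N assume N: "n < N"
        have "f N (x + y n * x) = f N x + f N (y n * x)"
          unfolding f_def cf_add[OF g(1)] avg_add ..
        also have "\<dots> = avg N (\<lambda>t. (1 + rad n t) *\<^sub>R g t x)"
          by (simp add: f_y[OF N] scaleR_add_left avg_add) (simp add: f_def)
        also have "cmod \<dots> \<le> avg N (\<lambda>t. cmod ((1 + rad n t) *\<^sub>R g t x))" by (rule norm_avg_le)
        also have "\<dots> \<le> avg N (\<lambda>t. norm x *\<^sub>R (1 + rad n t))"
          by (intro avg_mono) (simp add: rad_def cf_norm[OF g(1)])
        also have "\<dots> = norm x" by (simp only: avg_scaleR avg_add avg_const avg_rad_eq_0[OF N]) simp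
        finally show "cmod (f N (x + y n * x)) \<le> norm x" .
      qed
    qed
    show "\<exists>u. norm u \<le> 1 \<and> cmod (h (u + y n * u)) = 1"
      by (rule exI[of _ "p []"]) (simp add: p_norm y_root cf_add[OF cfh] h_root h_y)
    fix m
    assume "n < m"
    then show "\<exists>v. norm v \<le> 1 \<and> 1 \<le> cmod (h (v + y n * v) - h (v + y m * v))"
      by (intro exI[of _ "y n"]) (simp add: y_norm cf_add[OF cfh] h_y h_yy)
  next
    fix x
    have "(\<lambda>n. h x + h (y n * x)) \<longlonglongrightarrow> h x + 0" by (intro tendsto_add tendsto_const h_y_lim)
    then show "(\<lambda>n. h (x + y n * x)) \<longlonglongrightarrow> h x" by (simp add: cf_add[OF cfh])
    show "cmod (h x) \<le> 1 * norm x" using cf_norm[OF cfh] by simp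
  qed (simp_all add: p_norm h_root)
  then show False by simp
qed

section \<open>Elements with compact multiplication operators\<close>

definition totally_bdd :: "'b::real_normed_vector set \<Rightarrow> bool" where
  "totally_bdd S \<longleftrightarrow> (\<forall>e>0. \<exists>F. finite F \<and> (\<forall>x\<in>S. \<exists>z\<in>F. norm (x - z) < e))"

lemma totally_bdd_subset: "totally_bdd S \<Longrightarrow> T \<subseteq> S \<Longrightarrow> totally_bdd T"
  unfolding totally_bdd_def by (meson subsetD)

lemma totally_bdd_lipschitz_image:
  assumes S: "totally_bdd S" and L: "\<And>x z. norm (h x - h z) \<le> L * norm (x - z)"
  shows "totally_bdd (h ` S)"
  unfolding totally_bdd_def
proof (intro allI impI)
  fix e :: real assume e: "0 < e"
  define k where "k = e / (\<bar>L\<bar> + 1)"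
  have k: "0 < k" using e by (simp add: k_def add_nonneg_pos)
  then obtain F where F: "finite F" "\<forall>x\<in>S. \<exists>z\<in>F. norm (x - z) < k"
    using S unfolding totally_bdd_def by blast
  have "norm (h x - h z) < e" if "norm (x - z) < k" for x z
  proof -
    have "norm (h x - h z) \<le> L * norm (x - z)" by (rule L)
    also have "\<dots> \<le> (\<bar>L\<bar> + 1) * norm (x - z)" by (intro mult_right_mono) auto
    also have "\<dots> < (\<bar>L\<bar> + 1) * k" using that by (intro mult_strict_left_mono) (auto simp: add_nonneg_pos)
    also have "\<dots> = e" by (simp add: k_def)
    finally show ?thesis .
  qed
  then show "\<exists>F. finite F \<and> (\<forall>x\<in>h ` S. \<exists>z\<in>F. norm (x - z) < e)"
    using F by (intro exI[of _ "h ` F"]) (simp, meson)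
qed

lemma totally_bdd_add:
  assumes f: "totally_bdd (f ` S)" and g: "totally_bdd (g ` S)"
  shows "totally_bdd ((\<lambda>y. f y + g y) ` S)"
  unfolding totally_bdd_def
proof (intro allI impI)
  fix e :: real assume e: "0 < e"
  obtain F where F: "finite F" "\<forall>x\<in>f ` S. \<exists>z\<in>F. norm (x - z) < e / 2"
    using f e unfolding totally_bdd_def by (meson half_gt_zero)
  obtain G where G: "finite G" "\<forall>x\<in>g ` S. \<exists>z\<in>G. norm (x - z) < e / 2"
    using g e unfolding totally_bdd_def by (meson half_gt_zero)
  show "\<exists>H. finite H \<and> (\<forall>x\<in>(\<lambda>y. f y + g y) ` S. \<exists>z\<in>H. norm (x - z) < e)"
  proof (intro exI conjI ballI)
    show "finite ((\<lambda>(u, v). u + v) ` (F \<times> G))" using F G by simp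
    fix x assume "x \<in> (\<lambda>y. f y + g y) ` S"
    then obtain y where y: "y \<in> S" "x = f y + g y" by blast
    obtain u v where uv: "u \<in> F" "norm (f y - u) < e / 2" "v \<in> G" "norm (g y - v) < e / 2"
      using F G y by blast
    have "norm (x - (u + v)) = norm ((f y - u) + (g y - v))" by (simp add: y algebra_simps)
    also have "\<dots> < e" using uv norm_triangle_ineq[of "f y - u" "g y - v"] by linarith
    finally show "\<exists>z\<in>(\<lambda>(u, v). u + v) ` (F \<times> G). norm (x - z) < e"
      using uv by force
  qed
qed

lemma totally_bdd_compact: assumes "compact S" shows "totally_bdd S"
  unfolding totally_bdd_def
proof (intro allI impI)
  fix e :: real assume e: "0 < e"
  obtain T where T: "T \<subseteq> S" "finite T" "S \<subseteq> (\<Union>z\<in>T. ball z e)"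
    by (rule compactE_image[OF assms, of S "\<lambda>z. ball z e"]) (use e in auto)
  then show "\<exists>F. finite F \<and> (\<forall>x\<in>S. \<exists>z\<in>F. norm (x - z) < e)"
    by (intro exI[of _ T]) (fastforce simp: dist_norm norm_minus_commute)
qed

definition right_compact :: "'a::real_normed_algebra \<Rightarrow> bool" where
  "right_compact a \<longleftrightarrow> totally_bdd ((\<lambda>y. y * a) ` cball 0 1)"

lemma right_compact_zero: "right_compact 0"
  unfolding right_compact_def totally_bdd_def by (auto intro!: exI[of _ "{0}"])

lemma right_compact_add: "right_compact a \<Longrightarrow> right_compact b \<Longrightarrow> right_compact (a + b)"
  unfolding right_compact_def distrib_left by (rule totally_bdd_add)

lemma right_compact_mult_right: assumes "right_compact a" shows "right_compact (a * x)"
proof -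
  have "totally_bdd ((\<lambda>w. w * x) ` (\<lambda>y. y * a) ` cball 0 1)"
  proof (rule totally_bdd_lipschitz_image[OF assms[unfolded right_compact_def], where L = "norm x"])
    show "norm (u * x - v * x) \<le> norm x * norm (u - v)" for u v
      using norm_mult_ineq[of "u - v" x] by (simp add: left_diff_distrib mult.commute)
  qed
  then show ?thesis by (simp add: right_compact_def image_image mult.assoc)
qed

lemma right_compact_mult_left: assumes "right_compact a" shows "right_compact (x * a)"
proof -
  define k where "k = norm x + 1"
  have k: "k > 0" "norm x \<le> k" by (auto simp: k_def add_nonneg_pos)
  have "totally_bdd ((\<lambda>w. k *\<^sub>R w) ` (\<lambda>y. y * a) ` cball 0 1)"
    using k by (intro totally_bdd_lipschitz_image[OF assms[unfolded right_compact_def], where L = k])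
      (simp add: scaleR_diff_right[symmetric])
  moreover have "(\<lambda>y. y * (x * a)) ` cball 0 1 \<subseteq> (\<lambda>w. k *\<^sub>R w) ` (\<lambda>y. y * a) ` cball 0 1"
  proof
    fix w assume "w \<in> (\<lambda>y. y * (x * a)) ` cball 0 1"
    then obtain y where y: "norm y \<le> 1" "w = y * (x * a)" by auto
    have "norm (y * x) \<le> 1 * k" using y k by (intro order_trans[OF norm_mult_ineq] mult_mono) auto
    then have "(1/k) *\<^sub>R (y * x) \<in> cball 0 1" using k by (simp add: divide_le_eq)
    moreover have "w = k *\<^sub>R (((1/k) *\<^sub>R (y * x)) * a)" using y k by (simp add: mult.assoc)
    ultimately show "w \<in> (\<lambda>w. k *\<^sub>R w) ` (\<lambda>y. y * a) ` cball 0 1" by blast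
  qed
  ultimately show ?thesis unfolding right_compact_def by (rule totally_bdd_subset)
qed

lemma right_compact_scaleC:
  fixes a :: "'a::cstar_algebra" assumes "right_compact a" shows "right_compact (c *\<^sub>C a)"
proof -
  have "totally_bdd ((\<lambda>w. c *\<^sub>C w) ` (\<lambda>y. y * a) ` cball 0 1)"
    by (rule totally_bdd_lipschitz_image[OF assms[unfolded right_compact_def], where L = "cmod c"])
      (simp add: scaleC_diff_right[symmetric] norm_scaleC)
  then show ?thesis by (simp add: right_compact_def image_image mult_scaleC_right)
qed

lemma right_compact_limit:
  assumes "\<And>e. e > 0 \<Longrightarrow> \<exists>b. right_compact b \<and> norm (a - b) < e"
  shows "right_compact (a::'a::real_normed_algebra)"
  unfolding right_compact_def totally_bdd_def
proof (intro allI impI)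
  fix e :: real assume e: "0 < e"
  obtain b where b: "right_compact b" "norm (a - b) < e / 2" using assms[of "e/2"] e by auto
  obtain F where F: "finite F" "\<forall>x\<in>(\<lambda>y. y * b) ` cball 0 1. \<exists>z\<in>F. norm (x - z) < e / 2"
    using b(1) e unfolding right_compact_def totally_bdd_def by (meson half_gt_zero)
  show "\<exists>F. finite F \<and> (\<forall>x\<in>(\<lambda>y. y * a) ` cball 0 1. \<exists>z\<in>F. norm (x - z) < e)"
  proof (intro exI conjI ballI)
    show "finite F" by (rule F)
    fix x assume "x \<in> (\<lambda>y. y * a) ` cball 0 1"
    then obtain y where y: "norm y \<le> 1" "x = y * a" by auto
    obtain z where z: "z \<in> F" "norm (y * b - z) < e / 2" using F(2) y by force
    have "norm (y * (a - b)) \<le> 1 * norm (a - b)"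
      by (rule order_trans[OF norm_mult_ineq]) (intro mult_right_mono y norm_ge_zero)
    moreover have "norm (x - z) \<le> norm (y * (a - b)) + norm (y * b - z)"
      using norm_triangle_ineq[of "y * (a - b)" "y * b - z"] by (simp add: y algebra_simps)
    ultimately have "norm (x - z) < e" using z(2) b(2) by simp
    then show "\<exists>z\<in>F. norm (x - z) < e" using z by blast
  qed
qed

text \<open>
  Demanding the condition for the adjoint as well makes both one-sided multiplications compact and the set
  closed under the involution.
\<close>

definition compact_elements :: "'a::cstar_algebra set" where
  "compact_elements = {a. right_compact a \<and> right_compact (cstar a)}"

lemma compact_elements_ideal: "closed_star_ideal (compact_elements :: 'a::cstar_algebra set)"
  unfolding closed_star_ideal_def
proof (intro conjI ballI allI)
  fix x y :: 'a and c
  show "(0::'a) \<in> compact_elements" by (simp add: compact_elements_def right_compact_zero)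
  show "closed (compact_elements :: 'a set)"
    unfolding closure_subset_eq[symmetric]
  proof
    fix a :: 'a assume a: "a \<in> closure compact_elements"
    have near: "\<exists>b\<in>compact_elements. norm (a - b) < e" if "e > 0" for e
      using a that unfolding closure_approachable dist_norm by (metis norm_minus_commute)
    have "right_compact a"
      by (rule right_compact_limit) (use near in \<open>auto simp: compact_elements_def\<close>)
    moreover have "right_compact (cstar a)"
    proof (rule right_compact_limit)
      fix e :: real assume "e > 0"
      then obtain b where b: "b \<in> compact_elements" "norm (a - b) < e" using near by blast
      then have "norm (cstar a - cstar b) < e" by (simp add: cstar_diff[symmetric])
      then show "\<exists>b. right_compact b \<and> norm (cstar a - b) < e"
        using b(1) by (auto simp: compact_elements_def)
    qed
    ultimately show "a \<in> compact_elements" by (simp add: compact_elements_def)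
  qed
  assume x: "x \<in> compact_elements"
  then show "c *\<^sub>C x \<in> compact_elements" "cstar x \<in> compact_elements"
    "x * y \<in> compact_elements" "y * x \<in> compact_elements"
    by (simp_all add: compact_elements_def right_compact_scaleC cstar_scaleC cstar_cstar cstar_mult
        right_compact_mult_left right_compact_mult_right)
  assume "y \<in> compact_elements"
  then show "x + y \<in> compact_elements"
    using x by (simp add: compact_elements_def right_compact_add cstar_add)
qed

lemma compact_element_left:
  assumes "a \<in> compact_elements" shows "totally_bdd ((\<lambda>y. a * y) ` cball 0 1)"
proof -
  have "totally_bdd (cstar ` (\<lambda>y. y * cstar a) ` cball 0 1)"
  proof (rule totally_bdd_lipschitz_image[where L = 1])
    show "totally_bdd ((\<lambda>y. y * cstar a) ` cball 0 1)"
      using assms by (simp add: compact_elements_def right_compact_def)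
  qed (simp add: cstar_diff[symmetric])
  moreover have "(\<lambda>y. a * y) ` cball 0 1 \<subseteq> cstar ` (\<lambda>y. y * cstar a) ` cball 0 1"
  proof
    fix w assume "w \<in> (\<lambda>y. a * y) ` cball 0 1"
    then obtain y where y: "norm y \<le> 1" "w = a * y" by auto
    then have "w = cstar (cstar y * cstar a)" by (simp add: cstar_mult cstar_cstar)
    moreover have "cstar y \<in> cball 0 1" using y by simp
    ultimately show "w \<in> cstar ` (\<lambda>y. y * cstar a) ` cball 0 1" by blast
  qed
  ultimately show ?thesis by (rule totally_bdd_subset)
qed

text \<open>
  The elements \<open>j * Q n\<close> lie in a totally bounded set. If many \<open>j * P n\<close> were large, two of these
  elements would be close, and multiplying their difference by \<open>P n\<close> recovers \<open>j * P n\<close>.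
\<close>

lemma compact_element_orthogonal_limit:
  fixes P Q :: "nat \<Rightarrow> 'a::cstar_algebra"
  assumes j: "j \<in> compact_elements"
    and Q: "\<And>n. norm (Q n) \<le> 1" and P: "\<And>n. norm (P n) \<le> 1"
    and QP: "\<And>n. Q n * P n = P n" and orth: "\<And>n m. n \<noteq> m \<Longrightarrow> Q m * P n = 0"
  shows "(\<lambda>n. j * P n) \<longlonglongrightarrow> 0"
proof (rule LIMSEQ_I)
  fix e :: real assume e: "0 < e"
  obtain F where F: "finite F" "\<forall>x\<in>(\<lambda>y. j * y) ` cball 0 1. \<exists>z\<in>F. norm (x - z) < e / 2"
    using compact_element_left[OF j] e unfolding totally_bdd_def by (meson half_gt_zero)
  have "\<exists>z\<in>F. norm (j * Q n - z) < e / 2" for n using F(2) Q[of n] by auto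
  then obtain z where z: "\<And>n. z n \<in> F" "\<And>n. norm (j * Q n - z n) < e / 2" by metis
  define S where "S = {n. e \<le> norm (j * P n)}"
  have "inj_on z S"
  proof (rule inj_onI, rule ccontr)
    fix n m assume nm: "n \<in> S" "m \<in> S" "z n = z m" "n \<noteq> m"
    have "j * P n = (j * Q n - j * Q m) * P n"
      using QP[of n] orth[OF nm(4)] by (simp add: left_diff_distrib mult.assoc)
    also have "norm \<dots> \<le> norm (j * Q n - j * Q m) * 1"
      by (rule order_trans[OF norm_mult_ineq]) (intro mult_left_mono P norm_ge_zero)
    also have "norm (j * Q n - j * Q m) \<le> norm (j * Q n - z n) + norm (j * Q m - z m)"
      using norm_triangle_ineq4[of "j * Q n - z n" "j * Q m - z m"] nm(3) by simp
    finally show False using z(2)[of n] z(2)[of m] nm(1) by (simp add: S_def)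
  qed
  moreover have "z ` S \<subseteq> F" using z by blast
  ultimately have "finite S" using F(1) inj_on_finite by blast
  then obtain N where "\<forall>n\<in>S. n < N" using finite_nat_set_iff_bounded[of S] by auto
  then have N: "\<And>n. n \<in> S \<Longrightarrow> n < N" by simp
  show "\<exists>N. \<forall>n\<ge>N. norm (j * P n - 0) < e"
  proof (intro exI allI impI)
    fix n assume "N \<le> n"
    then show "norm (j * P n - 0) < e" using N[of n] by (force simp: S_def)
  qed
qed

section \<open>Minimal projections\<close>

text \<open>
  For a minimal projection \<open>p\<close> the left ideal of all \<open>y * p\<close> is a Hilbert space with inner product
  \<open>cstar u * v = \<tau> (cstar u * v) p\<close>. If it has an orthonormal sequence starting with \<open>p\<close>, the
  functionals \<open>x \<mapsto> \<tau> (cstar v * x)\<close> with \<open>v = (p + u n) / sqrt 2\<close> have norm one and mutual distance at least \<open>1\<close>,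
  but tend to \<open>\<tau> / sqrt 2\<close>, whose norm exceeds \<open>1/2\<close>. Otherwise the space is finite-dimensional, and right
  multiplication by \<open>p\<close> is compact.
\<close>

lemma minimal_projection_compact:
  fixes p :: "'a::cstar_algebra"
  assumes ddagger: "property_ddagger TYPE('a)"
    and p: "selfadj p" "p * p = p" "p \<noteq> 0" and minimal: "\<And>y. \<exists>c. p * y * p = c *\<^sub>C p"
  shows "p \<in> compact_elements"
proof (rule ccontr)
  assume "p \<notin> compact_elements"
  then have not_compact: "\<not> right_compact p" using p(1) by (simp add: compact_elements_def selfadj_def)
  obtain \<tau> where \<tau>: "\<And>y. p * y * p = \<tau> y *\<^sub>C p" using minimal by metis
  have np: "norm p = 1"
    using selfadj_norm_square[OF p(1)] p(2,3) by (simp add: power2_eq_square)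
  have norm_1: "norm w = 1" if "cstar w * w = p" for w
  proof (rule power2_eq_imp_eq)
    show "(norm w)\<^sup>2 = 1\<^sup>2" using that cstar_norm[of w] np by simp
  qed simp_all
  have uniq: "c = d" if "c *\<^sub>C p = d *\<^sub>C p" for c d
  proof -
    have "(c - d) *\<^sub>C p = 0"
      using that scaleC_add_left[of c "- d" p] by (simp add: scaleC_minus_left)
    then have "cmod (c - d) * norm p = 0" by (metis norm_scaleC norm_zero)
    then show ?thesis using np by simp
  qed
  have \<tau>I: "\<tau> y = c" if "p * y * p = c *\<^sub>C p" for y c using uniq \<tau> that by metis
  have \<tau>_add: "\<tau> (y + z) = \<tau> y + \<tau> z" for y z
    by (rule \<tau>I) (simp add: distrib_left distrib_right \<tau> scaleC_add_left)
  have \<tau>_scale: "\<tau> (c *\<^sub>C y) = c * \<tau> y" for c y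
    by (rule \<tau>I) (simp add: mult_scaleC_left mult_scaleC_right \<tau> scaleC_scaleC)
  have \<tau>_norm: "cmod (\<tau> y) \<le> norm y" for y
  proof -
    have "cmod (\<tau> y) = norm (p * y * p)" by (simp add: \<tau> norm_scaleC np)
    also have "\<dots> \<le> norm p * norm y * norm p"
      by (meson mult_right_mono norm_ge_zero norm_mult_ineq order_trans)
    finally show ?thesis by (simp add: np)
  qed
  have \<tau>_p: "\<tau> p = 1" by (rule \<tau>I) (simp add: p scaleC_one)
  have \<tau>_pl: "\<tau> (p * y) = \<tau> y" for y
    by (rule \<tau>I) (simp add: mult.assoc[symmetric] p \<tau>)
  have \<tau>_sum: "\<tau> (sum f A) = (\<Sum>i\<in>A. \<tau> (f i))" for f :: "nat \<Rightarrow> 'a" and A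
  proof (induction A rule: infinite_finite_induct)
    case empty
    have "\<tau> 0 = 0" by (rule \<tau>I) simp
    then show ?case by simp
  next
    case (infinite A)
    have "\<tau> 0 = 0" by (rule \<tau>I) simp
    then show ?case using infinite by simp
  qed (simp add: \<tau>_add)
  have left_p: "p * cstar u = cstar u" if "u * p = u" for u
    using that p(1) unfolding selfadj_def by (metis cstar_mult)
  have inner: "cstar u * v = \<tau> (cstar u * v) *\<^sub>C p" if "u * p = u" "v * p = v" for u v
    using \<tau>[of "cstar u * v"] left_p[OF that(1)] that(2) by (simp add: mult.assoc[symmetric]) (simp add: mult.assoc)
  define P where "P = (\<lambda>(f::nat \<Rightarrow> 'a) r n. r * p = r \<and> cstar r * r = p \<and> (\<forall>i<n. cstar (f i) * r = 0) \<and> (n = 0 \<longrightarrow> r = p))"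
  have "\<exists>u. \<forall>n. P u (u n) n"
  proof (rule dependent_wellorder_choice)
    fix r :: 'a and f g :: "nat \<Rightarrow> 'a" and n
    assume "\<And>i. i < n \<Longrightarrow> f i = g i"
    then show "P f r n = P g r n" by (simp add: P_def)
  next
    fix n :: nat and u :: "nat \<Rightarrow> 'a"
    assume u: "\<And>i. i < n \<Longrightarrow> P u (u i) i"
    show "\<exists>r. P u r n"
    proof (cases "n = 0")
      case True
      then show ?thesis using p by (intro exI[of _ p]) (simp add: P_def selfadj_def)
    next
      case False
      have u0: "u 0 = p" using u[of 0] False by (simp add: P_def)
      have up: "u i * p = u i" "cstar (u i) * u i = p" if "i < n" for i using u[OF that] by (auto simp: P_def)
      have orth: "cstar (u i) * u j = 0" if "i < n" "j < n" "i \<noteq> j" for i j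
      proof (cases "i < j")
        case True
        then show ?thesis using u[OF that(2)] by (simp add: P_def)
      next
        case False
        then have "cstar (u j) * u i = 0" using u[OF that(1)] that by (simp add: P_def)
        then have "cstar (cstar (u j) * u i) = 0" by simp
        then show ?thesis by (simp add: cstar_mult cstar_cstar)
      qed
      define c where "c = (\<lambda>i y. \<tau> (cstar (u i) * y))"
      \<comment> \<open>The Gram-Schmidt residual; if it is always zero, all \<open>y * p\<close> lie in the span of \<open>n\<close> vectors.\<close>
      define res where "res = (\<lambda>y. y * p - (\<Sum>i<n. c i y *\<^sub>C u i))"
      have res_p: "res y * p = res y" for y
        using up p by (simp add: res_def left_diff_distrib sum_distrib_right mult_scaleC_left mult.assoc)
      have res_orth: "cstar (u j) * res y = 0" if j: "j < n" for j y
      proof -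
        have "cstar (u j) * (y * p) = c j y *\<^sub>C p"
          using \<tau>[of "cstar (u j) * y"] left_p[OF up(1)[OF j]]
          by (simp add: c_def mult.assoc[symmetric])
        moreover have "cstar (u j) * (\<Sum>i<n. c i y *\<^sub>C u i) = (\<Sum>i<n. if i = j then c j y *\<^sub>C p else 0)"
          unfolding sum_distrib_left
          by (rule sum.cong) (use orth j up in \<open>auto simp: mult_scaleC_right\<close>)
        ultimately show ?thesis using j by (simp add: res_def right_diff_distrib sum.delta)
      qed
      obtain y where y: "res y \<noteq> 0"
      proof (rule ccontr)
        assume "\<not> thesis"
        then have "res y = 0" for y using that by blast
        then have yp: "y * p = (\<Sum>i<n. c i y *\<^sub>C u i)" for y by (simp add: res_def)
        have "totally_bdd ((\<lambda>y. \<Sum>i<k. c i y *\<^sub>C u i) ` cball 0 1)" if "k \<le> n" for k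
          using that
        proof (induction k)
          case 0
          show ?case unfolding totally_bdd_def by (auto intro!: exI[of _ "{0}"])
        next
          case (Suc k)
          have uk: "norm (u k) = 1" using up(2)[of k] Suc.prems by (intro norm_1) simp
          have "totally_bdd ((\<lambda>z. z *\<^sub>C u k) ` cball 0 1)"
          proof (rule totally_bdd_lipschitz_image[OF totally_bdd_compact[OF compact_cball], where L = 1])
            show "norm (x *\<^sub>C u k - z *\<^sub>C u k) \<le> 1 * norm (x - z)" for x z
              using scaleC_add_left[of x "- z" "u k"] norm_scaleC[of "x - z" "u k"] uk
              by (simp add: scaleC_minus_left)
          qed
          moreover have "(\<lambda>y. c k y *\<^sub>C u k) ` cball 0 1 \<subseteq> (\<lambda>z. z *\<^sub>C u k) ` cball 0 1"
          proof
            fix w assume "w \<in> (\<lambda>y. c k y *\<^sub>C u k) ` cball 0 1"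
            then obtain y where y: "norm y \<le> 1" "w = c k y *\<^sub>C u k" by auto
            have "cmod (c k y) \<le> norm (cstar (u k) * y)" unfolding c_def by (rule \<tau>_norm)
            also have "\<dots> \<le> 1" using norm_mult_ineq[of "cstar (u k)" y] uk y by simp
            finally show "w \<in> (\<lambda>z. z *\<^sub>C u k) ` cball 0 1" using y by auto
          qed
          ultimately have "totally_bdd ((\<lambda>y. c k y *\<^sub>C u k) ` cball 0 1)" by (rule totally_bdd_subset)
          then show ?case using Suc by (simp add: totally_bdd_add)
        qed
        from this[of n] show False using not_compact by (simp add: right_compact_def yp)
      qed
      define r where "r = res y"
      define \<rho> where "\<rho> = \<tau> (cstar r * r)"
      have rr: "cstar r * r = \<rho> *\<^sub>C p" unfolding \<rho>_def r_def by (rule inner[OF res_p res_p])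
      have "cstar (cstar r * r) = cstar r * r" by (simp add: cstar_mult cstar_cstar)
      then have "cnj \<rho> *\<^sub>C p = \<rho> *\<^sub>C p" using p(1) by (simp add: rr cstar_scaleC selfadj_def)
      then have real: "\<rho> = of_real (Re \<rho>)" using uniq by (metis complex_cnj_cancel_iff Reals_cnj_iff of_real_Re)
      have nr: "cmod \<rho> = (norm r)\<^sup>2" using cstar_norm[of r] by (simp add: rr norm_scaleC np)
      have r0: "r \<noteq> 0" using y by (simp add: r_def)
      have pr: "p * r = 0" using res_orth[of 0 y] False u0 p(1) by (simp add: r_def selfadj_def)
      have rp: "cstar r * p = 0" using pr p(1) unfolding selfadj_def by (metis cstar_mult cstar_zero)
      \<comment> \<open>Positivity of \<open>r\<^sup>* r\<close> comes from orthogonality to \<open>p\<close>: for a negative value a multiple of \<open>r\<close> would be \<open>- p\<close>.\<close>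
      have pos: "Re \<rho> > 0"
      proof (rule ccontr)
        assume "\<not> 0 < Re \<rho>"
        moreover have "\<rho> \<noteq> 0" using nr r0 by auto
        ultimately have neg: "Re \<rho> < 0" using real by (metis linorder_neqE_linordered_idom of_real_0)
        define t where "t = 1 / sqrt (- Re \<rho>)"
        have t: "t * t * Re \<rho> = -1" "t > 0" using neg by (simp_all add: t_def field_simps)
        have "cstar (p + t *\<^sub>R r) * (p + t *\<^sub>R r) = p + (t * t) *\<^sub>R (cstar r * r)"
          using p pr rp by (simp add: cstar_add cstar_scaleR selfadj_def distrib_left distrib_right)
        also have "\<dots> = p + (t * t * Re \<rho>) *\<^sub>R p"
          by (subst rr, subst real) (simp add: scaleR_scaleC scaleC_scaleC)
        also have "\<dots> = 0" by (simp add: t)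
        finally have "p + t *\<^sub>R r = 0" using cstar_norm[of "p + t *\<^sub>R r"] by simp
        then have "p * (p + t *\<^sub>R r) = 0" by simp
        then show False using p pr by (simp add: distrib_left)
      qed
      define v where "v = (1 / sqrt (Re \<rho>)) *\<^sub>R r"
      have "P u v n"
        unfolding P_def
      proof (intro conjI allI impI)
        show "v * p = v" using res_p by (simp add: v_def r_def)
        have "cstar v * v = (1 / Re \<rho>) *\<^sub>R (cstar r * r)"
          using pos by (simp add: v_def cstar_scaleR)
        also have "\<dots> = p" using pos by (subst rr, subst real) (simp add: scaleR_scaleC scaleC_scaleC scaleC_one of_real_mult[symmetric] del: of_real_mult)
        finally show "cstar v * v = p" .
        show "cstar (u i) * v = 0" if "i < n" for i using res_orth[OF that] by (simp add: v_def r_def)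
        show "v = p" if "n = 0" using that False by simp
      qed
      then show ?thesis by blast
    qed
  qed
  then obtain u where "\<And>n. P u (u n) n" by blast
  then have u0: "u 0 = p" and up: "u n * p = u n" and uu: "cstar (u n) * u n = p"
    and uo: "i < n \<Longrightarrow> cstar (u i) * u n = 0" for i n
    by (auto simp: P_def)
  have orth: "cstar (u i) * u j = 0" if "i \<noteq> j" for i j
  proof (cases "i < j")
    case False
    then have "cstar (cstar (u j) * u i) = 0" using uo[of j i] that by simp
    then show ?thesis by (simp add: cstar_mult cstar_cstar)
  qed (simp add: uo)
  define a where "a = (\<lambda>x n. \<tau> (cstar (u n) * x))"
  have bessel: "(\<Sum>n<N. (cmod (a x n))\<^sup>2) \<le> (norm x)\<^sup>2" for N x
  proof -
    define S where "S = (\<Sum>n<N. (cmod (a x n))\<^sup>2)"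
    \<comment> \<open>Testing \<open>x\<close> against \<open>w\<close> gives the sum \<open>S\<close>, and \<open>S\<close> is also the square of the norm of \<open>w\<close>.\<close>
    define w where "w = (\<Sum>n<N. a x n *\<^sub>C u n)"
    have S0: "0 \<le> S" unfolding S_def by (intro sum_nonneg) simp
    have "cstar w * w = (\<Sum>i<N. \<Sum>j<N. (cnj (a x i) * a x j) *\<^sub>C (cstar (u i) * u j))"
      by (simp add: w_def cstar_sum cstar_scaleC sum_product mult_scaleC_left mult_scaleC_right scaleC_scaleC mult.commute)
    also have "\<dots> = (\<Sum>i<N. \<Sum>j<N. if j = i then (cnj (a x i) * a x i) *\<^sub>C p else 0)"
      by (intro sum.cong refl) (auto simp: orth uu)
    also have "\<dots> = (\<Sum>i<N. (cmod (a x i))\<^sup>2 *\<^sub>R p)"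
      by (intro sum.cong refl) (simp add: sum.delta scaleR_scaleC complex_norm_square mult.commute del: of_real_power)
    also have "\<dots> = S *\<^sub>R p" by (simp add: S_def scaleR_sum_left)
    finally have nw: "(norm w)\<^sup>2 = S" using cstar_norm[of w] S0 np by simp
    have "\<tau> (cstar w * x) = (\<Sum>n<N. cnj (a x n) * a x n)"
      by (simp add: w_def cstar_sum cstar_scaleC sum_distrib_right mult_scaleC_left \<tau>_sum \<tau>_scale a_def)
    also have "\<dots> = of_real S"
      unfolding S_def of_real_sum by (intro sum.cong refl) (simp add: complex_norm_square mult.commute del: of_real_power)
    finally have "S = cmod (\<tau> (cstar w * x))" using S0 by simp
    also have "\<dots> \<le> norm w * norm x"
      using \<tau>_norm[of "cstar w * x"] norm_mult_ineq[of "cstar w" x] by simp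
    finally have "S * S \<le> (norm w * norm x) * (norm w * norm x)"
      using S0 by (intro mult_mono) auto
    also have "\<dots> = S * (norm x)\<^sup>2" by (simp add: nw[symmetric] power2_eq_square mult_ac)
    finally show ?thesis using S0 unfolding S_def[symmetric] by (cases "S = 0") auto
  qed
  have a_lim: "a x \<longlonglongrightarrow> 0" for x by (rule square_summable_tendsto_0[OF bessel])
  define h where "h = 1 / sqrt 2"
  have h: "h * h = 1/2" "h > 0" by (auto simp: h_def)
  define v where "v = (\<lambda>n. h *\<^sub>R (p + u (Suc n)))"
  have cv: "cstar (v n) = h *\<^sub>R (p + cstar (u (Suc n)))" for n
    using p(1) by (simp add: v_def cstar_scaleR cstar_add selfadj_def)
  have pu: "p * u (Suc n) = 0" "cstar (u (Suc n)) * p = 0" for n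
    using orth[of 0 "Suc n"] orth[of "Suc n" 0] u0 p(1) by (simp_all add: selfadj_def)
  have vv: "cstar (v n) * v n = p" for n
  proof -
    have "cstar (v n) * v n = (h * h) *\<^sub>R (p + p)"
      unfolding cv by (simp add: v_def distrib_left distrib_right pu uu p scaleR_add_right)
    then show ?thesis by (simp add: h scaleR_2[symmetric])
  qed
  have "h \<le> 1/2"
  proof (rule ddagger_sequence[OF ddagger, where G = "\<lambda>n x. \<tau> (cstar (v n) * x)" and H = "\<lambda>x. of_real h * \<tau> x" and w = p])
    fix n
    show "contractive_functional (\<lambda>x. \<tau> (cstar (v n) * x))"
      unfolding contractive_functional_def
    proof (intro conjI allI)
      fix x show "cmod (\<tau> (cstar (v n) * x)) \<le> norm x"
        using \<tau>_norm[of "cstar (v n) * x"] norm_mult_ineq[of "cstar (v n)" x] norm_1[OF vv[of n]] by simp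
    qed (simp_all add: distrib_left \<tau>_add mult_scaleC_right \<tau>_scale)
    show "\<exists>w. norm w \<le> 1 \<and> cmod (\<tau> (cstar (v n) * w)) = 1"
      by (rule exI[of _ "v n"]) (simp add: vv norm_1[OF vv] \<tau>_p)
    fix m assume nm: "n < m"
    define w where "w = h *\<^sub>R (u (Suc n) - u (Suc m))"
    have cw: "cstar w = cstar (v n) - cstar (v m)"
      unfolding cv by (simp add: w_def cstar_scaleR cstar_diff scaleR_diff_right scaleR_add_right)
    have "cstar w * w = (h * h) *\<^sub>R (p + p)"
      using nm by (simp add: w_def cstar_scaleR cstar_diff left_diff_distrib right_diff_distrib orth uu
          scaleR_add_right)
    then have ww: "cstar w * w = p" by (simp add: h scaleR_2[symmetric])
    have "\<tau> (cstar (v n) * w) = \<tau> (cstar w * w) + \<tau> (cstar (v m) * w)"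
      unfolding \<tau>_add[symmetric] cw by (simp add: left_diff_distrib)
    then show "\<exists>w. norm w \<le> 1 \<and> 1 \<le> cmod (\<tau> (cstar (v n) * w) - \<tau> (cstar (v m) * w))"
      by (intro exI[of _ w]) (simp add: norm_1[OF ww] ww \<tau>_p)
  next
    fix x
    have eq: "\<tau> (cstar (v n) * x) = of_real h * (\<tau> x + a x (Suc n))" for n
      unfolding cv by (simp add: scaleR_scaleC distrib_right mult_scaleC_left scaleC_add_right \<tau>_add \<tau>_scale
          \<tau>_pl a_def distrib_left)
    have "(\<lambda>n. of_real h * (\<tau> x + a x (Suc n))) \<longlonglongrightarrow> of_real h * (\<tau> x + 0)"
      by (intro tendsto_intros LIMSEQ_Suc a_lim)
    then show "(\<lambda>n. \<tau> (cstar (v n) * x)) \<longlonglongrightarrow> of_real h * \<tau> x" by (simp add: eq)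
    show "cmod (of_real h * \<tau> x) \<le> h * norm x"
      using h \<tau>_norm[of x] by (simp add: norm_mult)
  qed (use h in \<open>simp_all add: np \<tau>_p\<close>)
  then have "h * h \<le> (1/2) * (1/2)" using h by (intro mult_mono) auto
  then show False using h by simp
qed

section \<open>Every element is compact\<close>

text \<open>
  A selfadjoint element outside \<open>J\<close> has a nonzero point in its spectrum modulo \<open>J\<close>. The bumps at this point
  inherit whatever is stable under limits of polynomials without constant term.
\<close>

lemma bump_chain_exists:
  fixes a :: "'a::cstar_algebra"
  assumes J: "closed_star_ideal J" and a: "selfadj a" "a \<notin> J"
  obtains c where "bump_chain J c" "\<And>v. a * v = 0 \<Longrightarrow> c 0 * v = 0" "\<And>e. e * a = a \<Longrightarrow> e * c 0 = c 0"
    "\<And>I k. closed_star_ideal I \<Longrightarrow> a \<in> I \<Longrightarrow> c k \<in> I"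
proof -
  have "a \<noteq> 0" using a(2) ideal_zero[OF J] by metis
  define b where "b = (1 / norm a) *\<^sub>R a"
  have ab: "a = norm a *\<^sub>R b" using \<open>a \<noteq> 0\<close> by (simp add: b_def)
  have b: "selfadj b" "norm b \<le> 1" using a \<open>a \<noteq> 0\<close> by (simp_all add: b_def selfadj_def cstar_scaleR)
  have "b \<notin> J" using ideal_scaleR[OF J, of b "norm a"] a(2) ab by metis
  have "\<exists>t\<in>ess_spectrum J b. t \<noteq> 0"
  proof (rule ccontr)
    assume "\<not> (\<exists>t\<in>ess_spectrum J b. t \<noteq> 0)"
    then have "cfc b (\<lambda>t. t) \<in> J"
      by (intro cfc_in_ideal[OF J b]) (auto simp: continuous_on_id)
    then show False using \<open>b \<notin> J\<close> by (simp add: cfc_ident[OF b])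
  qed
  then obtain t where t: "t \<in> ess_spectrum J b" "t \<noteq> 0" by blast
  define d where "d = \<bar>t\<bar> / 2"
  have d: "d > 0" "2 * d \<le> \<bar>t\<bar>" using t by (auto simp: d_def)
  have u: "null_cont (bump t (d / 2 ^ k))" for k
  proof (rule bump_null_cont)
    show "d / 2 ^ k > 0" using d by simp
    have "d / 2 ^ k \<le> d / 1" using d by (intro divide_left_mono) auto
    then show "2 * (d / 2 ^ k) \<le> \<bar>t\<bar>" using d by linarith
  qed
  show thesis
  proof (rule that)
    show "bump_chain J (\<lambda>k. cfc b (bump t (d / 2 ^ k)))" by (rule bump_chain_at[OF b t(1) d])
    show "cfc b (bump t (d / 2 ^ 0)) * v = 0" if "a * v = 0" for v
      using that by (intro cfc_annihilates[OF b u]) (simp add: b_def)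
    show "e * cfc b (bump t (d / 2 ^ 0)) = cfc b (bump t (d / 2 ^ 0))" if "e * a = a" for e
      using that by (intro cfc_mult_unit[OF b u]) (simp add: b_def)
    show "cfc b (bump t (d / 2 ^ k)) \<in> I" if "closed_star_ideal I" "a \<in> I" for I k
      using that by (intro ideal_cfc[OF that(1) b _ u]) (simp add: b_def ideal_scaleR[OF that(1)])
  qed
qed

lemma zero_ideal: "closed_star_ideal {0}"
  by (simp add: closed_star_ideal_def)

text \<open>
  If \<open>b\<close> compressed no compact element to a nonzero one, the scalar relation modulo compact elements
  would be exact: \<open>b y b\<close> would be a multiple of \<open>b\<^sup>2\<close> for all \<open>y\<close>. Then \<open>b\<close> would be a multiple of a
  minimal projection, which is compact.
\<close>

lemma corner_meets_compact_elements:
  fixes b :: "'a::cstar_algebra"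
  assumes ddagger: "property_ddagger TYPE('a)"
    and character: "\<And>y. \<exists>c. e * y * e - c *\<^sub>C (e * e) \<in> compact_elements"
    and b: "selfadj b" "b \<notin> compact_elements" and eb: "e * b = b" "b * e = b"
  obtains z where "selfadj z" "b * z * b \<in> compact_elements" "b * z * b \<noteq> 0"
proof -
  note J = compact_elements_ideal
  have b0: "b \<noteq> 0" using b(2) ideal_zero[OF J] by metis
  have bb0: "b * b \<noteq> 0" using selfadj_norm_square[OF b(1)] b0 by auto
  have "\<exists>z. b * z * b \<in> compact_elements \<and> b * z * b \<noteq> 0"
  proof (rule ccontr)
    assume none: "\<not> ?thesis"
    have byb: "\<exists>c. b * y * b = c *\<^sub>C (b * b)" for y
    proof -
      obtain c where c: "e * y * e - c *\<^sub>C (e * e) \<in> compact_elements" using character by blast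
      have "b * (e * y * e - c *\<^sub>C (e * e)) * b \<in> compact_elements"
        by (intro ideal_mult_left[OF J] ideal_mult_right[OF J] c)
      then have "b * (e * y * e - c *\<^sub>C (e * e)) * b = 0" using none by blast
      moreover have "b * (e * y * e - c *\<^sub>C (e * e)) * b = b * y * b - c *\<^sub>C (b * b)"
      proof -
        have "b * (e * w) = b * w" for w using eb by (simp add: mult.assoc[symmetric])
        then show ?thesis
          by (simp add: right_diff_distrib left_diff_distrib mult.assoc eb mult_scaleC_left mult_scaleC_right)
      qed
      ultimately show ?thesis by auto
    qed
    obtain l where l: "b * b * b = l *\<^sub>C (b * b)" using byb by blast
    have cb: "cstar b = b" using b(1) by (simp add: selfadj_def)
    have "cstar (b * b - l *\<^sub>C b) * (b * b - l *\<^sub>C b) = b * (b * b * b - l *\<^sub>C (b * b)) - cnj l *\<^sub>C (b * b * b - l *\<^sub>C (b * b))"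
      by (simp add: cstar_diff cstar_mult cstar_scaleC cb left_diff_distrib right_diff_distrib
          mult_scaleC_left mult_scaleC_right scaleC_diff_right mult.assoc scaleC_scaleC mult.commute)
    then have "norm (b * b - l *\<^sub>C b) = 0" using cstar_norm[of "b * b - l *\<^sub>C b"] by (simp add: l)
    then have bb: "b * b = l *\<^sub>C b" by simp
    have l0: "l \<noteq> 0" using bb bb0 by auto
    have "cstar (b * b) = b * b" by (simp add: cstar_mult cb)
    then have "cnj l *\<^sub>C b = l *\<^sub>C b" by (simp add: bb cstar_scaleC cb)
    then have "(cnj l - l) *\<^sub>C b = 0"
      using scaleC_add_left[of "cnj l" "- l" b] by (simp add: scaleC_minus_left)
    then have "cmod (cnj l - l) * norm b = 0" by (metis norm_scaleC norm_zero)
    then have lreal: "cnj l = l" using b0 by simp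
    define p where "p = (1 / l) *\<^sub>C b"
    have bp: "b = l *\<^sub>C p" using l0 by (simp add: p_def scaleC_scaleC scaleC_one)
    have "p \<in> compact_elements"
    proof (rule minimal_projection_compact[OF ddagger])
      show "selfadj p" by (simp add: p_def selfadj_def cstar_scaleC cb lreal)
      show "p * p = p" using l0 by (simp add: p_def mult_scaleC_left mult_scaleC_right bb scaleC_scaleC)
      show "p \<noteq> 0" using bp b0 by auto
      fix y
      obtain c where c: "b * y * b = c *\<^sub>C (b * b)" using byb by blast
      have "p * y * p = (1 / l) *\<^sub>C (1 / l) *\<^sub>C (b * y * b)"
        by (simp add: p_def mult_scaleC_left mult_scaleC_right)
      also have "\<dots> = c *\<^sub>C p" using l0 by (simp add: c bb scaleC_scaleC p_def)
      finally show "\<exists>c. p * y * p = c *\<^sub>C p" by blast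
    qed
    then show False using b(2) bp ideal_scaleC[OF J] by metis
  qed
  then obtain z where z: "b * z * b \<in> compact_elements" "b * z * b \<noteq> 0" by blast
  have cb: "cstar b = b" using b(1) by (simp add: selfadj_def)
  have cz: "cstar (b * z * b) = b * cstar z * b" by (simp add: cstar_mult cb mult.assoc)
  have zstar: "b * cstar z * b \<in> compact_elements" using ideal_cstar[OF J z(1)] by (simp add: cz)
  show thesis
  proof (cases "b * (z + cstar z) * b = 0")
    case False
    have "b * (z + cstar z) * b = b * z * b + b * cstar z * b" by (simp add: distrib_left distrib_right)
    then show thesis using that[of "z + cstar z"] False ideal_add[OF J z(1) zstar]
      by (simp add: selfadj_def cstar_add cstar_cstar add.commute)
  next
    case True
    then have eq: "b * cstar z * b = - (b * z * b)"
      by (simp add: distrib_left distrib_right eq_neg_iff_add_eq_0 add.commute)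
    have "b * (\<i> *\<^sub>C (z - cstar z)) * b = \<i> *\<^sub>C (2 *\<^sub>R (b * z * b))"
      by (simp add: mult_scaleC_left mult_scaleC_right right_diff_distrib left_diff_distrib eq scaleR_2)
    moreover have "norm (\<i> *\<^sub>C (2 *\<^sub>R (b * z * b))) \<noteq> 0" using z(2) by (simp add: norm_scaleC)
    moreover have "\<i> *\<^sub>C (2 *\<^sub>R (b * z * b)) \<in> compact_elements"
      by (intro ideal_scaleC[OF J] ideal_scaleR[OF J] z)
    moreover have "selfadj (\<i> *\<^sub>C (z - cstar z))"
      by (simp add: selfadj_def cstar_scaleC cstar_diff cstar_cstar scaleC_minus_left scaleC_diff_right)
    ultimately show thesis using that[of "\<i> *\<^sub>C (z - cstar z)"] by auto
  qed
qed

lemma chain_normal_to_compact_exists: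
  fixes b :: "'a::cstar_algebra"
  assumes ddagger: "property_ddagger TYPE('a)"
    and character: "\<And>y. \<exists>c. e * y * e - c *\<^sub>C (e * e) \<in> compact_elements"
    and b: "selfadj b" "b \<notin> compact_elements" and eb: "e * b = b" "b * e = b" "f * b = b"
  obtains c where "bump_chain {0} c" "\<And>k. c k \<in> compact_elements" "\<And>v. b * v = 0 \<Longrightarrow> c 0 * v = 0"
    "f * c 0 = c 0"
proof -
  obtain z where z: "selfadj z" "b * z * b \<in> compact_elements" "b * z * b \<noteq> 0"
    by (rule corner_meets_compact_elements[OF ddagger character b eb(1,2)])
  have sa: "selfadj (b * z * b)" using z(1) b(1) by (simp add: selfadj_def cstar_mult mult.assoc)
  obtain c where c: "bump_chain {0} c" "\<And>v. b * z * b * v = 0 \<Longrightarrow> c 0 * v = 0"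
    "\<And>e. e * (b * z * b) = b * z * b \<Longrightarrow> e * c 0 = c 0"
    "\<And>I k. closed_star_ideal I \<Longrightarrow> b * z * b \<in> I \<Longrightarrow> c k \<in> I"
    by (rule bump_chain_exists[OF zero_ideal sa]) (use z(3) in auto)
  show thesis
  proof (rule that[OF c(1)])
    show "c k \<in> compact_elements" for k by (rule c(4)[OF compact_elements_ideal z(2)])
    show "c 0 * v = 0" if "b * v = 0" for v using that by (intro c(2)) (simp add: mult.assoc)
    show "f * c 0 = c 0" using eb(3) by (intro c(3)) (simp add: mult.assoc[symmetric])
  qed
qed

text \<open>
  Otherwise there is a chain \<open>e\<close> that does not split modulo the compact elements, so \<open>e 4 * y * e 4\<close> is a
  scalar times \<open>e 4 * e 4\<close> up to a compact element. Inside its corner one finds infinitely many orthogonal chains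
  of compact elements. Functionals \<open>g n\<close> concentrated on them vanish in the limit on compact elements
  and therefore converge weak* to this scalar, which as a functional of \<open>y\<close> attains its norm one at \<open>e 4\<close>. But
  orthogonality keeps the \<open>g n\<close> at distance at least \<open>1\<close> from one another.
\<close>

lemma all_elements_compact:
  assumes ddagger: "property_ddagger TYPE('a::cstar_algebra)"
  shows "(a::'a) \<in> compact_elements"
proof (rule ccontr)
  assume na: "a \<notin> compact_elements"
  note J = compact_elements_ideal[where 'a = 'a]
  have "\<exists>a::'a. selfadj a \<and> a \<notin> compact_elements"
  proof (rule ccontr)
    assume none: "\<not> ?thesis"
    have "a + cstar a \<in> compact_elements" "\<i> *\<^sub>C (a - cstar a) \<in> compact_elements"
      using none by (auto simp: selfadj_def cstar_add cstar_cstar cstar_scaleC cstar_diff scaleC_minus_left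
          scaleC_diff_right add.commute)
    then have "(1/2) *\<^sub>R ((a + cstar a) + (- \<i>) *\<^sub>C (\<i> *\<^sub>C (a - cstar a))) \<in> compact_elements"
      by (rule ideal_scaleR[OF J ideal_add[OF J _ ideal_scaleC[OF J]]])
    moreover have "(1/2) *\<^sub>R ((a + cstar a) + (- \<i>) *\<^sub>C (\<i> *\<^sub>C (a - cstar a))) = a"
      by (simp add: scaleC_scaleC scaleC_one scaleR_2[symmetric])
    ultimately show False using na by simp
  qed
  then obtain a0 :: 'a where a0: "selfadj a0" "a0 \<notin> compact_elements" by blast
  obtain e0 where "bump_chain compact_elements (e0 :: nat \<Rightarrow> 'a)"
    by (rule bump_chain_exists[OF J a0])
  from ex_not_splits[OF ddagger J this]
  obtain e where e: "bump_chain compact_elements (e :: nat \<Rightarrow> 'a)" "\<not> splits compact_elements e" .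
  note mult = chain_mult[OF e(1)] and multr = chain_mult_right[OF e(1)]
  have character: "\<exists>c. e 4 * y * e 4 - c *\<^sub>C (e 4 * e 4) \<in> compact_elements" for y
    by (rule not_splits_character[OF J e, of y]) blast
  define inv where "inv = (\<lambda>b. selfadj b \<and> b \<notin> compact_elements \<and> e 5 * b = b)"
  have inv4: "e 4 * b = b" "b * e 4 = b" if "inv b" for b
  proof -
    have "e 4 * (e 5 * b) = e 5 * b" using mult[of 4 5] by (simp add: mult.assoc[symmetric])
    then show "e 4 * b = b" using that by (simp add: inv_def)
    then show "b * e 4 = b" using that chain_selfadj[OF e(1), of 4] unfolding inv_def selfadj_def
      by (metis cstar_mult)
  qed
  have "\<exists>c. bump_chain {0} c \<and> (\<forall>k. c k \<in> compact_elements) \<and> (\<forall>v. b * v = 0 \<longrightarrow> c 0 * v = 0) \<and>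
      e 5 * c 0 = c 0" if "inv b" for b
    using that inv4[OF that] unfolding inv_def
    by (elim conjE) (rule chain_normal_to_compact_exists[OF ddagger character, of b "e 5"]; blast)
  then obtain C where C: "\<And>b. inv b \<Longrightarrow> bump_chain {0} (C b)" "\<And>b k. inv b \<Longrightarrow> C b k \<in> compact_elements"
    "\<And>b v. inv b \<Longrightarrow> b * v = 0 \<Longrightarrow> C b 0 * v = 0" "\<And>b. inv b \<Longrightarrow> e 5 * C b 0 = C b 0"
    by metis
  \<comment> \<open>With \<open>c = C b 0\<close> this is \<open>(1 - c) b (1 - c)\<close>: it differs from \<open>b\<close> by a compact element and annihilates the rest of the chain \<open>C b\<close>.\<close>
  define nxt where "nxt = (\<lambda>b. b - C b 0 * b - (b - C b 0 * b) * C b 0)"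
  define B where "B = rec_nat (e 6) (\<lambda>_. nxt)"
  have B0: "B 0 = e 6" and BS: "B (Suc n) = nxt (B n)" for n by (simp_all add: B_def)
  have inv_B: "inv (B n)" for n
  proof (induction n)
    case 0
    then show ?case using chain_selfadj[OF e(1)] chain_notin[OF e(1)] mult[of 5 6] by (simp add: B0 inv_def)
  next
    case (Suc n)
    let ?b = "B n" and ?c = "C (B n) 0"
    have sc: "cstar ?c = ?c" using chain_selfadj[OF C(1)[OF Suc]] by (simp add: selfadj_def)
    have sb: "cstar ?b = ?b" using Suc by (simp add: inv_def selfadj_def)
    have "selfadj (nxt ?b)"
      by (simp add: nxt_def selfadj_def cstar_diff cstar_mult sc sb left_diff_distrib right_diff_distrib mult.assoc)
    moreover have "nxt ?b \<notin> compact_elements"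
    proof
      assume "nxt ?b \<in> compact_elements"
      moreover have "?c * ?b \<in> compact_elements" "(?b - ?c * ?b) * ?c \<in> compact_elements"
        by (intro ideal_mult_right[OF J] ideal_mult_left[OF J] C(2) Suc)+
      ultimately have "nxt ?b + (?c * ?b + (?b - ?c * ?b) * ?c) \<in> compact_elements"
        by (intro ideal_add[OF J])
      then show False using Suc by (simp add: nxt_def inv_def)
    qed
    moreover have "e 5 * nxt ?b = nxt ?b"
      using Suc C(4)[OF Suc] by (simp add: nxt_def inv_def right_diff_distrib mult.assoc[symmetric])
    ultimately show ?case by (simp add: BS inv_def)
  qed
  define c where "c = (\<lambda>n. C (B n))"
  have c: "bump_chain {0} (c n)" "c n k \<in> compact_elements" "B n * v = 0 \<Longrightarrow> c n 0 * v = 0"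
    "e 5 * c n 0 = c n 0" for n k v
    using C inv_B by (auto simp: c_def)
  note cm = chain_mult[OF c(1)] and cmr = chain_mult_right[OF c(1)]
  have B_kill: "B m * c n 1 = 0" if "n < m" for n m
    using that
  proof (induction m)
    case (Suc m)
    have nxt: "nxt (B m) * v = (B m - c m 0 * B m) * (v - c m 0 * v)" for v
      by (simp add: nxt_def c_def left_diff_distrib right_diff_distrib mult.assoc)
    show ?case
    proof (cases "n = m")
      case True
      then show ?thesis using cm[of 0 1 m] by (simp add: BS nxt)
    next
      case False
      then have "B m * c n 1 = 0" using Suc by simp
      moreover from this have "c m 0 * c n 1 = 0" by (rule c(3))
      ultimately show ?thesis by (simp add: BS nxt left_diff_distrib mult.assoc)
    qed
  qed simp
  have orth_lt: "c m 1 * c n 1 = 0" if "n < m" for n m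
  proof -
    have "c m 0 * c n 1 = 0" by (rule c(3)[OF B_kill[OF that]])
    then have "c m 1 * c m 0 * c n 1 = 0" by (simp add: mult.assoc)
    then show ?thesis using cmr[of 0 1 m] by simp
  qed
  have orth: "c m 1 * c n 1 = 0" if "n \<noteq> m" for n m
  proof (cases "n < m")
    case False
    then have "c n 1 * c m 1 = 0" using that by (intro orth_lt) simp
    then have "cstar (c n 1 * c m 1) = 0" by simp
    then show ?thesis using chain_selfadj[OF c(1)] by (simp add: cstar_mult selfadj_def)
  qed (rule orth_lt)
  define P where "P = (\<lambda>n. c n 2)"
  have QP: "c n 1 * P n = P n" for n using cm[of 1 2 n] by (simp add: P_def)
  have orthP: "c m 1 * P n = 0" if "n \<noteq> m" for n m
    using orth[OF that] QP[of n] by (metis mult.assoc mult_zero_left)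
  have PP: "P n * P m = 0" if "n \<noteq> m" for n m
  proof -
    have "P n = P n * c n 1" using cmr[of 1 2 n] by (simp add: P_def)
    then show ?thesis using orthP[of m n] that by (metis mult.assoc mult_zero_right)
  qed
  have saP: "cstar (P n) = P n" for n using chain_selfadj[OF c(1)] by (simp add: P_def selfadj_def)
  have P_norm: "norm (P n) \<le> 1" for n using chain_norm_le[OF c(1)] by (simp add: P_def)
  have eP: "e 4 * P n = P n" for n
  proof -
    have "e 5 * (c n 0 * P n) = c n 0 * P n" using c(4)[of n] by (simp add: mult.assoc[symmetric])
    then have e5: "e 5 * P n = P n" using cm[of 0 2 n] by (simp add: P_def)
    have "e 4 * (e 5 * P n) = e 5 * P n" using mult[of 4 5] by (simp add: mult.assoc[symmetric])
    then show ?thesis by (simp add: e5)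
  qed
  have Pe: "P n * e 4 = P n" for n
    using eP[of n] saP[of n] chain_selfadj[OF e(1), of 4] unfolding selfadj_def by (metis cstar_mult)
  have "\<exists>F. contractive_functional F \<and> F (P n) = 1 \<and> (\<forall>x. F (P n * x) = F x) \<and> (\<forall>x. F (x * P n) = F x)" for n
  proof -
    obtain F where "contractive_functional F" "\<And>j. j \<le> 3 \<Longrightarrow> F (c n j) = 1"
      "\<And>j x. j < 3 \<Longrightarrow> F (c n j * x) = F x" "\<And>j x. j < 3 \<Longrightarrow> F (x * c n j) = F x"
      by (rule chain_functional_exists[OF zero_ideal c(1), of 3 n]) blast
    then show ?thesis by (intro exI[of _ F]) (simp add: P_def)
  qed
  then obtain g where g: "\<And>n. contractive_functional (g n)" "\<And>n. g n (P n) = 1"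
    "\<And>n x. g n (P n * x) = g n x" "\<And>n x. g n (x * P n) = g n x"
    by metis
  have ge: "g n (e 4 * x * e 4) = g n x" for n x
  proof -
    have "P n * (e 4 * x * e 4) * P n = P n * x * P n"
      using eP[of n] Pe[of n] by (metis mult.assoc)
    then show ?thesis using g(3,4) by (metis mult.assoc)
  qed
  have ge1: "g n (e 4) = 1" for n using g(4)[of n "e 4"] g(2) by (simp add: eP)
  have "\<exists>l. (\<lambda>n. g n x) \<longlonglongrightarrow> l" for x
  proof -
    obtain l where l: "e 4 * x * e 4 - l *\<^sub>C (e 4 * e 4) \<in> compact_elements" using character by blast
    define j where "j = e 4 * x * e 4 - l *\<^sub>C (e 4 * e 4)"
    have ee: "g n (e 4 * e 4) = 1" for n
    proof -
      have "g n (e 4 * e 4) = g n (e 4 * e 4 * P n)" by (simp add: g(4))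
      then show ?thesis by (simp add: mult.assoc eP g(2))
    qed
    have eq: "g n x - l = g n (j * P n)" for n
      by (simp add: g(4)) (simp add: j_def cf_diff[OF g(1)] cf_scaleC[OF g(1)] ge ee)
    have "(\<lambda>n. j * P n) \<longlonglongrightarrow> 0"
      by (rule compact_element_orthogonal_limit[where Q = "\<lambda>n. c n 1"])
        (use l QP orthP P_norm chain_norm_le[OF c(1)] in \<open>auto simp: j_def\<close>)
    then have "(\<lambda>n. g n x - l) \<longlonglongrightarrow> 0"
      unfolding eq by (rule Lim_null_comparison[OF always_eventually, rotated, OF tendsto_norm_zero])
        (simp add: cf_norm[OF g(1)])
    then have "(\<lambda>n. g n x) \<longlonglongrightarrow> l" by (rule LIM_zero_cancel)
    then show ?thesis ..
  qed
  then obtain H where H: "\<And>x. (\<lambda>n. g n x) \<longlonglongrightarrow> H x" by metis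
  have "(1::real) \<le> 1/2"
  proof (rule ddagger_sequence[OF ddagger g(1) _ _ H, where w = "e 4"])
    show "\<exists>u. norm u \<le> 1 \<and> cmod (g n u) = 1" for n using P_norm g(2) by (intro exI[of _ "P n"]) simp
    show "\<exists>v. norm v \<le> 1 \<and> 1 \<le> cmod (g n v - g m v)" if "n < m" for n m
    proof -
      have "g m (P n) = g m (P n * P m)" by (simp add: g(4))
      then have "g m (P n) = 0" using PP[of n m] that cf_zero[OF g(1)] by simp
      then show ?thesis using P_norm g(2) by (intro exI[of _ "P n"]) simp
    qed
    show "cmod (H x) \<le> 1 * norm x" for x
      by (rule LIMSEQ_le_const2[OF tendsto_norm[OF H]]) (simp add: cf_norm[OF g(1)])
    show "norm (e 4) \<le> 1" by (rule chain_norm_le[OF e(1)])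
    have "H (e 4) = 1" using H[of "e 4"] by (simp add: ge1 LIMSEQ_const_iff)
    then show "cmod (H (e 4)) = 1" by simp
  qed
  then show False by simp
qed

section \<open>Lim's condition\<close>

lemma norm_orthogonal_add_le_1:
  fixes u w :: "'a::cstar_algebra"
  assumes orth: "cstar u * w = 0" "u * cstar w = 0" and norms: "norm u \<le> 1" "norm w \<le> 1"
  shows "norm (u + w) \<le> 1"
proof -
  define x where "x = (\<lambda>b. if b then cstar u * u else cstar w * w)"
  have wu: "cstar w * u = 0" "w * cstar u = 0"
    using arg_cong[OF orth(1), of cstar] arg_cong[OF orth(2), of cstar]
    by (simp_all add: cstar_mult cstar_cstar)
  have "norm (\<Sum>b\<in>UNIV. x b) \<le> 1"
  proof (rule norm_sum_orthogonal_le_1)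
    fix b c :: bool
    show "selfadj (x b)" by (simp add: x_def selfadj_def cstar_mult cstar_cstar)
    show "norm (x b) \<le> 1" using norms by (simp add: x_def cstar_norm power_le_one)
    assume "b \<noteq> c"
    moreover have "cstar u * u * (cstar w * w) = 0" "cstar w * w * (cstar u * u) = 0"
      using orth(2) wu(2) by (metis mult.assoc mult_zero_left mult_zero_right)+
    ultimately show "x b * x c = 0" by (auto simp: x_def)
  qed simp
  moreover have "cstar (u + w) * (u + w) = (\<Sum>b\<in>UNIV. x b)"
    using orth(1) wu(1) by (simp add: x_def UNIV_bool cstar_add distrib_left distrib_right)
  ultimately have "(norm (u + w))\<^sup>2 \<le> 1\<^sup>2" by (simp add: cstar_norm[symmetric])
  then show ?thesis by (rule power2_le_imp_le) simp
qed

text \<open>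
  Both cutoffs are functions of \<open>x x\<^sup>*\<close>: \<open>k\<close> is a local unit for \<open>x\<close>, supported where \<open>m\<close> is \<open>1\<close>, so that
  multiplication by \<open>1 - m\<close> removes everything \<open>k\<close> sees.
\<close>

lemma left_cutoffs_exist:
  fixes x :: "'a::cstar_algebra"
  assumes x: "norm x \<le> 1" and e: "0 < e"
  obtains k m where "selfadj k" "selfadj m" "k * m = k" "\<And>z. norm (k * z) \<le> norm z"
    "\<And>z. norm (z - m * z) \<le> norm z" "norm (x - k * x) \<le> e"
proof -
  define a where "a = x * cstar x"
  have a: "selfadj a" "norm a \<le> 1"
    using x by (simp_all add: a_def selfadj_def cstar_mult cstar_cstar cstar_norm' power_le_one)
  define d where "d = e\<^sup>2 / 2"
  have d: "d > 0" using e by (simp add: d_def)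
  define K where "K = (\<lambda>t. 1 - bump 0 d t)"
  define M where "M = (\<lambda>t. 1 - bump 0 (d / 2) t)"
  have K: "null_cont K" "\<And>t. 0 \<le> K t" "\<And>t. K t \<le> 1"
    and M: "null_cont M" "\<And>t. 0 \<le> M t" "\<And>t. M t \<le> 1"
    unfolding K_def M_def using d bump_range[of 0 d] bump_range[of 0 "d/2"]
    by (auto intro!: continuous_intros bump_continuous simp: diff_le_eq)
  have KM: "K t * M t = K t" for t
    using bump_eq_1[of d t 0] bump_eq_0[of "d / 2" t 0] d by (cases "\<bar>t\<bar> \<le> d") (auto simp: K_def M_def)
  define k m where "k = cfc a K" and "m = cfc a M"
  have contract: "norm (z - cfc a f * z) \<le> norm z"
    if f: "null_cont f" "\<And>t. 0 \<le> f t" "\<And>t. f t \<le> 1" for f z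
  proof -
    have "null_cont (\<lambda>t. (-1) * f t)" using f by (auto intro: continuous_intros)
    moreover have "\<bar>1 + (-1) * f t\<bar> \<le> 1" for t using f(2,3)[of t] by simp
    ultimately have "norm (1 *\<^sub>R z + cfc a (\<lambda>t. (-1) * f t) * z) \<le> 1 * norm z"
      by (intro cfc_norm[OF a])
    then show ?thesis unfolding cfc_scale[OF a f(1)] by simp
  qed
  show thesis
  proof (rule that)
    show sk: "selfadj k" and "selfadj m" using cfc_selfadj[OF a] K M by (auto simp: k_def m_def)
    show "k * m = k" unfolding k_def m_def cfc_mult[OF a K(1) M(1), symmetric] KM ..
    show "norm (k * z) \<le> norm z" for z
      using cfc_norm[OF a K(1), of 0 1 z] K(2,3) by (simp add: k_def)
    show "norm (z - m * z) \<le> norm z" for z unfolding m_def by (rule contract[OF M])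
    define w where "w = a - k * a"
    have id: "null_cont (\<lambda>t. t)" by (simp add: continuous_on_id)
    have u: "null_cont (\<lambda>t. K t * t)" "null_cont (\<lambda>t. (-1) * (K t * t))" "null_cont (\<lambda>t. t + (-1) * (K t * t))"
      using K(1) by (auto intro!: continuous_intros)
    have w: "w = cfc a (\<lambda>t. t + (-1) * (K t * t))"
      unfolding cfc_add[OF a id u(2)] cfc_scale[OF a u(1)] cfc_mult[OF a K(1) id] cfc_ident[OF a]
      by (simp add: w_def k_def)
    have "norm w \<le> 2 * d"
      unfolding w
    proof (rule cfc_norm_le[OF a u(3)])
      fix t :: real
      have eq: "t + (-1) * (K t * t) = t * bump 0 d t" by (simp add: K_def algebra_simps)
      show "\<bar>t + (-1) * (K t * t)\<bar> \<le> 2 * d"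
      proof (cases "2 * d \<le> \<bar>t\<bar>")
        case True
        then show ?thesis unfolding eq using bump_eq_0[OF d, of t 0] d by simp
      next
        case False
        have "\<bar>t * bump 0 d t\<bar> \<le> \<bar>t\<bar> * 1"
          unfolding abs_mult using bump_range[of 0 d t] by (intro mult_left_mono) auto
        then show ?thesis unfolding eq using False by simp
      qed
    qed
    have sw: "selfadj w" unfolding w by (rule cfc_selfadj[OF a u(3)])
    have "(x - k * x) * cstar (x - k * x) = w - w * k"
      using sk by (simp add: w_def a_def cstar_diff cstar_mult selfadj_def left_diff_distrib right_diff_distrib mult.assoc)
    then have "(norm (x - k * x))\<^sup>2 = norm (w - w * k)" by (simp add: cstar_norm'[symmetric])
    also have "\<dots> = norm (cstar (w - w * k))" by simp
    also have "\<dots> = norm (w - k * w)" using sw sk by (simp add: cstar_diff cstar_mult selfadj_def)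
    also have "\<dots> \<le> norm w" unfolding k_def by (rule contract[OF K])
    also have "\<dots> \<le> e\<^sup>2" using \<open>norm w \<le> 2 * d\<close> by (simp add: d_def)
    finally show "norm (x - k * x) \<le> e" by (rule power2_le_imp_le) (use e in simp)
  qed
qed

lemma cmod_phase:
  obtains c where "cmod c = 1" "c * w = of_real (cmod w)"
proof (cases "w = 0")
  case False
  have "cnj w / of_real (cmod w) * w = of_real (cmod w)"
    using False complex_norm_square[of w] by (simp add: power2_eq_square field_simps)
  then show thesis using that[of "cnj w / of_real (cmod w)"] False by (simp add: norm_divide)
qed (use that[of 1] in simp)

lemma dual_almost_attains:
  assumes \<phi>: "\<phi> \<in> dual_space" and e: "0 < e"
  obtains x where "norm x \<le> 1" "norm \<phi> - e \<le> Re (blinfun_apply \<phi> x)"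
proof (cases "norm \<phi> \<le> e")
  case True
  then show thesis using that[of 0] by (simp add: blinfun.zero_right)
next
  case False
  have "\<exists>y. (norm \<phi> - e) * norm y < cmod (blinfun_apply \<phi> y)"
  proof (rule ccontr)
    assume "\<not> ?thesis"
    then have "norm \<phi> \<le> norm \<phi> - e" using False by (intro norm_blinfun_bound) (auto simp: not_less)
    then show False using e by simp
  qed
  then obtain y where y: "(norm \<phi> - e) * norm y < cmod (blinfun_apply \<phi> y)" by blast
  then have y0: "norm y > 0" by (cases "y = 0") (auto simp: blinfun.zero_right)
  obtain c where c: "cmod c = 1" "c * blinfun_apply \<phi> y = of_real (cmod (blinfun_apply \<phi> y))"
    by (rule cmod_phase)
  define x where "x = c *\<^sub>C ((1 / norm y) *\<^sub>R y)"
  have "norm x \<le> 1" using y0 c by (simp add: x_def norm_scaleC)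
  moreover have "blinfun_apply \<phi> x = of_real (cmod (blinfun_apply \<phi> y) / norm y)"
  proof -
    have "blinfun_apply \<phi> x = c * blinfun_apply \<phi> y / norm y"
      using \<phi> by (simp add: x_def dual_space_def blinfun.scaleR_right scaleR_conv_of_real)
    then show ?thesis by (simp add: c)
  qed
  ultimately show thesis using that[of x] y y0 by (simp add: field_simps)
qed

lemma dual_uniform_on_totally_bdd:
  assumes F: "\<forall>\<^sub>F i in F. norm (f i) \<le> s" and lim: "\<And>x. ((\<lambda>i. blinfun_apply (f i) x) \<longlongrightarrow> 0) F"
    and S: "totally_bdd S" and e: "0 < e"
  shows "\<forall>\<^sub>F i in F. \<forall>x\<in>S. cmod (blinfun_apply (f i) x) \<le> e"
proof -
  define k where "k = e / (2 * (\<bar>s\<bar> + 1))"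
  have k: "k > 0" using e by (simp add: k_def add_nonneg_pos)
  then obtain Z where Z: "finite Z" "\<forall>x\<in>S. \<exists>z\<in>Z. norm (x - z) < k"
    using S unfolding totally_bdd_def by blast
  have "\<forall>\<^sub>F i in F. \<forall>z\<in>Z. cmod (blinfun_apply (f i) z) < e / 2"
    unfolding eventually_ball_finite_distrib[OF Z(1)]
  proof
    fix z
    have "\<forall>\<^sub>F i in F. dist (blinfun_apply (f i) z) 0 < e / 2" using lim e by (intro tendstoD) auto
    then show "\<forall>\<^sub>F i in F. cmod (blinfun_apply (f i) z) < e / 2" by simp
  qed
  with F show ?thesis
  proof eventually_elim
    case (elim i)
    show ?case
    proof
      fix x assume "x \<in> S"
      then obtain z where z: "z \<in> Z" "norm (x - z) < k" using Z(2) by blast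
      have "cmod (blinfun_apply (f i) (x - z)) \<le> norm (f i) * norm (x - z)" by (rule norm_blinfun)
      also have "\<dots> \<le> (\<bar>s\<bar> + 1) * k" using elim(1) z(2) by (intro mult_mono) auto
      also have "\<dots> = e / 2"
      proof -
        have "r * (e / (2 * r)) = e / 2" if "r > 0" for r :: real using that by simp
        then show ?thesis unfolding k_def by (simp add: add_nonneg_pos del: distrib_left_numeral)
      qed
      finally have "cmod (blinfun_apply (f i) (x - z)) \<le> e / 2" .
      moreover have "cmod (blinfun_apply (f i) z) < e / 2" using elim(2) z(1) by blast
      moreover have "cmod (blinfun_apply (f i) x)
          \<le> cmod (blinfun_apply (f i) (x - z)) + cmod (blinfun_apply (f i) z)"
        using norm_triangle_ineq[of "blinfun_apply (f i) (x - z)" "blinfun_apply (f i) z"]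
        by (simp add: blinfun.diff_right)
      ultimately show "cmod (blinfun_apply (f i) x) \<le> e" by simp
    qed
  qed
qed

text \<open>
  Let \<open>\<phi>\<close> nearly attain its norm at \<open>x\<close>, and \<open>f i\<close> at \<open>y\<close>. Cut both down so that they become orthogonal:
  replace \<open>x\<close> by \<open>u = k x k'\<close> and \<open>y\<close> by \<open>y' = (1 - m) y (1 - m')\<close>. The sum \<open>u + y'\<close> is still in the unit ball. The
  difference \<open>y - y'\<close> stays in a totally bounded set because the cutoffs are compact elements, so \<open>f i\<close>, which
  tends to \<open>0\<close> weak*, is eventually small on it and hence does not notice the change. Nor does \<open>\<phi>\<close> notice
  \<open>y'\<close>: it has already spent its norm on \<open>u\<close>. So \<open>f i + \<phi>\<close> is nearly \<open>s + norm \<phi>\<close> at \<open>u + y'\<close>.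
\<close>

lemma lim_if_all_elements_compact:
  fixes f :: "'i \<Rightarrow> 'a::cstar_algebra \<Rightarrow>\<^sub>L complex"
  assumes compact: "\<And>a::'a. a \<in> compact_elements"
    and f: "\<forall>\<^sub>F i in F. f i \<in> dual_space \<and> norm (f i) = s"
    and lim: "\<And>x. ((\<lambda>i. blinfun_apply (f i) x) \<longlongrightarrow> 0) F"
    and \<phi>: "\<phi> \<in> dual_space"
  shows "((\<lambda>i. norm (f i + \<phi>)) \<longlongrightarrow> s + norm \<phi>) F"
proof (rule tendstoI)
  fix e :: real assume e: "0 < e"
  define h where "h = e / 8"
  have h: "0 < h" using e by (simp add: h_def)
  obtain x where x: "norm x \<le> 1" "norm \<phi> - h \<le> Re (blinfun_apply \<phi> x)"
    by (rule dual_almost_attains[OF \<phi> h])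
  define d where "d = h / (2 * (norm \<phi> + 1))"
  have np: "norm \<phi> + 1 > 0" by (simp add: add_nonneg_pos)
  have d: "d > 0" using h np by (simp add: d_def)
  obtain k m where km: "selfadj k" "selfadj m" "k * m = k" "\<And>z. norm (k * z) \<le> norm z"
    "\<And>z. norm (z - m * z) \<le> norm z" "norm (x - k * x) \<le> d"
    by (rule left_cutoffs_exist[OF x(1) d]) blast
  obtain k' m' where km': "selfadj k'" "selfadj m'" "k' * m' = k'" "\<And>z. norm (k' * z) \<le> norm z"
    "\<And>z. norm (z - m' * z) \<le> norm z" "norm (cstar x - k' * cstar x) \<le> d"
    by (rule left_cutoffs_exist[of "cstar x" d]) (use x d in auto)
  have star': "cstar k' = k'" "cstar m' = m'" using km' by (auto simp: selfadj_def)
  have k'r: "norm (z * k') \<le> norm z" for z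
    using km'(4)[of "cstar z"] norm_cstar[of "z * k'"] by (simp add: cstar_mult star' del: norm_cstar) simp
  have m'r: "norm (z - z * m') \<le> norm z" for z
    using km'(5)[of "cstar z"] norm_cstar[of "z - z * m'"]
    by (simp add: cstar_mult cstar_diff star' del: norm_cstar) simp
  have xk': "norm (x - x * k') \<le> d"
    using km'(6) norm_cstar[of "x - x * k'"] by (simp add: cstar_mult cstar_diff star')
  have m'k': "m' * k' = k'" using arg_cong[OF km'(3), of cstar] by (simp add: cstar_mult star')
  define u where "u = k * x * k'"
  define y' where "y' = (\<lambda>y. (y - m * y) - (y - m * y) * m')"
  define T where "T = (\<lambda>y. m * y + (y - m * y) * m') ` cball 0 1"
  have ux: "norm (x - u) \<le> 2 * d"
  proof -
    have eq: "x - u = (x - k * x) + k * (x - x * k')" by (simp add: u_def algebra_simps)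
    have "norm (x - u) \<le> norm (x - k * x) + norm (k * (x - x * k'))"
      unfolding eq by (rule norm_triangle_ineq)
    then show ?thesis using km(6) km(4)[of "x - x * k'"] xk' by simp
  qed
  have \<phi>u: "norm \<phi> - 2 * h \<le> Re (blinfun_apply \<phi> u)"
  proof -
    have "Re (blinfun_apply \<phi> (x - u)) \<le> norm \<phi> * norm (x - u)"
      by (rule order_trans[OF complex_Re_le_cmod norm_blinfun])
    also have "\<dots> \<le> (norm \<phi> + 1) * (2 * d)" using ux by (intro mult_mono) auto
    also have "\<dots> = h"
    proof -
      have "r * (2 * (h / (2 * r))) = h" if "r > 0" for r :: real using that by simp
      then show ?thesis unfolding d_def using np by blast
    qed
    finally show ?thesis using x(2) by (simp add: blinfun.diff_right)
  qed
  have nu: "norm u \<le> 1"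
    unfolding u_def using k'r[of "k * x"] km(4)[of x] x(1) by linarith
  have ny': "norm (y' y) \<le> norm y" for y
    unfolding y'_def using m'r[of "y - m * y"] km(5)[of y] by linarith
  have uy': "norm (u + c *\<^sub>C y' y) \<le> 1" if "norm y \<le> 1" "cmod c = 1" for y c
  proof (rule norm_orthogonal_add_le_1)
    have "k * y' y = 0"
    proof -
      have "k * (y - m * y) = 0" using km(3) by (simp add: right_diff_distrib mult.assoc[symmetric])
      then show ?thesis by (simp add: y'_def right_diff_distrib mult.assoc[symmetric])
    qed
    then show "cstar u * (c *\<^sub>C y' y) = 0"
      using km(1) by (simp add: u_def cstar_mult selfadj_def mult.assoc mult_scaleC_right)
    have "y' y * k' = 0" by (simp add: y'_def left_diff_distrib mult.assoc m'k')
    from arg_cong[OF this, of cstar] have "k' * cstar (y' y) = 0" by (simp add: cstar_mult star')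
    then show "u * cstar (c *\<^sub>C y' y) = 0"
      by (simp add: u_def cstar_scaleC mult.assoc mult_scaleC_right)
    show "norm (c *\<^sub>C y' y) \<le> 1" using ny'[of y] that by (simp add: norm_scaleC)
  qed (rule nu)
  \<comment> \<open>The phase \<open>c\<close> aligns the two values, so that their sum is bounded by the norm of \<open>\<phi>\<close>.\<close>
  have \<phi>y': "cmod (blinfun_apply \<phi> (y' y)) \<le> 2 * h" if y: "norm y \<le> 1" for y
  proof -
    obtain c where c: "cmod c = 1" "c * blinfun_apply \<phi> (y' y) = of_real (cmod (blinfun_apply \<phi> (y' y)))"
      by (rule cmod_phase)
    have "Re (blinfun_apply \<phi> (u + c *\<^sub>C y' y)) = Re (blinfun_apply \<phi> u) + cmod (blinfun_apply \<phi> (y' y))"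
      using \<phi> c(2) by (simp add: blinfun.add_right dual_space_def)
    moreover have "Re (blinfun_apply \<phi> (u + c *\<^sub>C y' y)) \<le> norm \<phi> * norm (u + c *\<^sub>C y' y)"
      by (rule order_trans[OF complex_Re_le_cmod norm_blinfun])
    moreover have "\<dots> \<le> norm \<phi>" using uy'[OF y c(1)] by (simp add: mult_left_le)
    ultimately show ?thesis using \<phi>u by linarith
  qed
  have "totally_bdd T"
    unfolding T_def
  proof (rule totally_bdd_add)
    show "totally_bdd ((\<lambda>y. m * y) ` cball 0 1)" by (rule compact_element_left[OF compact])
    have "totally_bdd ((\<lambda>q. q * m') ` cball 0 1)"
      using compact[of m'] by (simp add: compact_elements_def right_compact_def)
    moreover have "(\<lambda>y. (y - m * y) * m') ` cball 0 1 \<subseteq> (\<lambda>q. q * m') ` cball 0 1"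
    proof
      fix w assume "w \<in> (\<lambda>y. (y - m * y) * m') ` cball 0 1"
      then obtain y where y: "norm y \<le> 1" "w = (y - m * y) * m'" by auto
      then have "y - m * y \<in> cball 0 1" using km(5)[of y] by simp
      then show "w \<in> (\<lambda>q. q * m') ` cball 0 1" using y(2) by blast
    qed
    ultimately show "totally_bdd ((\<lambda>y. (y - m * y) * m') ` cball 0 1)" by (rule totally_bdd_subset)
  qed
  then have evT: "\<forall>\<^sub>F i in F. \<forall>t\<in>T. cmod (blinfun_apply (f i) t) \<le> h"
    using f by (intro dual_uniform_on_totally_bdd[where s = s] lim h) (auto elim: eventually_mono)
  have evu: "\<forall>\<^sub>F i in F. dist (blinfun_apply (f i) u) 0 < h" by (rule tendstoD[OF lim h])
  from f evT evu show "\<forall>\<^sub>F i in F. dist (norm (f i + \<phi>)) (s + norm \<phi>) < e"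
  proof eventually_elim
    case (elim i)
    obtain y where y: "norm y \<le> 1" "norm (f i) - h \<le> Re (blinfun_apply (f i) y)"
      using elim h dual_almost_attains[of "f i" h] by blast
    define t where "t = m * y + (y - m * y) * m'"
    have "t \<in> T" using y(1) by (auto simp: T_def t_def)
    then have t: "\<bar>Re (blinfun_apply (f i) t)\<bar> \<le> h"
      using elim(2) abs_Re_le_cmod order_trans by blast
    have yt: "y' y = y - t" by (simp add: y'_def t_def)
    have fu: "\<bar>Re (blinfun_apply (f i) u)\<bar> \<le> h"
      using elim(3) abs_Re_le_cmod[of "blinfun_apply (f i) u"] by simp
    have fy': "\<bar>Re (blinfun_apply \<phi> (y' y))\<bar> \<le> 2 * h"
      using \<phi>y'[OF y(1)] abs_Re_le_cmod[of "blinfun_apply \<phi> (y' y)"] by simp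
    have "Re (blinfun_apply (f i + \<phi>) (u + y' y)) \<le> norm (f i + \<phi>) * norm (u + y' y)"
      by (rule order_trans[OF complex_Re_le_cmod norm_blinfun])
    also have "\<dots> \<le> norm (f i + \<phi>)"
      using uy'[OF y(1), of 1] by (simp add: mult_left_le scaleC_one)
    finally have "Re (blinfun_apply (f i) u) + Re (blinfun_apply (f i) y) - Re (blinfun_apply (f i) t)
        + Re (blinfun_apply \<phi> u) + Re (blinfun_apply \<phi> (y' y)) \<le> norm (f i + \<phi>)"
      by (simp add: blinfun.add_left blinfun.add_right yt blinfun.diff_right)
    then have "s + norm \<phi> - 7 * h \<le> norm (f i + \<phi>)"
      using t fu fy' \<phi>u y(2) elim(1) by linarith
    moreover have "norm (f i + \<phi>) \<le> s + norm \<phi>" using elim(1) norm_triangle_ineq[of "f i" \<phi>] by simp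
    ultimately show ?case using h by (simp add: dist_real_def h_def)
  qed
qed

theorem corollary13:
  assumes "property_ddagger TYPE('a::cstar_algebra)"
  shows "lim_condition TYPE('i) TYPE('a)"
  unfolding lim_condition_def
proof (intro allI impI, elim conjE)
  fix s :: real and I :: "'i set" and le and f :: "'i \<Rightarrow> 'a \<Rightarrow>\<^sub>L complex" and \<phi> :: "'a \<Rightarrow>\<^sub>L complex"
  assume dir: "directed_set I le" and f: "\<forall>i\<in>I. f i \<in> dual_space \<and> norm (f i) = s"
    and lim: "limitin weak_star_topology f 0 (net_filter I le)" and \<phi>: "\<phi> \<in> dual_space"
  have "I \<noteq> {}" using dir by (simp add: directed_set_def)
  then have "\<forall>\<^sub>F i in net_filter I le. f i \<in> dual_space \<and> norm (f i) = s"
    unfolding eventually_net_filter[OF dir] using f by blast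
  moreover have "((\<lambda>i. blinfun_apply (f i) x) \<longlongrightarrow> 0) (net_filter I le)" for x
    using lim by (simp add: limitin_weak_star_iff blinfun.zero_left)
  ultimately show "((\<lambda>i. norm (f i + \<phi>)) \<longlongrightarrow> s + norm \<phi>) (net_filter I le)"
    by (rule lim_if_all_elements_compact[OF all_elements_compact[OF assms] _ _ \<phi>])
qed

end
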